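(* Let $X$ be a time-homogeneous Markov process with state space $S_{\Delta}$ and semigroup $(P_t)_{t\ge 0}$, and let $m\ge 0$ be an integer. Then the following assertions are equivalent: (i) $X$ is $m$-polynomial. (ii) For every $k\in\{0,\ldots,m\}$ there exists a linear map $A$ on $\mathcal{P}_k$ such that for all $t\ge 0$ the restriction of $P_t$ to $\mathcal{P}_k$ can be written as $P_t|_{\mathcal{P}_k}=e^{tA}$. (iii) For all $f\in\mathcal{P}_m$, $x\in S_\Delta$ and $t\ge 0$ one has $P_t|f|(x)=\mathbb{E}_x[|f(X_t)|]<\infty$, the process $$M_t^f=f(X_t)-f(x)-\int_0^t\mathcal{G}f(X_s)\,ds$$ is a true $(\mathcal{F}_t,\mathbb{P}_x)$-martingale, and the extended generator $\mathcal{G}$ satisfies $\mathcal{G}(\mathcal{P}_k)\subset\mathcal{P}_k$ for all $k\in\{0,1,\ldots,m\}$.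
   Context: Setting. $S\subseteq\mathbb{R}^n$ is closed with Borel $\sigma$-algebra $\mathcal{S}$; $\Delta\notin S$ is an adjoined cemetery point, $S_\Delta=S\cup\{\Delta\}$, $\mathcal{S}_\Delta=\sigma(\mathcal{S},\{\Delta\})$. Convention: $f(\Delta)=0$ for every function $f$ considered on $S$. $(p_t)_{t\ge0}$ is a time-homogeneous Markov transition function on $S_\Delta$ (measurability and Chapman–Kolmogorov) with $p_0(x,\cdot)=\delta_x$, $p_t(x,\{\Delta\})=1-p_t(x,S)$ for $x\in S$, and $p_t(\Delta,\{\Delta\})=1$. The semigroup is $P_tf(x)=\int_S f(\xi)\,p_t(x,d\xi)$, $x\in S_\Delta$, for all Borel $f:S_\Delta\to\mathbb{R}$ for which the integral is well defined. $\Omega$ is the space of càdlàg functions $\omega:\mathbb{R}_+\to S_\Delta$ such that each of $\omega(t-)=\Delta$ and $\omega(t)=\Delta$ implies $\omega(s)=\Delta$ for all $s\ge t$; $X_t(\omega)=\omega(t)$ is the coordinate process; $(\mathcal{F}_t)$ is a right continuous filtration containing the filtration generated by $X$, $\mathcal{F}=\bigvee_t\mathcal{F}_t$. For each $x\in S_\Delta$ there is a probability measure $\mathbb{P}_x$ on $(\Omega,\mathcal{F})$ under which $X$ is Markov relative to $(\mathcal{F}_t)$ with semigroup $(P_t)$ and initial value $x$: $\mathbb{E}_x[f(X_{t+s})|\mathcal{F}_s]=P_tf(X_s)$, $\mathbb{P}_x$-a.s., for all $s,t\ge0$ and all Borel $f:S_\Delta\to\mathbb{R}$ with $\mathbb{E}_x[|f(X_t)|]<\infty$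 for all $t\ge0$, $x\in S$. Polynomials. $\mathcal{P}_k$ is the finite-dimensional vector space of functions on $S_\Delta$ that on $S$ are restrictions of real polynomials on $\mathbb{R}^n$ of degree at most $k$ and that vanish at $\Delta$. $m$-polynomial. $X$ is called $m$-polynomial if for all $k\in\{0,\ldots,m\}$, all $f\in\mathcal{P}_k$ and $t\ge0$ the map $x\mapsto P_tf(x)$ belongs to $\mathcal{P}_k$ (it is implicitly required that $P_t|f|(x)<\infty$ for all $f\in\mathcal{P}_m$, $x\in S_\Delta$, $t\ge0$), and $t\mapsto P_tf(x)$ is continuous at $t=0$ for all $f\in\mathcal{P}_m$. Extended generator. $\mathcal{G}$ with domain $\mathcal{D}_\mathcal{G}$: $\mathcal{D}_\mathcal{G}$ consists of those Borel $f:S_\Delta\to\mathbb{R}$ for which there is a function $\mathcal{G}f$ such that $M^f_t:=f(X_t)-f(x)-\int_0^t\mathcal{G}f(X_s)\,ds$ is well defined and a $(\mathcal{F}_t,\mathbb{P}_x)$-local martingale for every $x\in S_\Delta$. *)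

theory Defs
  imports "HOL-Probability.Probability"
begin

text \<open>
  The state space is \<open>S \<subseteq> \<real>\<^sup>n\<close> with the cemetery adjoined; points of \<open>S\<close> are \<open>Some y\<close>, the
  cemetery is \<open>None\<close>. Real functions on the extended state space that have to be compared as
  functions (polynomials and their images under the semigroup) are represented by functions that
  are \<open>0\<close> outside the extended state space. Time runs through \<open>{0..}\<close>; values of \<open>F t\<close> and \<open>p t\<close>
  for negative \<open>t\<close> are irrelevant.
\<close>

type_synonym 'n state = "(real ^ 'n) option"
type_synonym 'n path = "real \<Rightarrow> 'n state"

definition states :: "(real ^ 'n) set \<Rightarrow> 'n::finite state set" where
  "states S = insert None (Some ` S)"

definition state_algebra :: "(real ^ 'n) set \<Rightarrow> 'n::finite state measure" where
  "state_algebra S = sigma (states S) (insert {None} ((`) Some ` sets (restrict_space borel S)))"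

text \<open>
  One-point compactification: the cemetery is the point at infinity if \<open>S\<close> is not compact,
  and an isolated point if \<open>S\<close> is compact.
\<close>

definition state_topology :: "(real ^ 'n) set \<Rightarrow> 'n::finite state topology" where
  "state_topology S = Alexandroff_compactification (top_of_set S)"

definition cadlag :: "'n::finite state topology \<Rightarrow> 'n path \<Rightarrow> bool" where
  "cadlag T w \<longleftrightarrow>
    (\<forall>t\<ge>0. limitin T w (w t) (at_right t)) \<and>
    (\<forall>t>0. \<exists>l. limitin T w l (at_left t))"

text \<open>Extensionality makes a path the same thing as a function on \<open>{0..}\<close>.\<close>

definition paths :: "(real ^ 'n) set \<Rightarrow> 'n::finite path set" where
  "paths S = {w \<in> {0..} \<rightarrow>\<^sub>E states S. cadlag (state_topology S) w \<and>
    (\<forall>t\<ge>0. w t = None \<longrightarrow> (\<forall>s\<ge>t. w s = None)) \<and>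
    (\<forall>t>0. limitin (state_topology S) w None (at_left t) \<longrightarrow> (\<forall>s\<ge>t. w s = None))}"

text \<open>The integral runs over \<open>S\<close> only, so the value of \<open>f\<close> at the cemetery does not enter.\<close>

definition transition_semigroup :: "(real ^ 'n) set \<Rightarrow> (real \<Rightarrow> 'n::finite state \<Rightarrow> 'n state measure) \<Rightarrow>
    real \<Rightarrow> ('n state \<Rightarrow> real) \<Rightarrow> 'n state \<Rightarrow> real" where
  "transition_semigroup S p t f x =
    (if x \<in> states S then set_lebesgue_integral (p t x) (Some ` S) f else 0)"

text \<open>\<open>P\<^sub>t\<bar>f\<bar>(x)\<close> with values in \<open>[0, \<infinity>]\<close>.\<close>

definition transition_semigroup_abs :: "(real ^ 'n) set \<Rightarrow> (real \<Rightarrow> 'n::finite state \<Rightarrow> 'n state measure) \<Rightarrow>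
    real \<Rightarrow> ('n state \<Rightarrow> real) \<Rightarrow> 'n state \<Rightarrow> ennreal" where
  "transition_semigroup_abs S p t f x = (\<integral>\<^sup>+ y \<in> Some ` S. ennreal \<bar>f y\<bar> \<partial>p t x)"

locale transition_function =
  fixes S :: "(real ^ 'n::finite) set"
    and p :: "real \<Rightarrow> 'n state \<Rightarrow> 'n state measure"
  assumes closed_S: "closed S"
    and kernel: "\<And>t. t \<ge> 0 \<Longrightarrow>
      p t \<in> state_algebra S \<rightarrow>\<^sub>M subprob_algebra (state_algebra S)"
    and chapman_kolmogorov: "\<And>s t x B. s \<ge> 0 \<Longrightarrow> t \<ge> 0 \<Longrightarrow> x \<in> states S \<Longrightarrow>
      B \<in> sets (state_algebra S) \<Longrightarrow>
      emeasure (p (s + t) x) B = (\<integral>\<^sup>+ y. emeasure (p t y) B \<partial>p s x)"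
    and initial_kernel: "\<And>x. x \<in> states S \<Longrightarrow> p 0 x = return (state_algebra S) x"
    and killing: "\<And>t y. t \<ge> 0 \<Longrightarrow> y \<in> S \<Longrightarrow>
      measure (p t (Some y)) {None} = 1 - measure (p t (Some y)) (Some ` S)"
    and absorbing: "\<And>t. t \<ge> 0 \<Longrightarrow> measure (p t None) {None} = 1"

text \<open>
  The coordinate process is \<open>\<lambda>t w. w t\<close>; \<open>Pr x\<close> is the law of the process started at \<open>x\<close>.
  The Markov property is stated for \<open>f\<close> vanishing at the cemetery: the semigroup integrates
  over \<open>S\<close> only, so it would be inconsistent for other \<open>f\<close>.
\<close>

locale markov_process = transition_function S p
  for S :: "(real ^ 'n::finite) set" and p :: "real \<Rightarrow> 'n state \<Rightarrow> 'n state measure" +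
  fixes F :: "real \<Rightarrow> 'n path measure"
    and Pr :: "'n state \<Rightarrow> 'n path measure"
  assumes space_F: "\<And>t. t \<ge> 0 \<Longrightarrow> space (F t) = paths S"
    and mono_F: "\<And>s t. 0 \<le> s \<Longrightarrow> s \<le> t \<Longrightarrow> sets (F s) \<subseteq> sets (F t)"
    and right_continuous_F: "\<And>t. t \<ge> 0 \<Longrightarrow> sets (F t) = (\<Inter>s\<in>{t<..}. sets (F s))"
    and adapted: "\<And>t. t \<ge> 0 \<Longrightarrow> (\<lambda>w. w t) \<in> F t \<rightarrow>\<^sub>M state_algebra S"
    and prob_space_Pr: "\<And>x. x \<in> states S \<Longrightarrow> prob_space (Pr x)"
    and space_Pr: "\<And>x. x \<in> states S \<Longrightarrow> space (Pr x) = paths S"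
    and sets_Pr: "\<And>x. x \<in> states S \<Longrightarrow>
      sets (Pr x) = sigma_sets (paths S) (\<Union>t\<in>{0..}. sets (F t))"
    and initial_value: "\<And>x. x \<in> states S \<Longrightarrow> AE w in Pr x. w 0 = x"
    and markov: "\<And>f x s t. f \<in> borel_measurable (state_algebra S) \<Longrightarrow> f None = 0 \<Longrightarrow>
      (\<And>y u. y \<in> S \<Longrightarrow> u \<ge> 0 \<Longrightarrow> integrable (Pr (Some y)) (\<lambda>w. f (w u))) \<Longrightarrow>
      x \<in> states S \<Longrightarrow> s \<ge> 0 \<Longrightarrow> t \<ge> 0 \<Longrightarrow>
      AE w in Pr x. real_cond_exp (Pr x) (F s) (\<lambda>w. f (w (t + s))) w = transition_semigroup S p t f (w s)"

definition polynomial_of_degree_le :: "nat \<Rightarrow> (real ^ 'n::finite \<Rightarrow> real) \<Rightarrow> bool" where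
  "polynomial_of_degree_le k q \<longleftrightarrow> (\<exists>c :: ('n \<Rightarrow> nat) \<Rightarrow> real.
    \<forall>y. q y = (\<Sum>a | (\<Sum>i\<in>UNIV. a i) \<le> k. c a * (\<Prod>i\<in>UNIV. (y $ i) ^ a i)))"

definition polys :: "(real ^ 'n) set \<Rightarrow> nat \<Rightarrow> ('n::finite state \<Rightarrow> real) set" where
  "polys S k = {f. (\<exists>q. polynomial_of_degree_le k q \<and> (\<forall>y\<in>S. f (Some y) = q y)) \<and>
    f None = 0 \<and> (\<forall>x. x \<notin> states S \<longrightarrow> f x = 0)}"

definition m_polynomial ::
  "(real ^ 'n) set \<Rightarrow> (real \<Rightarrow> 'n::finite state \<Rightarrow> 'n state measure) \<Rightarrow> nat \<Rightarrow> bool" where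
  "m_polynomial S p m \<longleftrightarrow>
    (\<forall>f\<in>polys S m. \<forall>x\<in>states S. \<forall>t\<ge>0. transition_semigroup_abs S p t f x < \<infinity>) \<and>
    (\<forall>k\<le>m. \<forall>f\<in>polys S k. \<forall>t\<ge>0. transition_semigroup S p t f \<in> polys S k) \<and>
    (\<forall>f\<in>polys S m. \<forall>x\<in>states S. continuous (at 0 within {0..}) (\<lambda>t. transition_semigroup S p t f x))"

definition linear_map_on :: "('a \<Rightarrow> real) set \<Rightarrow> (('a \<Rightarrow> real) \<Rightarrow> 'a \<Rightarrow> real) \<Rightarrow> bool" where
  "linear_map_on V A \<longleftrightarrow> (\<forall>f\<in>V. A f \<in> V) \<and>
    (\<forall>f\<in>V. \<forall>g\<in>V. A (\<lambda>x. f x + g x) = (\<lambda>x. A f x + A g x)) \<and>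
    (\<forall>c. \<forall>f\<in>V. A (\<lambda>x. c * f x) = (\<lambda>x. c * A f x))"

text \<open>
  \<open>e\<^sup>t\<^sup>A f\<close> as the exponential series. On a finite-dimensional space of functions the
  vector space topology is that of pointwise convergence, so the series may be summed pointwise.
\<close>

definition exp_map :: "real \<Rightarrow> (('a \<Rightarrow> real) \<Rightarrow> 'a \<Rightarrow> real) \<Rightarrow> ('a \<Rightarrow> real) \<Rightarrow> 'a \<Rightarrow> real" where
  "exp_map t A f x = (\<Sum>j. t ^ j / fact j * (A ^^ j) f x)"

definition martingale ::
  "'w measure \<Rightarrow> (real \<Rightarrow> 'w measure) \<Rightarrow> (real \<Rightarrow> 'w \<Rightarrow> real) \<Rightarrow> bool" where
  "martingale N F M \<longleftrightarrow>
    (\<forall>t\<ge>0. M t \<in> borel_measurable (F t) \<and> integrable N (M t)) \<and>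
    (\<forall>s\<ge>0. \<forall>t\<ge>s. AE w in N. real_cond_exp N (F s) (M t) w = M s w)"

text \<open>The localizing stopping times may take the value \<open>\<infinity>\<close>.\<close>

definition local_martingale ::
  "'w measure \<Rightarrow> (real \<Rightarrow> 'w measure) \<Rightarrow> (real \<Rightarrow> 'w \<Rightarrow> real) \<Rightarrow> bool" where
  "local_martingale N F M \<longleftrightarrow>
    (\<forall>t\<ge>0. M t \<in> borel_measurable (F t)) \<and>
    (AE w in N. \<forall>t\<ge>0. continuous (at_right t) (\<lambda>s. M s w)) \<and>
    (\<exists>\<tau> :: nat \<Rightarrow> 'w \<Rightarrow> ennreal.
      (\<forall>n. \<forall>t\<ge>0. Measurable.pred (F t) (\<lambda>w. \<tau> n w \<le> ennreal t)) \<and>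
      (AE w in N. incseq (\<lambda>n. \<tau> n w) \<and> (\<lambda>n. \<tau> n w) \<longlonglongrightarrow> \<infinity>) \<and>
      (\<forall>n. martingale N F (\<lambda>t w. M (enn2real (min (ennreal t) (\<tau> n w))) w)))"

text \<open>The process \<open>M\<^sup>f\<close>, with \<open>g\<close> in the role of the generator applied to \<open>f\<close>.\<close>

definition gen_process :: "('n::finite state \<Rightarrow> real) \<Rightarrow> ('n state \<Rightarrow> real) \<Rightarrow> 'n state \<Rightarrow>
    real \<Rightarrow> 'n path \<Rightarrow> real" where
  "gen_process f g x t w = f (w t) - f x - set_lebesgue_integral lborel {0..t} (\<lambda>s. g (w s))"

text \<open>
  The function \<open>g\<close> is determined by \<open>f\<close> only up to modification on sets that the process does
  not charge, so the defining condition of the extended generator is a relation between \<open>f\<close> and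
  \<open>g\<close>. Its domain consists of the \<open>f\<close> that have such a \<open>g\<close>; an operator \<open>G\<close> is a version
  of the extended generator if it selects such a \<open>g = G f\<close> for every \<open>f\<close> in the domain.
\<close>

definition generator_rel :: "(real ^ 'n) set \<Rightarrow> (real \<Rightarrow> 'n::finite path measure) \<Rightarrow>
    ('n state \<Rightarrow> 'n path measure) \<Rightarrow> ('n state \<Rightarrow> real) \<Rightarrow> ('n state \<Rightarrow> real) \<Rightarrow> bool" where
  "generator_rel S F Pr f g \<longleftrightarrow>
    f \<in> borel_measurable (state_algebra S) \<and> g \<in> borel_measurable (state_algebra S) \<and>
    (\<forall>x\<in>states S.
      (AE w in Pr x. \<forall>t\<ge>0. set_integrable lborel {0..t} (\<lambda>s. g (w s))) \<and>
      local_martingale (Pr x) F (gen_process f g x))"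

definition generator_domain :: "(real ^ 'n) set \<Rightarrow> (real \<Rightarrow> 'n::finite path measure) \<Rightarrow>
    ('n state \<Rightarrow> 'n path measure) \<Rightarrow> ('n state \<Rightarrow> real) set" where
  "generator_domain S F Pr = {f. \<exists>g. generator_rel S F Pr f g}"

definition extended_generator :: "(real ^ 'n) set \<Rightarrow> (real \<Rightarrow> 'n::finite path measure) \<Rightarrow>
    ('n state \<Rightarrow> 'n path measure) \<Rightarrow> (('n state \<Rightarrow> real) \<Rightarrow> ('n state \<Rightarrow> real)) \<Rightarrow> bool" where
  "extended_generator S F Pr G \<longleftrightarrow> (\<forall>f\<in>generator_domain S F Pr. generator_rel S F Pr f (G f))"

definition semigroup_is_exp ::
  "(real ^ 'n) set \<Rightarrow> (real \<Rightarrow> 'n::finite state \<Rightarrow> 'n state measure) \<Rightarrow> nat \<Rightarrow> bool" where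
  "semigroup_is_exp S p m \<longleftrightarrow> (\<forall>k\<le>m. \<exists>A. linear_map_on (polys S k) A \<and>
    (\<forall>t\<ge>0. \<forall>f\<in>polys S k.
      (\<forall>x\<in>states S. transition_semigroup_abs S p t f x < \<infinity>) \<and> transition_semigroup S p t f = exp_map t A f))"

definition martingale_generator_condition ::
  "(real ^ 'n) set \<Rightarrow> (real \<Rightarrow> 'n::finite state \<Rightarrow> 'n state measure) \<Rightarrow>
    (real \<Rightarrow> 'n path measure) \<Rightarrow> ('n state \<Rightarrow> 'n path measure) \<Rightarrow> nat \<Rightarrow> bool" where
  "martingale_generator_condition S p F Pr m \<longleftrightarrow>
    (\<forall>f\<in>polys S m. \<forall>x\<in>states S. \<forall>t\<ge>0.
      transition_semigroup_abs S p t f x = (\<integral>\<^sup>+ w. ennreal \<bar>f (w t)\<bar> \<partial>Pr x) \<and>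
      transition_semigroup_abs S p t f x < \<infinity>) \<and>
    (\<exists>G. extended_generator S F Pr G \<and> polys S m \<subseteq> generator_domain S F Pr \<and>
      (\<forall>f\<in>polys S m. \<forall>x\<in>states S. martingale (Pr x) F (gen_process f (G f) x)) \<and>
      (\<forall>k\<le>m. G ` polys S k \<subseteq> polys S k))"

end

theory Submission
  imports Defs
begin

text \<open>
  On the finite-dimensional space \<open>polys S k\<close> the semigroup is a continuous one-parameter semigroup of
  matrices, hence an exponential; conversely the exponential series stays in the space. If
  \<open>P\<^sub>t = e\<^sup>t\<^sup>A\<close>, differentiating \<open>E[1\<^sub>B f(X\<^sub>u)]\<close> for \<open>B\<close> known at time \<open>s\<close> shows that \<open>M\<^sup>f\<close> with \<open>G f = A f\<close>
  is a martingale. Conversely, taking expectations in \<open>M\<^sup>f\<close> gives \<open>P\<^sub>t f = f + \<integral> P\<^sub>s G f ds\<close>, whose only solution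
  is the exponential.

  Both passages exchange expectation and time integral, which needs \<open>E |f(X\<^sub>s)|\<close> integrable over
  \<open>s \<in> [0, T]\<close>. The degree of \<open>f\<close> may be the highest one with finite moments and odd, so \<open>\<bar>f\<bar>\<close> need not be
  dominated by a polynomial in the space. Given the exponential, invertibility of \<open>P\<^sub>h\<close> for small \<open>h\<close> carries the
  moments at time \<open>T\<close> back to earlier times; given the martingales, \<open>E |M\<^sub>s| \<le> E |M\<^sub>T|\<close> and a pathwise
  Gronwall inequality bound \<open>f(X)\<close> in terms of \<open>M\<close>.
\<close>

section \<open>Finite-dimensional spaces of functions\<close>

text \<open>The regularity assumed of the semigroup is continuity of \<open>P t f x\<close> at time
  0 for each fixed \<open>x\<close>. Working with values at finitely many nodes makes this enough:
  norms are finite sums, and limits, integrals and derivatives are taken pointwise. No generator is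
  given in advance; it arises because time averages of an orbit are differentiable and a subspace of
  a finite-dimensional space is closed. Two points shape the passage from the martingales.
  \<open>G\<close> is a selection from a relation and need not be linear, so a linear map is built
  from its values on a basis. Also, invariance of \<open>polys S k\<close> under the semigroup is
  then part of the goal, so the differential equation is solved at one starting point at a time,
  with \<open>P t f x\<close> as a functional of \<open>f\<close>. The linear maps for different
  degrees are unrelated at first; they are identified as derivatives at time 0 of the same
  function.\<close>

definition function_subspace :: "('a \<Rightarrow> real) set \<Rightarrow> bool" where
  "function_subspace V \<longleftrightarrow> (\<lambda>x. 0) \<in> V \<and> (\<forall>f\<in>V. \<forall>g\<in>V. (\<lambda>x. f x + g x) \<in> V) \<and>
    (\<forall>c. \<forall>f\<in>V. (\<lambda>x. c * f x) \<in> V)"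

lemma function_subspaceD:
  assumes "function_subspace V"
  shows "(\<lambda>x. 0) \<in> V"
    and "f \<in> V \<Longrightarrow> g \<in> V \<Longrightarrow> (\<lambda>x. f x + g x) \<in> V"
    and "f \<in> V \<Longrightarrow> (\<lambda>x. c * f x) \<in> V"
  using assms by (auto simp: function_subspace_def)

lemma function_subspace_diff:
  assumes "function_subspace V" "f \<in> V" "g \<in> V"
  shows "(\<lambda>x. f x - g x) \<in> V"
  using function_subspaceD(2)[OF assms(1,2) function_subspaceD(3)[OF assms(1,3), of "-1"]] by simp

lemma function_subspace_sum:
  assumes "function_subspace V" "finite J" "\<And>j. j \<in> J \<Longrightarrow> g j \<in> V"
  shows "(\<lambda>x. \<Sum>j\<in>J. c j * g j x) \<in> V"
  using assms(2,3)
proof (induction J rule: finite_induct)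
  case empty
  then show ?case using function_subspaceD(1)[OF assms(1)] by simp
next
  case (insert j J)
  then show ?case
    using function_subspaceD(2)[OF assms(1) function_subspaceD(3)[OF assms(1)], of "g j" "\<lambda>x. \<Sum>j\<in>J. c j * g j x" "c j"]
    by simp
qed

text \<open>A basis of Lagrange type: the coordinates of a function are its values at finitely many nodes,
  so that pointwise convergence is convergence in the finite-dimensional space.\<close>

lemma linear_mapD:
  assumes "linear_map_on V A"
  shows "f \<in> V \<Longrightarrow> A f \<in> V"
    and "f \<in> V \<Longrightarrow> g \<in> V \<Longrightarrow> A (\<lambda>x. f x + g x) = (\<lambda>x. A f x + A g x)"
    and "f \<in> V \<Longrightarrow> A (\<lambda>x. c * f x) = (\<lambda>x. c * A f x)"
  using assms unfolding linear_map_on_def by simp_all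

locale nodal_space =
  fixes V :: "('a \<Rightarrow> real) set" and X :: "'a set" and e :: "'a \<Rightarrow> 'a \<Rightarrow> real"
  assumes subspace: "function_subspace V"
    and finite_nodes: "finite X"
    and basis_in: "\<And>y. y \<in> X \<Longrightarrow> e y \<in> V"
    and expansion: "\<And>f x. f \<in> V \<Longrightarrow> f x = (\<Sum>y\<in>X. f y * e y x)"

text \<open>Elimination on the number of generators: normalise some \<open>f0\<close> in
  \<open>V\<close> to be 1 at a point \<open>x0\<close> and pass to the functions of
  \<open>V\<close> vanishing there, which need one generator less. The generators \<open>b\<close>
  may lie outside \<open>V\<close>, so subspaces such as \<open>smooth_vectors\<close> are
  covered.\<close>

lemma nodal_space_exists:
  fixes V :: "('a \<Rightarrow> real) set"
  assumes "finite I" "function_subspace V"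
    and "\<And>f. f \<in> V \<Longrightarrow> \<exists>c. f = (\<lambda>x. \<Sum>i\<in>I. c i * b i x)"
  obtains X e where "nodal_space V X e"
proof -
  have "\<exists>X e. nodal_space V X e"
    using assms
  proof (induction "card I" arbitrary: I V b)
    case 0
    then have "f = (\<lambda>x. 0)" if "f \<in> V" for f using that by fastforce
    then have "nodal_space V {} (\<lambda>_ _. 0)"
      using 0 by unfold_locales auto
    then show ?case by blast
  next
    case (Suc n)
    show ?case
    proof (cases "V = {\<lambda>x. 0}")
      case True
      then have "nodal_space V {} (\<lambda>_ _. 0)"
        using Suc by unfold_locales auto
      then show ?thesis by blast
    next
      case False
      then obtain f1 x0 where f1: "f1 \<in> V" "f1 x0 \<noteq> 0"
        using function_subspaceD(1)[OF Suc.prems(2)] by fastforce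
      define f0 where "f0 = (\<lambda>x. (1 / f1 x0) * f1 x)"
      have f0: "f0 \<in> V" "f0 x0 = 1"
        using f1(2) function_subspaceD(3)[OF Suc.prems(2) f1(1), of "1 / f1 x0"] by (simp_all add: f0_def)
      obtain c where c: "f0 = (\<lambda>x. \<Sum>i\<in>I. c i * b i x)" using Suc.prems(3) f0 by blast
      obtain j where j: "j \<in> I" "c j \<noteq> 0"
        using f0(2) unfolding c by (metis (no_types, lifting) mult_zero_left sum.neutral zero_neq_one)
      define V' where "V' = {f\<in>V. f x0 = 0}"
      define b' where "b' = (\<lambda>i x. b i x - b i x0 * f0 x)"
      have "n = card (I - {j})" using Suc j by simp
      moreover have "finite (I - {j})" using Suc by simp
      moreover have "function_subspace V'"
        using Suc.prems(2) by (auto simp: V'_def function_subspace_def)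
      moreover have "\<exists>c. f = (\<lambda>x. \<Sum>i\<in>I - {j}. c i * b' i x)" if "f \<in> V'" for f
      proof -
        obtain d where d: "f = (\<lambda>x. \<Sum>i\<in>I. d i * b i x)" using Suc.prems(3)[of f] \<open>f \<in> V'\<close> unfolding V'_def by blast
        \<comment> \<open>Subtracting \<open>d j / c j\<close> times \<open>f0\<close> cancels
          \<open>b j\<close>. At \<open>x0\<close>, where \<open>f\<close> is 0 and
          \<open>f0\<close> is 1, the same identity evaluates to \<open>- d j / c j\<close>, and
          this turns the \<open>b i\<close> into the \<open>b' i\<close>.\<close>
        define d' where "d' = (\<lambda>i. d i - d j / c j * c i)"
        have bj: "f x - d j / c j * f0 x = (\<Sum>i\<in>I - {j}. d' i * b i x)" for x
          unfolding c d d'_def using j Suc.prems(1)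
          by (simp add: sum.remove[OF Suc.prems(1) j(1)] algebra_simps sum_subtractf sum_distrib_left)
        have "f x = (\<Sum>i\<in>I - {j}. d' i * b' i x)" for x
        proof -
          have "0 - d j / c j = (\<Sum>i\<in>I - {j}. d' i * b i x0)"
            using bj[of x0] f0(2) that by (simp add: V'_def)
          then have "f x = (\<Sum>i\<in>I - {j}. d' i * b i x) - (\<Sum>i\<in>I - {j}. d' i * b i x0) * f0 x"
            using bj[of x] by (simp flip: \<open>0 - d j / c j = _\<close>)
          then show ?thesis
            by (simp add: b'_def algebra_simps sum_subtractf sum_distrib_left)
        qed
        then show ?thesis by blast
      qed
      ultimately obtain X' e' where "nodal_space V' X' e'"
        using Suc.hyps(1)[of "I - {j}" V' b'] by blast
      then interpret nodal_space V' X' e' .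
      \<comment> \<open>In \<open>f = f x0 * f0 + (f - f x0 * f0)\<close> the second summand is
        expanded over \<open>X'\<close>; collecting the multiples of \<open>f x0\<close> gives the
        function attached to \<open>x0\<close>. If \<open>x0\<close> already lies in
        \<open>X'\<close>, its coefficient there is 0, since functions in \<open>V'\<close> vanish
        at \<open>x0\<close>.\<close>
      define e where "e = (\<lambda>y. if y = x0 then \<lambda>x. f0 x - (\<Sum>z\<in>X' - {x0}. f0 z * e' z x) else e' y)"
      have e'V: "e' y \<in> V" if "y \<in> X'" for y using basis_in[OF that] by (simp add: V'_def)
      have sub: "(\<lambda>x. \<Sum>z\<in>X' - {x0}. f0 z * e' z x) \<in> V"
        using finite_nodes e'V by (intro function_subspace_sum[OF Suc.prems(2)]) auto
      have "nodal_space V (insert x0 X') e"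
      proof
        show "function_subspace V" "finite (insert x0 X')" using Suc finite_nodes by auto
        show "e y \<in> V" if "y \<in> insert x0 X'" for y
          using that e'V f0 sub function_subspace_diff[OF Suc.prems(2)] by (auto simp: e_def)
        fix f x assume f: "f \<in> V"
        have "(\<lambda>x. f x - f x0 * f0 x) \<in> V'"
          using f f0 function_subspace_diff[OF Suc.prems(2) f function_subspaceD(3)[OF Suc.prems(2) f0(1)], of "f x0"]
          by (auto simp: V'_def)
        from expansion[OF this, of x]
        have "f x - f x0 * f0 x = (\<Sum>y\<in>X' - {x0}. (f y - f x0 * f0 y) * e' y x)"
          using f0(2) finite_nodes
          by (cases "x0 \<in> X'") (auto simp: sum.remove)
        then have "f x = f x0 * e x0 x + (\<Sum>y\<in>X' - {x0}. f y * e' y x)"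
          by (simp add: e_def algebra_simps sum_subtractf sum_distrib_left)
        also have "(\<Sum>y\<in>X' - {x0}. f y * e' y x) = (\<Sum>y\<in>X' - {x0}. f y * e y x)"
          by (rule sum.cong) (auto simp: e_def)
        finally show "f x = (\<Sum>y\<in>insert x0 X'. f y * e y x)"
          using finite_nodes by (simp add: sum.insert_remove)
      qed
      then show ?thesis by blast
    qed
  qed
  then show ?thesis using that by blast
qed

section \<open>Limits, linear maps and exponential series on a nodal space\<close>

context nodal_space
begin

text \<open>The nodal expansion involves finitely many values, so it passes to the limit: a
  finite-dimensional space is closed under pointwise convergence.\<close>

lemma limit_in:
  assumes "F \<noteq> bot" "\<forall>\<^sub>F n in F. g n \<in> V" "\<And>x. ((\<lambda>n. g n x) \<longlongrightarrow> f x) F"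
  shows "f \<in> V"
proof -
  have eq: "f = (\<lambda>x. \<Sum>y\<in>X. f y * e y x)"
  proof
    fix x
    have "((\<lambda>n. \<Sum>y\<in>X. g n y * e y x) \<longlongrightarrow> (\<Sum>y\<in>X. f y * e y x)) F"
      by (intro tendsto_intros assms)
    then have "((\<lambda>n. g n x) \<longlongrightarrow> (\<Sum>y\<in>X. f y * e y x)) F"
      by (rule Lim_transform_eventually) (use assms(2) in eventually_elim, rule expansion[symmetric])
    then show "f x = (\<Sum>y\<in>X. f y * e y x)"
      by (rule tendsto_unique[OF assms(1,3)])
  qed
  have "(\<lambda>x. \<Sum>y\<in>X. f y * e y x) \<in> V"
    by (rule function_subspace_sum[OF subspace finite_nodes basis_in])
  then show ?thesis unfolding eq[symmetric] .
qed

lemma linear_sum: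
  assumes "linear_map_on V A" "finite J" "\<And>j. j \<in> J \<Longrightarrow> g j \<in> V"
  shows "A (\<lambda>x. \<Sum>j\<in>J. c j * g j x) = (\<lambda>x. \<Sum>j\<in>J. c j * A (g j) x)"
  using assms(2,3)
proof (induction J rule: finite_induct)
  case empty
  show ?case using linear_mapD(3)[OF assms(1) function_subspaceD(1)[OF subspace], of 0] by simp
next
  case (insert j J)
  have j: "(\<lambda>x. c j * g j x) \<in> V" and J: "(\<lambda>x. \<Sum>j\<in>J. c j * g j x) \<in> V"
    using insert by (auto intro!: function_subspace_sum[OF subspace] function_subspaceD(3)[OF subspace])
  have "A (\<lambda>x. \<Sum>j\<in>J. c j * g j x) = (\<lambda>x. \<Sum>j\<in>J. c j * A (g j) x)"
    using insert by auto
  then show ?case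
    unfolding sum.insert[OF insert.hyps] linear_mapD(2)[OF assms(1) j J]
    by (simp add: linear_mapD(3)[OF assms(1)] insert.prems)
qed

lemma linear_expansion:
  assumes "linear_map_on V A" "f \<in> V"
  shows "A f x = (\<Sum>y\<in>X. f y * A (e y) x)"
proof -
  have eq: "f = (\<lambda>x. \<Sum>y\<in>X. f y * e y x)" by (rule ext, rule expansion[OF assms(2)])
  have "A (\<lambda>x. \<Sum>y\<in>X. f y * e y x) = (\<lambda>x. \<Sum>y\<in>X. f y * A (e y) x)"
    by (rule linear_sum[OF assms(1) finite_nodes basis_in])
  from this[folded eq] show ?thesis by (rule fun_cong)
qed

lemma linear_map_from_basis:
  assumes "\<And>y. y \<in> X \<Longrightarrow> d y \<in> V"
  shows "linear_map_on V (\<lambda>f x. \<Sum>y\<in>X. f y * d y x)"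
  unfolding linear_map_on_def
  using function_subspace_sum[OF subspace finite_nodes assms]
  by (auto simp: algebra_simps sum.distrib sum_distrib_left)

text \<open>With the identity for \<open>A\<close> this dominates \<open>f\<close> at an arbitrary
  point by its node values, the form in which functions are later controlled along paths.\<close>

lemma linear_bound:
  assumes "linear_map_on V A" "f \<in> V"
  shows "\<bar>A f x\<bar> \<le> (\<Sum>y\<in>X. \<bar>f y\<bar>) * (\<Sum>y\<in>X. \<bar>A (e y) x\<bar>)"
proof -
  have "\<bar>A f x\<bar> \<le> (\<Sum>y\<in>X. \<bar>f y\<bar> * \<bar>A (e y) x\<bar>)"
    unfolding linear_expansion[OF assms, of x] by (rule order_trans[OF sum_abs]) (simp add: abs_mult)
  also have "\<dots> \<le> (\<Sum>y\<in>X. \<bar>f y\<bar> * (\<Sum>y\<in>X. \<bar>A (e y) x\<bar>))"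
    using finite_nodes by (intro sum_mono mult_left_mono member_le_sum) auto
  finally show ?thesis by (simp add: sum_distrib_right)
qed

lemma power_in:
  assumes "linear_map_on V A" "f \<in> V"
  shows "(A ^^ n) f \<in> V"
  by (induction n) (use assms in \<open>auto simp: linear_map_on_def\<close>)

text \<open>The entrywise sum norm of the matrix of \<open>A\<close> at the nodes. It dominates the
  operator norm belonging to the sum of absolute node values but is not normalised: the identity
  need not get the value 1.\<close>

definition operator_bound :: "(('a \<Rightarrow> real) \<Rightarrow> 'a \<Rightarrow> real) \<Rightarrow> real" where
  "operator_bound A = (\<Sum>x\<in>X. \<Sum>y\<in>X. \<bar>A (e y) x\<bar>)"

lemma operator_bound_nonneg: "operator_bound A \<ge> 0"
  by (simp add: operator_bound_def sum_nonneg)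

lemma operator_bound:
  assumes "linear_map_on V A" "f \<in> V"
  shows "(\<Sum>x\<in>X. \<bar>A f x\<bar>) \<le> operator_bound A * (\<Sum>y\<in>X. \<bar>f y\<bar>)"
proof -
  have "(\<Sum>x\<in>X. \<bar>A f x\<bar>) \<le> (\<Sum>x\<in>X. (\<Sum>y\<in>X. \<bar>f y\<bar>) * (\<Sum>y\<in>X. \<bar>A (e y) x\<bar>))"
    by (intro sum_mono linear_bound assms)
  then show ?thesis by (simp add: operator_bound_def sum_distrib_left mult.commute)
qed

lemma power_bound:
  assumes "linear_map_on V A" "f \<in> V"
  shows "(\<Sum>x\<in>X. \<bar>(A ^^ n) f x\<bar>) \<le> operator_bound A ^ n * (\<Sum>y\<in>X. \<bar>f y\<bar>)"
proof (induction n)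
  case (Suc n)
  have "(\<Sum>x\<in>X. \<bar>(A ^^ Suc n) f x\<bar>) \<le> operator_bound A * (\<Sum>y\<in>X. \<bar>(A ^^ n) f y\<bar>)"
    using operator_bound[OF assms(1) power_in[OF assms]] by simp
  also have "\<dots> \<le> operator_bound A * (operator_bound A ^ n * (\<Sum>y\<in>X. \<bar>f y\<bar>))"
    by (intro mult_left_mono Suc operator_bound_nonneg)
  finally show ?case by (simp add: algebra_simps)
qed simp

lemma linear_map_on_id: "linear_map_on V (\<lambda>f. f)"
  by (simp add: linear_map_on_def)

lemma power_bound_pointwise:
  assumes "linear_map_on V A" "f \<in> V"
  shows "\<bar>(A ^^ n) f x\<bar> \<le> operator_bound A ^ n * ((\<Sum>y\<in>X. \<bar>f y\<bar>) * (\<Sum>y\<in>X. \<bar>e y x\<bar>))"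
proof -
  have "\<bar>(A ^^ n) f x\<bar> \<le> (\<Sum>y\<in>X. \<bar>(A ^^ n) f y\<bar>) * (\<Sum>y\<in>X. \<bar>e y x\<bar>)"
    using linear_bound[OF linear_map_on_id power_in[OF assms]] by simp
  also have "\<dots> \<le> (operator_bound A ^ n * (\<Sum>y\<in>X. \<bar>f y\<bar>)) * (\<Sum>y\<in>X. \<bar>e y x\<bar>)"
    by (intro mult_right_mono power_bound assms sum_nonneg) auto
  finally show ?thesis by (simp add: algebra_simps)
qed

text \<open>Comparison with the series of \<open>exp (operator_bound A * \<bar>t\<bar>)\<close>. The
  coefficient precedes the power of \<open>t\<close> because termwise differentiation expects that
  form.\<close>

lemma exp_map_summable:
  assumes "linear_map_on V A" "f \<in> V"
  shows "summable (\<lambda>j. (A ^^ j) f x / fact j * t ^ j)"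
proof (rule summable_comparison_test)
  let ?C = "(\<Sum>y\<in>X. \<bar>f y\<bar>) * (\<Sum>y\<in>X. \<bar>e y x\<bar>)"
  show "\<exists>N. \<forall>n\<ge>N. norm ((A ^^ n) f x / fact n * t ^ n) \<le> ?C * (inverse (fact n) * (operator_bound A * \<bar>t\<bar>) ^ n)"
  proof (intro exI[of _ 0] allI impI)
    fix n
    have "\<bar>(A ^^ n) f x\<bar> * (\<bar>t\<bar> ^ n / fact n) \<le> (operator_bound A ^ n * ?C) * (\<bar>t\<bar> ^ n / fact n)"
      by (intro mult_right_mono power_bound_pointwise assms) auto
    then show "norm ((A ^^ n) f x / fact n * t ^ n) \<le> ?C * (inverse (fact n) * (operator_bound A * \<bar>t\<bar>) ^ n)"
      by (simp add: abs_mult power_abs power_mult_distrib field_simps)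
  qed
  show "summable (\<lambda>n. ?C * (inverse (fact n) * (operator_bound A * \<bar>t\<bar>) ^ n))"
    by (intro summable_mult summable_exp)
qed

lemma exp_map_in:
  assumes "linear_map_on V A" "f \<in> V"
  shows "exp_map t A f \<in> V"
proof (rule limit_in)
  show "\<forall>\<^sub>F n in sequentially. (\<lambda>x. \<Sum>j<n. t ^ j / fact j * (A ^^ j) f x) \<in> V"
    using power_in[OF assms] by (intro always_eventually allI function_subspace_sum[OF subspace]) auto
  show "(\<lambda>n. \<Sum>j<n. t ^ j / fact j * (A ^^ j) f x) \<longlonglongrightarrow> exp_map t A f x" for x
    unfolding exp_map_def using exp_map_summable[OF assms, of x t]
    by (intro summable_LIMSEQ) (simp add: mult.commute)
qed simp

text \<open>Termwise differentiation shifts the coefficients by one, and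
  \<open>(A ^^ Suc n) f\<close> is \<open>(A ^^ n) (A f)\<close>. Hence \<open>A\<close> acts on the
  argument \<open>f\<close>, the shape used in \<open>moment_on_set_increment\<close>.\<close>

lemma exp_map_has_derivative:
  assumes "linear_map_on V A" "f \<in> V"
  shows "((\<lambda>t. exp_map t A f x) has_field_derivative exp_map t A (A f) x) (at t)"
proof -
  have "((\<lambda>t. \<Sum>j. (A ^^ j) f x / fact j * t ^ j) has_field_derivative
      (\<Sum>n. diffs (\<lambda>j. (A ^^ j) f x / fact j) n * t ^ n)) (at t)"
    by (rule termdiffs_strong_converges_everywhere) (rule exp_map_summable[OF assms])
  moreover have "diffs (\<lambda>j. (A ^^ j) f x / fact j) n = (A ^^ n) (A f) x / fact n" for n
  proof -
    have "(A ^^ Suc n) f = (A ^^ n) (A f)" by (simp only: funpow_Suc_right comp_def)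
    moreover have "of_nat (Suc n) * (c / fact (Suc n)) = c / fact n" for c :: real
      by (simp del: of_nat_Suc)
    ultimately show ?thesis unfolding diffs_def by metis
  qed
  moreover have "exp_map s A g x = (\<Sum>j. (A ^^ j) g x / fact j * s ^ j)" for s g
    unfolding exp_map_def by (rule arg_cong[where f=suminf], rule ext) simp
  ultimately show ?thesis by (simp only:)
qed

lemma exp_map_zero: "exp_map 0 A f = f"
proof
  fix x
  have "(\<lambda>j. 0 ^ j / fact j * (A ^^ j) f x) sums (\<Sum>j\<in>{0::nat}. 0 ^ j / fact j * (A ^^ j) f x)"
    by (rule sums_finite) auto
  from sums_unique[OF this] show "exp_map 0 A f x = f x" unfolding exp_map_def by simp
qed

text \<open>Stated for values at a fixed point, since \<open>V\<close> need not be known to be invariant under the semigroup.\<close>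

theorem exp_map_unique:
  assumes A: "linear_map_on V A"
    and expand: "\<And>t f. t \<ge> 0 \<Longrightarrow> f \<in> V \<Longrightarrow> \<phi> t f = (\<Sum>y\<in>X. f y * \<phi> t (e y))"
    and zero: "\<And>f. f \<in> V \<Longrightarrow> \<phi> 0 f = f x"
    and der: "\<And>f t. f \<in> V \<Longrightarrow> t \<ge> 0 \<Longrightarrow>
      ((\<lambda>t. \<phi> t f) has_field_derivative \<phi> t (A f)) (at t within {0..})"
    and "f \<in> V" "t \<ge> 0"
  shows "\<phi> t f = exp_map t A f x"
proof -
  have cont: "continuous_on {0..t} (\<lambda>s. \<phi> s g)" if "g \<in> V" for g
    by (rule DERIV_continuous_on, rule DERIV_subset[OF der[OF that]]) auto
  \<comment> \<open>The expansion reduces \<open>\<phi> s\<close> to finitely many functions of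
    time, continuous and hence bounded on \<open>{0..t}\<close>. The bound \<open>K\<close> then
    serves all iterates \<open>(A ^^ n) f\<close> at once.\<close>
  have "continuous_on {0..t} (\<lambda>s. \<Sum>y\<in>X. \<bar>\<phi> s (e y)\<bar>)"
    by (intro continuous_intros cont basis_in)
  from continuous_attains_sup[OF compact_Icc _ this]
  obtain K where K: "\<And>s. s \<in> {0..t} \<Longrightarrow> (\<Sum>y\<in>X. \<bar>\<phi> s (e y)\<bar>) \<le> K"
    using \<open>t \<ge> 0\<close> by fastforce
  let ?N = "\<Sum>y\<in>X. \<bar>f y\<bar>" and ?a = "operator_bound A"
  have bound: "\<bar>\<phi> s ((A ^^ n) f)\<bar> \<le> K * ?N * ?a ^ n" if "s \<in> {0..t}" for s n
  proof -
    have "\<bar>\<phi> s ((A ^^ n) f)\<bar> \<le> (\<Sum>y\<in>X. \<bar>(A ^^ n) f y * \<phi> s (e y)\<bar>)"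
      using that by (subst expand[OF _ power_in[OF A \<open>f \<in> V\<close>]]) auto
    also have "\<dots> \<le> (\<Sum>y\<in>X. \<bar>(A ^^ n) f y\<bar> * (\<Sum>y\<in>X. \<bar>\<phi> s (e y)\<bar>))"
      unfolding abs_mult using finite_nodes by (intro sum_mono mult_left_mono member_le_sum) auto
    also have "\<dots> = (\<Sum>y\<in>X. \<bar>(A ^^ n) f y\<bar>) * (\<Sum>y\<in>X. \<bar>\<phi> s (e y)\<bar>)"
      by (rule sum_distrib_right[symmetric])
    also have "\<dots> \<le> (?a ^ n * ?N) * K"
      using K[OF that] by (intro mult_mono power_bound A \<open>f \<in> V\<close>)
        (auto intro!: sum_nonneg mult_nonneg_nonneg simp: operator_bound_nonneg)
    finally show ?thesis by (simp add: algebra_simps)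
  qed
  \<comment> \<open>The derivative of order \<open>i\<close> of \<open>\<phi> s f\<close> in
    \<open>s\<close> is \<open>\<phi> s ((A ^^ i) f)\<close>, so the Taylor polynomial at 0 is a
    partial sum of the exponential series.\<close>
  have taylor: "\<bar>\<phi> t f - (\<Sum>i\<le>n. (A ^^ i) f x * t ^ i / fact i)\<bar> \<le> K * ?N * ?a * t * ((?a * t) ^ n / fact n)" for n
  proof -
    have "norm (\<phi> t ((A ^^ 0) f) - (\<Sum>i\<le>n. \<phi> 0 ((A ^^ i) f) * (t - 0) ^ i / fact i))
        \<le> (K * ?N * ?a ^ Suc n) * norm (t - 0) ^ Suc n / fact n"
    proof (rule field_Taylor[where S = "{0..t}"])
      fix i s assume "s \<in> {0..t}"
      then show "((\<lambda>s. \<phi> s ((A ^^ i) f)) has_field_derivative \<phi> s ((A ^^ Suc i) f)) (at s within {0..t})"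
        using DERIV_subset[OF der[OF power_in[OF A \<open>f \<in> V\<close>], of s i], of "{0..t}"] by auto
    next
      show "norm (\<phi> s ((A ^^ Suc n) f)) \<le> K * ?N * ?a ^ Suc n" if "s \<in> {0..t}" for s
        using bound[OF that] unfolding real_norm_def .
    qed (use \<open>t \<ge> 0\<close> in auto)
    then show ?thesis
      using \<open>t \<ge> 0\<close> zero[OF power_in[OF A \<open>f \<in> V\<close>]] by (simp add: power_mult_distrib algebra_simps)
  qed
  have "(\<lambda>n. (?a * t) ^ n / fact n) \<longlonglongrightarrow> 0"
    using summable_LIMSEQ_zero[OF summable_exp[of "?a * t"]] by (simp add: field_simps)
  then have "(\<lambda>n. K * ?N * ?a * t * ((?a * t) ^ n / fact n)) \<longlonglongrightarrow> 0"
    by (rule tendsto_mult_right_zero)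
  then have "(\<lambda>n. \<phi> t f - (\<Sum>i\<le>n. (A ^^ i) f x * t ^ i / fact i)) \<longlonglongrightarrow> 0"
    by (rule Lim_null_comparison[rotated]) (use taylor in auto)
  then have "(\<lambda>n. \<phi> t f - (\<phi> t f - (\<Sum>i\<le>n. (A ^^ i) f x * t ^ i / fact i))) \<longlonglongrightarrow> \<phi> t f - 0"
    by (intro tendsto_intros)
  then have "(\<lambda>n. \<Sum>i\<le>n. t ^ i / fact i * (A ^^ i) f x) \<longlonglongrightarrow> \<phi> t f"
    by (simp add: mult.commute)
  then have "(\<lambda>i. t ^ i / fact i * (A ^^ i) f x) sums \<phi> t f"
    by (simp add: sums_def_le)
  then show "\<phi> t f = exp_map t A f x"
    unfolding exp_map_def by (rule sums_unique)
qed

end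

section \<open>One-parameter semigroups on function spaces\<close>

lemma antiderivative_atLeast:
  fixes g :: "real \<Rightarrow> real"
  assumes "continuous_on {0..} g" "t \<ge> 0"
  shows "((\<lambda>t. integral {0..t} g) has_field_derivative g t) (at t within {0..})"
proof -
  have "((\<lambda>t. integral {0..t} g) has_field_derivative g t) (at t within {0..t+1})"
    using assms by (intro integral_has_real_derivative continuous_on_subset[OF assms(1)]) auto
  moreover have "at t within {0..t+1} = at t within {0..}"
    by (rule at_within_nhd[of t "{..<t+1}"]) auto
  ultimately show ?thesis by simp
qed

lemma has_derivative_transform_atLeast:
  fixes f g :: "real \<Rightarrow> real"
  assumes "(f has_field_derivative D) (at t within {0..})" "\<And>s. s \<ge> 0 \<Longrightarrow> g s = f s" "t \<ge> 0"
  shows "(g has_field_derivative D) (at t within {0..})"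
  using assms by (intro has_field_derivative_transform_within[OF assms(1) zero_less_one]) auto

context nodal_space
begin

lemma linear_diff:
  assumes "linear_map_on V A" "f \<in> V" "g \<in> V"
  shows "A (\<lambda>x. f x - g x) = (\<lambda>x. A f x - A g x)"
proof -
  have "A (\<lambda>x. f x + (-1) * g x) = (\<lambda>x. A f x + (-1) * A g x)"
    using linear_mapD(2)[OF assms(1,2) function_subspaceD(3)[OF subspace assms(3)], of "-1"]
      linear_mapD(3)[OF assms(1,3), of "-1"] by simp
  then show ?thesis by simp
qed

text \<open>By the nodal expansion the integral of \<open>u\<close> is a combination of the
  \<open>e y\<close> whose coefficients are scalar integrals of node values, and a linear map passes
  through such a finite combination.\<close>

lemma linear_integral:
  fixes u :: "real \<Rightarrow> 'a \<Rightarrow> real"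
  assumes L: "linear_map_on V L"
    and u: "\<And>s. s \<in> {a..b} \<Longrightarrow> u s \<in> V" "\<And>x. continuous_on {a..b} (\<lambda>s. u s x)"
  shows "(\<lambda>x. integral {a..b} (\<lambda>s. u s x)) \<in> V"
    and "L (\<lambda>x. integral {a..b} (\<lambda>s. u s x)) x = integral {a..b} (\<lambda>s. L (u s) x)"
proof -
  have int: "integral {a..b} (\<lambda>s. M (u s) x) = (\<Sum>y\<in>X. integral {a..b} (\<lambda>s. u s y) * M (e y) x)"
    if "linear_map_on V M" for M x
  proof -
    have "integral {a..b} (\<lambda>s. M (u s) x) = integral {a..b} (\<lambda>s. \<Sum>y\<in>X. u s y * M (e y) x)"
      using linear_expansion[OF that u(1)] by (intro integral_cong)
    also have "\<dots> = (\<Sum>y\<in>X. integral {a..b} (\<lambda>s. u s y * M (e y) x))"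
      using finite_nodes
      by (intro integral_sum integrable_continuous_real continuous_intros u(2))
    finally show ?thesis by simp
  qed
  have eq: "(\<lambda>x. integral {a..b} (\<lambda>s. u s x)) = (\<lambda>x. \<Sum>y\<in>X. integral {a..b} (\<lambda>s. u s y) * e y x)"
    using int[OF linear_map_on_id] by (intro ext)
  show "(\<lambda>x. integral {a..b} (\<lambda>s. u s x)) \<in> V"
    by (rule ssubst[where P = "\<lambda>h. h \<in> V", OF eq]) (rule function_subspace_sum[OF subspace finite_nodes basis_in])
  have "L (\<lambda>x. integral {a..b} (\<lambda>s. u s x)) x = L (\<lambda>x. \<Sum>y\<in>X. integral {a..b} (\<lambda>s. u s y) * e y x) x"
    by (rule arg_cong[where f = "\<lambda>h. L h x", OF eq])
  also have "\<dots> = integral {a..b} (\<lambda>s. L (u s) x)"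
    unfolding int[OF L] by (rule fun_cong[OF linear_sum[OF L finite_nodes basis_in]])
  finally show "L (\<lambda>x. integral {a..b} (\<lambda>s. u s x)) x = integral {a..b} (\<lambda>s. L (u s) x)" .
qed

end

text \<open>A strongly continuous semigroup, with convergence required only pointwise and only at
  time 0 from the right. Local boundedness and continuity at all times are derived through the
  semigroup law.\<close>

locale nodal_semigroup = nodal_space V X e
  for V :: "('a \<Rightarrow> real) set" and X e +
  fixes T :: "real \<Rightarrow> ('a \<Rightarrow> real) \<Rightarrow> 'a \<Rightarrow> real"
  assumes linear: "\<And>t. t \<ge> 0 \<Longrightarrow> linear_map_on V (T t)"
    and T_zero: "\<And>f. f \<in> V \<Longrightarrow> T 0 f = f"
    and T_add: "\<And>s t f. s \<ge> 0 \<Longrightarrow> t \<ge> 0 \<Longrightarrow> f \<in> V \<Longrightarrow> T (s + t) f = T s (T t f)"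
    and T_tendsto: "\<And>f x. f \<in> V \<Longrightarrow> ((\<lambda>t. T t f x) \<longlongrightarrow> f x) (at_right 0)"
begin

lemma T_in: "t \<ge> 0 \<Longrightarrow> f \<in> V \<Longrightarrow> T t f \<in> V"
  using linear_mapD(1)[OF linear] .

lemma operator_bound_add:
  assumes "s \<ge> 0" "t \<ge> 0"
  shows "operator_bound (T (s + t)) \<le> operator_bound (T s) * operator_bound (T t)"
proof -
  have "operator_bound (T (s + t)) = (\<Sum>y\<in>X. \<Sum>x\<in>X. \<bar>T s (T t (e y)) x\<bar>)"
    unfolding operator_bound_def by (subst sum.swap) (intro sum.cong refl, simp add: T_add basis_in assms)
  also have "\<dots> \<le> (\<Sum>y\<in>X. operator_bound (T s) * (\<Sum>x\<in>X. \<bar>T t (e y) x\<bar>))"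
    using assms by (intro sum_mono operator_bound linear T_in basis_in)
  also have "\<dots> = operator_bound (T s) * operator_bound (T t)"
    unfolding operator_bound_def[of "T t"] sum_distrib_left[symmetric] by (subst sum.swap) (rule refl)
  finally show ?thesis .
qed

lemma operator_bound_locally_bounded: "\<exists>K. \<forall>s\<in>{0..R}. operator_bound (T s) \<le> K"
proof -
  \<comment> \<open>The limit of the bounds as \<open>s\<close> tends to 0, plus 1: the slack makes
    the bound strict near 0, and \<open>C \<ge> 1\<close> makes the powers of \<open>C\<close>
    increase.\<close>
  define C where "C = operator_bound (\<lambda>f. f) + 1"
  have C: "C \<ge> 1" using operator_bound_nonneg by (simp add: C_def)
  have "((\<lambda>s. operator_bound (T s)) \<longlongrightarrow> operator_bound (\<lambda>f. f)) (at_right 0)"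
    unfolding operator_bound_def by (intro tendsto_intros T_tendsto basis_in)
  then have "\<forall>\<^sub>F s in at_right 0. operator_bound (T s) < C"
    by (rule order_tendstoD) (simp add: C_def)
  then obtain \<delta> where \<delta>: "\<delta> > 0" "\<And>s. 0 < s \<Longrightarrow> s < \<delta> \<Longrightarrow> operator_bound (T s) < C"
    unfolding eventually_at_right_field by auto
  have "operator_bound (T 0) < C"
    unfolding operator_bound_def C_def using T_zero[OF basis_in] by simp
  with \<delta> have small: "operator_bound (T s) \<le> C" if "0 \<le> s" "s < \<delta>" for s
    using that by (cases "s = 0") (auto intro: less_imp_le)
  \<comment> \<open>Times are reduced by \<open>\<delta> / 2\<close> rather than
    \<open>\<delta>\<close>, so that the removed piece lies strictly inside the range of
    \<open>small\<close>. Each reduction costs one factor \<open>C\<close>.\<close>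
  have bound: "operator_bound (T s) \<le> C ^ Suc n" if "0 \<le> s" "s < \<delta> / 2 * Suc n" for n s
    using that
  proof (induction n arbitrary: s)
    case 0
    then show ?case using small \<delta>(1) by simp
  next
    case (Suc n)
    show ?case
    proof (cases "s < \<delta>")
      case True
      have "C * 1 \<le> C * C ^ Suc n" using C by (intro mult_left_mono one_le_power) auto
      then show ?thesis using small[OF Suc.prems(1) True] by simp
    next
      case False
      have "operator_bound (T (\<delta>/2 + (s - \<delta>/2))) \<le> operator_bound (T (\<delta>/2)) * operator_bound (T (s - \<delta>/2))"
        using \<delta>(1) False by (intro operator_bound_add) auto
      also have "\<dots> \<le> C * C ^ Suc n"
        using \<delta>(1) False C Suc.prems by (intro mult_mono small Suc.IH operator_bound_nonneg) (auto simp: algebra_simps)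
      finally show ?thesis by simp
    qed
  qed
  obtain n where "R < \<delta> / 2 * real n"
    using reals_Archimedean3[of "\<delta> / 2"] \<delta>(1) by (auto simp: mult.commute)
  then have "R < \<delta> / 2 * Suc n" using \<delta>(1) by (simp add: algebra_simps)
  then show ?thesis by (intro exI[of _ "C ^ Suc n"] ballI bound) auto
qed

text \<open>The increment from \<open>s\<close> to \<open>s + h\<close> is \<open>T s\<close>
  applied to \<open>T h f - f\<close>. Taking the earlier of two times as \<open>s\<close> treats
  left and right limits alike, since \<open>operator_bound (T s)\<close> is bounded over bounded
  times and the remaining factor depends only on \<open>h\<close>.\<close>

lemma T_continuous:
  assumes f: "f \<in> V"
  shows "continuous_on {0..} (\<lambda>t. T t f x)"
proof -
  define E where "E = (\<Sum>y\<in>X. \<bar>e y x\<bar>)"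
  define w where "w = (\<lambda>h. \<Sum>y\<in>X. \<bar>T h f y - f y\<bar>)"
  have E: "E \<ge> 0" by (simp add: E_def sum_nonneg)
  have w: "w h \<ge> 0" for h by (simp add: w_def sum_nonneg)
  have main: "\<bar>T (s + h) f x - T s f x\<bar> \<le> w h * (operator_bound (T s) * E)" if "s \<ge> 0" "h \<ge> 0" for s h
  proof -
    have diff: "(\<lambda>x. T h f x - f x) \<in> V"
      using T_in[OF that(2) f] f by (rule function_subspace_diff[OF subspace])
    have "T (s + h) f x - T s f x = T s (\<lambda>x. T h f x - f x) x"
      using T_add[OF that f] linear_diff[OF linear[OF that(1)] T_in[OF that(2) f] f] by simp
    also have "\<bar>\<dots>\<bar> \<le> w h * (\<Sum>y\<in>X. \<bar>T s (e y) x\<bar>)"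
      using linear_bound[OF linear[OF that(1)] diff] by (simp add: w_def)
    also have "\<dots> \<le> w h * (\<Sum>y\<in>X. (\<Sum>z\<in>X. \<bar>T s (e y) z\<bar>) * E)"
      using linear_bound[OF linear_map_on_id T_in[OF that(1) basis_in]] w
      by (intro mult_left_mono sum_mono) (auto simp: E_def)
    also have "\<dots> = w h * (operator_bound (T s) * E)"
      unfolding operator_bound_def sum_distrib_right[symmetric] by (subst sum.swap) (rule refl)
    finally show ?thesis .
  qed
  have "(w \<longlongrightarrow> (\<Sum>y\<in>X. \<bar>f y - f y\<bar>)) (at_right 0)"
    unfolding w_def by (intro tendsto_intros T_tendsto f)
  then have w0: "(w \<longlongrightarrow> 0) (at_right 0)" by simp
  show ?thesis
    unfolding continuous_on_iff
  proof (intro ballI allI impI)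
    fix t0 \<epsilon> :: real assume t0: "t0 \<in> {0..}" and \<epsilon>: "\<epsilon> > 0"
    obtain K where K: "\<And>s. s \<in> {0..t0+1} \<Longrightarrow> operator_bound (T s) \<le> K"
      using operator_bound_locally_bounded by blast
    have K0: "K \<ge> 0" using K[of 0] t0 operator_bound_nonneg[of "T 0"] by simp
    have "((\<lambda>h. w h * (K * E)) \<longlongrightarrow> 0 * (K * E)) (at_right 0)"
      by (intro tendsto_intros w0)
    then have "\<forall>\<^sub>F h in at_right 0. w h * (K * E) < \<epsilon>"
      using \<epsilon> by (intro order_tendstoD) auto
    then obtain d where d: "d > 0" "\<And>h. 0 < h \<Longrightarrow> h < d \<Longrightarrow> w h * (K * E) < \<epsilon>"
      unfolding eventually_at_right_field by auto
    have step: "\<bar>T t f x - T s f x\<bar> < \<epsilon>" if "0 \<le> s" "s < t" "t < s + d" "s \<le> t0 + 1" for s t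
    proof -
      have "\<bar>T t f x - T s f x\<bar> \<le> w (t - s) * (operator_bound (T s) * E)"
        using main[of s "t - s"] that by simp
      also have "\<dots> \<le> w (t - s) * (K * E)"
        using K[of s] that E w by (intro mult_left_mono mult_right_mono) auto
      also have "\<dots> < \<epsilon>" using d(2)[of "t - s"] that by simp
      finally show ?thesis .
    qed
    show "\<exists>d>0. \<forall>x'\<in>{0..}. dist x' t0 < d \<longrightarrow> dist (T x' f x) (T t0 f x) < \<epsilon>"
    proof (intro exI[of _ "min d 1"] conjI ballI impI)
      fix t assume t: "t \<in> {0..}" "dist t t0 < min d 1"
      consider "t < t0" | "t = t0" | "t > t0" by linarith
      then show "dist (T t f x) (T t0 f x) < \<epsilon>"
      proof cases
        case 1
        then show ?thesis using step[of t t0] t t0 by (auto simp: dist_real_def abs_minus_commute)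
      next
        case 3
        then show ?thesis using step[of t0 t] t t0 by (auto simp: dist_real_def)
      qed (use \<epsilon> in auto)
    qed (use d in auto)
  qed
qed

text \<open>The domain of the infinitesimal generator, with \<open>g'\<close> as the image of
  \<open>g\<close>. The derivative is demanded at all times, in the form of the hypothesis of
  \<open>exp_map_unique\<close>.\<close>

definition smooth_vectors :: "('a \<Rightarrow> real) set" where
  "smooth_vectors = {g\<in>V. \<exists>g'\<in>V. \<forall>x. \<forall>t\<ge>0. ((\<lambda>t. T t g x) has_field_derivative T t g' x) (at t within {0..})}"

lemma smooth_vectorsI:
  assumes "g \<in> V" "g' \<in> V"
    "\<And>x t. t \<ge> 0 \<Longrightarrow> ((\<lambda>t. T t g x) has_field_derivative T t g' x) (at t within {0..})"
  shows "g \<in> smooth_vectors"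
  using assms unfolding smooth_vectors_def by auto

lemma smooth_vectorsE:
  assumes "g \<in> smooth_vectors"
  obtains g' where "g \<in> V" "g' \<in> V"
    "\<And>x t. t \<ge> 0 \<Longrightarrow> ((\<lambda>t. T t g x) has_field_derivative T t g' x) (at t within {0..})"
  using assms unfolding smooth_vectors_def by auto

lemma subspace_smooth_vectors: "function_subspace smooth_vectors"
  unfolding function_subspace_def
proof (intro conjI ballI allI)
  have 0: "T t (\<lambda>x. 0) = (\<lambda>x. 0)" if "t \<ge> 0" for t
    using linear_mapD(3)[OF linear[OF that] function_subspaceD(1)[OF subspace], of 0] by simp
  have "((\<lambda>t. T t (\<lambda>x. 0) x) has_field_derivative T t (\<lambda>x. 0) x) (at t within {0..})" if "t \<ge> 0" for t x
    by (rule has_derivative_transform_atLeast[where f = "\<lambda>t. 0"]) (use that 0 in auto)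
  then show "(\<lambda>x. 0) \<in> smooth_vectors"
    by (rule smooth_vectorsI[OF function_subspaceD(1)[OF subspace] function_subspaceD(1)[OF subspace]])
next
  fix f g assume fg: "f \<in> smooth_vectors" "g \<in> smooth_vectors"
  obtain f' where f: "f \<in> V" "f' \<in> V" "\<And>x t. t \<ge> 0 \<Longrightarrow> ((\<lambda>t. T t f x) has_field_derivative T t f' x) (at t within {0..})"
    by (rule smooth_vectorsE[OF fg(1)]) (rule that)
  obtain g' where g: "g \<in> V" "g' \<in> V" "\<And>x t. t \<ge> 0 \<Longrightarrow> ((\<lambda>t. T t g x) has_field_derivative T t g' x) (at t within {0..})"
    by (rule smooth_vectorsE[OF fg(2)]) (rule that)
  have "((\<lambda>t. T t (\<lambda>x. f x + g x) x) has_field_derivative T t (\<lambda>x. f' x + g' x) x) (at t within {0..})" if "t \<ge> 0" for t x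
    unfolding linear_mapD(2)[OF linear[OF that] f(2) g(2)]
    by (rule has_derivative_transform_atLeast[OF DERIV_add[OF f(3)[OF that] g(3)[OF that]]])
      (simp_all add: that linear_mapD(2)[OF linear f(1) g(1)])
  then show "(\<lambda>x. f x + g x) \<in> smooth_vectors"
    by (rule smooth_vectorsI[OF function_subspaceD(2)[OF subspace f(1) g(1)] function_subspaceD(2)[OF subspace f(2) g(2)]])
next
  fix c f assume f: "f \<in> smooth_vectors"
  obtain f' where f: "f \<in> V" "f' \<in> V" "\<And>x t. t \<ge> 0 \<Longrightarrow> ((\<lambda>t. T t f x) has_field_derivative T t f' x) (at t within {0..})"
    by (rule smooth_vectorsE[OF f]) (rule that)
  have "((\<lambda>t. T t (\<lambda>x. c * f x) x) has_field_derivative T t (\<lambda>x. c * f' x) x) (at t within {0..})" if "t \<ge> 0" for t x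
    unfolding linear_mapD(3)[OF linear[OF that] f(2)]
    by (rule has_derivative_transform_atLeast[OF DERIV_cmult[OF f(3)[OF that]]])
      (simp_all add: that linear_mapD(3)[OF linear f(1)])
  then show "(\<lambda>x. c * f x) \<in> smooth_vectors"
    by (rule smooth_vectorsI[OF function_subspaceD(3)[OF subspace f(1), where c = c] function_subspaceD(3)[OF subspace f(2), where c = c]])
qed

text \<open>Applying \<open>T t\<close> shifts the window of integration, so the average becomes a
  difference of antiderivatives and is differentiable in \<open>t\<close>, although
  \<open>T t f\<close> is only known to be continuous. The generator sends it to the difference
  quotient of \<open>T \<epsilon> f\<close> and \<open>f\<close>.\<close>

lemma average_smooth:
  assumes f: "f \<in> V" and \<epsilon>: "\<epsilon> > 0"
  shows "(\<lambda>x. (1 / \<epsilon>) * integral {0..\<epsilon>} (\<lambda>s. T s f x)) \<in> smooth_vectors"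
proof -
  define \<Phi> where "\<Phi> = (\<lambda>x t. integral {0..t} (\<lambda>s. T s f x))"
  have cont: "continuous_on {a..b} (\<lambda>s. T s f x)" if "a \<ge> 0" for x a b
    using that by (intro continuous_on_subset[OF T_continuous[OF f]]) auto
  have V: "(\<lambda>x. integral {0..\<epsilon>} (\<lambda>s. T s f x)) \<in> V"
    using T_in f cont by (intro linear_integral(1)[OF linear_map_on_id]) auto
  have diff: "(\<lambda>x. T \<epsilon> f x - f x) \<in> V"
    using T_in[OF _ f, of \<epsilon>] f \<epsilon> by (intro function_subspace_diff[OF subspace]) auto
  have T: "T t (\<lambda>x. (1 / \<epsilon>) * integral {0..\<epsilon>} (\<lambda>s. T s f x)) x = (1 / \<epsilon>) * (\<Phi> x (t + \<epsilon>) - \<Phi> x t)"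
    if "t \<ge> 0" for t x
  proof -
    have "T t (\<lambda>x. integral {0..\<epsilon>} (\<lambda>s. T s f x)) x = integral {0..\<epsilon>} (\<lambda>s. T t (T s f) x)"
      using T_in f cont by (intro linear_integral(2)[OF linear[OF that]]) auto
    also have "\<dots> = integral {0..\<epsilon>} ((\<lambda>s. T s f x) \<circ> (\<lambda>s. s + t))"
      using T_add[OF that _ f] by (intro integral_cong) (simp add: add.commute)
    also have "\<dots> = integral {0 + t..\<epsilon> + t} (\<lambda>s. T s f x)"
      using that by (intro integral_shift cont) auto
    also have "\<dots> = \<Phi> x (t + \<epsilon>) - \<Phi> x t"
    proof -
      have "(\<lambda>s. T s f x) integrable_on {0..t + \<epsilon>}" by (rule integrable_continuous_real[OF cont]) simp
      from Henstock_Kurzweil_Integration.integral_combine[OF _ _ this, of t] that \<epsilon> show ?thesis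
        by (simp add: \<Phi>_def add.commute)
    qed
    finally show ?thesis unfolding linear_mapD(3)[OF linear[OF that] V, of "1 / \<epsilon>"] by simp
  qed
  have "((\<lambda>t. T t (\<lambda>x. (1 / \<epsilon>) * integral {0..\<epsilon>} (\<lambda>s. T s f x)) x) has_field_derivative
      T t (\<lambda>x. (1 / \<epsilon>) * (T \<epsilon> f x - f x)) x) (at t within {0..})" if t: "t \<ge> 0" for t x
  proof -
    have d: "(\<Phi> x has_field_derivative T t f x) (at t within {0..})"
      unfolding \<Phi>_def by (rule antiderivative_atLeast[OF T_continuous[OF f] t])
    \<comment> \<open>\<open>DERIV_shift\<close> works with two-sided derivatives; one exists at
      \<open>t + \<epsilon>\<close>, an interior point of \<open>{0..}\<close> even for
      \<open>t = 0\<close>.\<close>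
    have pos: "t + \<epsilon> \<ge> 0" and "t + \<epsilon> \<in> interior {0..}" using t \<epsilon> by auto
    from this(2) have "(\<Phi> x has_field_derivative T (t + \<epsilon>) f x) (at (t + \<epsilon>))"
      using antiderivative_atLeast[OF T_continuous[OF f] pos, of x]
      unfolding \<Phi>_def by (simp only: at_within_interior)
    then have "((\<lambda>t. \<Phi> x (t + \<epsilon>)) has_field_derivative T (t + \<epsilon>) f x) (at t)"
      by (rule DERIV_shift[THEN iffD1])
    then have "((\<lambda>t. \<Phi> x (t + \<epsilon>)) has_field_derivative T (t + \<epsilon>) f x) (at t within {0..})"
      by (rule has_field_derivative_at_within)
    from DERIV_cmult[OF DERIV_diff[OF this d], of "1 / \<epsilon>"]
    have deriv: "((\<lambda>t. (1 / \<epsilon>) * (\<Phi> x (t + \<epsilon>) - \<Phi> x t)) has_field_derivative (1 / \<epsilon>) * (T (t + \<epsilon>) f x - T t f x)) (at t within {0..})" .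
    have eq: "T t (\<lambda>x. (1 / \<epsilon>) * (T \<epsilon> f x - f x)) x = (1 / \<epsilon>) * (T (t + \<epsilon>) f x - T t f x)"
      using linear_mapD(3)[OF linear[OF t] diff, of "1 / \<epsilon>"] linear_diff[OF linear[OF t] T_in[OF _ f] f, of \<epsilon>] \<epsilon> T_add[OF t _ f, of \<epsilon>]
      by simp
    show ?thesis
      unfolding eq using deriv
      by (rule has_derivative_transform_atLeast[OF _ _ t]) (erule T)
  qed
  then show ?thesis
    using smooth_vectorsI[OF function_subspaceD(3)[OF subspace V, where c = "1 / \<epsilon>"]
        function_subspaceD(3)[OF subspace diff, where c = "1 / \<epsilon>"]] by (simp only:)
qed

text \<open>The averages tend to \<open>f\<close>, and the subspace \<open>smooth_vectors\<close> is
  finite-dimensional, hence closed, so every vector is smooth. The generators of the basis functions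
  then determine \<open>A\<close>.\<close>

theorem semigroup_eq_exp_map:
  assumes "finite I" "\<And>f. f \<in> V \<Longrightarrow> \<exists>c. f = (\<lambda>x. \<Sum>i\<in>I. c i * b i x)"
  obtains A where "linear_map_on V A" "\<And>t f. t \<ge> 0 \<Longrightarrow> f \<in> V \<Longrightarrow> T t f = exp_map t A f"
proof -
  have "\<exists>c. f = (\<lambda>x. \<Sum>i\<in>I. c i * b i x)" if "f \<in> smooth_vectors" for f
    by (rule assms(2)) (use that in \<open>simp add: smooth_vectors_def\<close>)
  then obtain Y d where "nodal_space smooth_vectors Y d"
    by (rule nodal_space_exists[OF assms(1) subspace_smooth_vectors])
  then interpret D: nodal_space smooth_vectors Y d .
  have smooth: "f \<in> smooth_vectors" if f: "f \<in> V" for f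
  proof (rule D.limit_in)
    show "\<forall>\<^sub>F \<epsilon> in at_right 0. (\<lambda>x. (1 / \<epsilon>) * integral {0..\<epsilon>} (\<lambda>s. T s f x)) \<in> smooth_vectors"
      by (rule eventually_mono[OF eventually_at_right_less]) (rule average_smooth[OF f])
    fix x
    \<comment> \<open>The average over \<open>{0..\<epsilon>}\<close> is the difference quotient at
      0 of this antiderivative.\<close>
    have "((\<lambda>t. integral {0..t} (\<lambda>s. T s f x)) has_field_derivative T 0 f x) (at 0 within {0..})"
      by (rule antiderivative_atLeast[OF T_continuous[OF f]]) simp
    then have "((\<lambda>\<epsilon>. (1 / \<epsilon>) * integral {0..\<epsilon>} (\<lambda>s. T s f x)) \<longlongrightarrow> T 0 f x) (at 0 within {0..})"
      unfolding has_field_derivative_iff by simp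
    then show "((\<lambda>\<epsilon>. (1 / \<epsilon>) * integral {0..\<epsilon>} (\<lambda>s. T s f x)) \<longlongrightarrow> f x) (at_right 0)"
      unfolding T_zero[OF f] by (rule tendsto_within_subset) auto
  qed simp
  have "\<forall>y\<in>X. \<exists>d. d \<in> V \<and> (\<forall>x. \<forall>t\<ge>0. ((\<lambda>t. T t (e y) x) has_field_derivative T t d x) (at t within {0..}))"
  proof
    fix y assume "y \<in> X"
    from smooth[OF basis_in[OF this]]
    obtain d where "d \<in> V" "\<And>x t. t \<ge> 0 \<Longrightarrow> ((\<lambda>t. T t (e y) x) has_field_derivative T t d x) (at t within {0..})"
      by (rule smooth_vectorsE) (rule that)
    then show "\<exists>d. d \<in> V \<and> (\<forall>x. \<forall>t\<ge>0. ((\<lambda>t. T t (e y) x) has_field_derivative T t d x) (at t within {0..}))"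
      by auto
  qed
  from bchoice[OF this] obtain d where d: "\<And>y. y \<in> X \<Longrightarrow> d y \<in> V"
    "\<And>y x t. y \<in> X \<Longrightarrow> t \<ge> 0 \<Longrightarrow> ((\<lambda>t. T t (e y) x) has_field_derivative T t (d y) x) (at t within {0..})"
    by auto
  define A where "A = (\<lambda>f x. \<Sum>y\<in>X. f y * d y x)"
  have A: "linear_map_on V A" unfolding A_def by (rule linear_map_from_basis[OF d(1)])
  have "T t f x = exp_map t A f x" if t: "t \<ge> 0" and f: "f \<in> V" for t f x
  proof (rule exp_map_unique[where \<phi> = "\<lambda>t f. T t f x", OF A linear_expansion[OF linear] _ _ f t])
    show "T 0 f x = f x" if "f \<in> V" for f by (simp only: T_zero[OF that])
    fix f t assume f: "f \<in> V" and t: "t \<ge> (0 :: real)"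
    have "((\<lambda>t. \<Sum>y\<in>X. f y * T t (e y) x) has_field_derivative (\<Sum>y\<in>X. f y * T t (d y) x)) (at t within {0..})"
      by (rule DERIV_sum, rule DERIV_cmult, rule d(2)[OF _ t])
    moreover have "(\<Sum>y\<in>X. f y * T t (d y) x) = T t (A f) x"
      unfolding A_def by (rule fun_cong[OF linear_sum[OF linear[OF t] finite_nodes d(1)], symmetric])
    ultimately have "((\<lambda>t. \<Sum>y\<in>X. f y * T t (e y) x) has_field_derivative T t (A f) x) (at t within {0..})"
      by (simp only:)
    then show "((\<lambda>t. T t f x) has_field_derivative T t (A f) x) (at t within {0..})"
      by (rule has_derivative_transform_atLeast[OF _ _ t]) (rule linear_expansion[OF linear f])
  qed
  then have "T t f = exp_map t A f" if "t \<ge> 0" "f \<in> V" for t f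
    using that by (intro ext)
  then show ?thesis by (rule that[OF A])
qed

end

section \<open>Polynomials on the state space\<close>

lemma finite_multi_indices: "finite {a :: 'n::finite \<Rightarrow> nat. (\<Sum>i\<in>UNIV. a i) \<le> k}"
proof (rule finite_subset)
  show "{a :: 'n \<Rightarrow> nat. (\<Sum>i\<in>UNIV. a i) \<le> k} \<subseteq> UNIV \<rightarrow>\<^sub>E {..k}"
  proof
    fix a :: "'n \<Rightarrow> nat" assume "a \<in> {a. (\<Sum>i\<in>UNIV. a i) \<le> k}"
    moreover have "a i \<le> (\<Sum>i\<in>UNIV. a i)" for i by (rule member_le_sum) auto
    ultimately have "a i \<le> k" for i by (metis mem_Collect_eq order_trans)
    then show "a \<in> UNIV \<rightarrow>\<^sub>E {..k}" by (auto simp: PiE_iff)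
  qed
  show "finite ((UNIV :: 'n set) \<rightarrow>\<^sub>E {..k})" by (intro finite_PiE) auto
qed

lemma polynomial_of_degree_le_mono:
  assumes "polynomial_of_degree_le k q" "k \<le> m"
  shows "polynomial_of_degree_le m q"
proof -
  obtain c where c: "\<And>y. q y = (\<Sum>a | (\<Sum>i\<in>UNIV. a i) \<le> k. c a * (\<Prod>i\<in>UNIV. (y $ i) ^ a i))"
    using assms(1) unfolding polynomial_of_degree_le_def by blast
  have "q y = (\<Sum>a | (\<Sum>i\<in>UNIV. a i) \<le> m. (if (\<Sum>i\<in>UNIV. a i) \<le> k then c a else 0) * (\<Prod>i\<in>UNIV. (y $ i) ^ a i))" for y
    unfolding c using assms(2) finite_multi_indices
    by (intro sum.mono_neutral_cong_left) auto
  then show ?thesis unfolding polynomial_of_degree_le_def by (intro exI allI)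
qed

lemma polys_mono: "k \<le> m \<Longrightarrow> polys S k \<subseteq> polys S m"
  unfolding polys_def using polynomial_of_degree_le_mono by blast

lemma polysE:
  assumes "f \<in> polys S k"
  obtains q where "polynomial_of_degree_le k q" "\<And>y. y \<in> S \<Longrightarrow> f (Some y) = q y"
    "f None = 0" "\<And>x. x \<notin> states S \<Longrightarrow> f x = 0"
  using assms unfolding polys_def by blast

lemma polys_outside: "f \<in> polys S k \<Longrightarrow> x \<notin> states S \<Longrightarrow> f x = 0"
  and polys_None: "f \<in> polys S k \<Longrightarrow> f None = 0"
  unfolding polys_def by blast+

lemma subspace_polys: "function_subspace (polys S k)"
  unfolding function_subspace_def
proof (intro conjI ballI allI)
  have "polynomial_of_degree_le k (\<lambda>y :: real ^ 'a. 0)"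
    unfolding polynomial_of_degree_le_def by (intro exI[of _ "\<lambda>_. 0"]) simp
  then show "(\<lambda>x. 0) \<in> polys S k" unfolding polys_def by blast
next
  fix f g assume "f \<in> polys S k" "g \<in> polys S k"
  then obtain p q where p: "polynomial_of_degree_le k p" "\<And>y. y \<in> S \<Longrightarrow> f (Some y) = p y"
    and q: "polynomial_of_degree_le k q" "\<And>y. y \<in> S \<Longrightarrow> g (Some y) = q y"
    by (auto elim!: polysE)
  obtain c d where
    "\<And>y. p y = (\<Sum>a | (\<Sum>i\<in>UNIV. a i) \<le> k. c a * (\<Prod>i\<in>UNIV. (y $ i) ^ a i))"
    "\<And>y. q y = (\<Sum>a | (\<Sum>i\<in>UNIV. a i) \<le> k. d a * (\<Prod>i\<in>UNIV. (y $ i) ^ a i))"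
    using p(1) q(1) unfolding polynomial_of_degree_le_def by blast
  then have "polynomial_of_degree_le k (\<lambda>y. p y + q y)"
    unfolding polynomial_of_degree_le_def
    by (intro exI[of _ "\<lambda>a. c a + d a"]) (simp add: algebra_simps sum.distrib)
  moreover have "f None + g None = 0" "\<And>x. x \<notin> states S \<Longrightarrow> f x + g x = 0"
    using \<open>f \<in> polys S k\<close> \<open>g \<in> polys S k\<close> by (simp_all add: polys_None polys_outside)
  ultimately show "(\<lambda>x. f x + g x) \<in> polys S k"
    unfolding polys_def using p(2) q(2) by auto
next
  fix c f assume f: "f \<in> polys S k"
  then obtain p where p: "polynomial_of_degree_le k p" "\<And>y. y \<in> S \<Longrightarrow> f (Some y) = p y"
    by (auto elim!: polysE)
  obtain d where "\<And>y. p y = (\<Sum>a | (\<Sum>i\<in>UNIV. a i) \<le> k. d a * (\<Prod>i\<in>UNIV. (y $ i) ^ a i))"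
    using p(1) unfolding polynomial_of_degree_le_def by blast
  then have "polynomial_of_degree_le k (\<lambda>y. c * p y)"
    unfolding polynomial_of_degree_le_def
    by (intro exI[of _ "\<lambda>a. c * d a"]) (simp add: sum_distrib_left mult.assoc)
  moreover have "c * f None = 0" "\<And>x. x \<notin> states S \<Longrightarrow> c * f x = 0"
    using f by (simp_all add: polys_None polys_outside)
  ultimately show "(\<lambda>x. c * f x) \<in> polys S k"
    unfolding polys_def using p(2) by auto
qed

text \<open>Cut off outside \<open>S\<close> so that elements of \<open>polys S k\<close> are
  combinations of these as functions on the whole type. On a small \<open>S\<close> they may be
  linearly dependent, so they serve only as generators; the basis comes from
  \<open>nodal_space_exists\<close>.\<close>

definition state_monomial :: "(real ^ 'n) set \<Rightarrow> ('n::finite \<Rightarrow> nat) \<Rightarrow> 'n state \<Rightarrow> real" where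
  "state_monomial S a x = (case x of None \<Rightarrow> 0 | Some y \<Rightarrow> if y \<in> S then \<Prod>i\<in>UNIV. (y $ i) ^ a i else 0)"

lemma polys_spanned:
  assumes "f \<in> polys S k"
  shows "\<exists>c. f = (\<lambda>x. \<Sum>a\<in>{a. (\<Sum>i\<in>UNIV. a i) \<le> k}. c a * state_monomial S a x)"
proof -
  obtain q where q: "polynomial_of_degree_le k q" "\<And>y. y \<in> S \<Longrightarrow> f (Some y) = q y"
    "f None = 0" "\<And>x. x \<notin> states S \<Longrightarrow> f x = 0"
    using assms by (rule polysE) (rule that)
  obtain c where c: "\<And>y. q y = (\<Sum>a | (\<Sum>i\<in>UNIV. a i) \<le> k. c a * (\<Prod>i\<in>UNIV. (y $ i) ^ a i))"
    using q(1) unfolding polynomial_of_degree_le_def by blast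
  have "f x = (\<Sum>a\<in>{a. (\<Sum>i\<in>UNIV. a i) \<le> k}. c a * state_monomial S a x)" for x
  proof (cases x)
    case None
    then show ?thesis using q(3) by (simp add: state_monomial_def)
  next
    case (Some y)
    show ?thesis
    proof (cases "y \<in> S")
      case True
      then show ?thesis using q(2) c Some by (simp add: state_monomial_def)
    next
      case False
      then have "x \<notin> states S" using Some by (auto simp: states_def)
      then show ?thesis using q(4) Some False by (simp add: state_monomial_def)
    qed
  qed
  then show ?thesis by blast
qed

lemma continuous_polynomial: "polynomial_of_degree_le k q \<Longrightarrow> continuous_on A q"
proof -
  assume "polynomial_of_degree_le k q"
  then obtain c where "\<And>y. q y = (\<Sum>a | (\<Sum>i\<in>UNIV. a i) \<le> k. c a * (\<Prod>i\<in>UNIV. (y $ i) ^ a i))"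
    unfolding polynomial_of_degree_le_def by blast
  then have "q = (\<lambda>y. \<Sum>a | (\<Sum>i\<in>UNIV. a i) \<le> k. c a * (\<Prod>i\<in>UNIV. (y $ i) ^ a i))" by (rule ext)
  then show "continuous_on A q" by (simp only:) (intro continuous_intros)
qed

section \<open>Measurability and right continuity of polynomials on the extended state space\<close>

lemma space_state_algebra [simp]: "space (state_algebra S) = states S"
  unfolding state_algebra_def by (rule space_measure_of) (auto simp: states_def sets_restrict_space)

lemma sets_state_algebra:
  "sets (state_algebra S) = sigma_sets (states S) (insert {None} ((`) Some ` sets (restrict_space borel S)))"
  unfolding state_algebra_def by (rule sets_measure_of) (auto simp: states_def sets_restrict_space)

lemma None_in_state_algebra [measurable]: "{None} \<in> sets (state_algebra S)"
  unfolding sets_state_algebra by (rule sigma_sets.Basic) simp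

lemma Some_in_state_algebra: "C \<in> sets (restrict_space borel S) \<Longrightarrow> Some ` C \<in> sets (state_algebra S)"
  unfolding sets_state_algebra by (rule sigma_sets.Basic) simp

lemma Some_S_in_state_algebra [measurable]: "Some ` S \<in> sets (state_algebra S)"
  by (rule Some_in_state_algebra) (metis sets.top space_borel space_restrict_space Int_UNIV_right)

lemma polys_measurable:
  assumes "f \<in> polys S k"
  shows "f \<in> borel_measurable (state_algebra S)"
proof (rule measurableI)
  fix B :: "real set" assume B: "B \<in> sets borel"
  obtain q where q: "polynomial_of_degree_le k q" "\<And>y. y \<in> S \<Longrightarrow> f (Some y) = q y"
    "f None = 0"
    using assms by (rule polysE) (rule that)
  have "q \<in> borel_measurable borel"
    by (rule borel_measurable_continuous_onI[OF continuous_polynomial[OF q(1)]])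
  from measurable_sets[OF this B] have "S \<inter> q -` B \<in> sets (restrict_space borel S)"
    by (auto simp: sets_restrict_space)
  then have "Some ` (S \<inter> q -` B) \<in> sets (state_algebra S)" by (rule Some_in_state_algebra)
  moreover have "f -` B \<inter> states S = Some ` (S \<inter> q -` B) \<union> (if 0 \<in> B then {None} else {})"
    using q(2,3) by (auto simp: states_def)
  ultimately show "f -` B \<inter> space (state_algebra S) \<in> sets (state_algebra S)"
    by (auto intro: sets.insert_in_sets None_in_state_algebra)
qed simp

text \<open>A polynomial may be discontinuous at the cemetery, so two reasons are needed: a path at
  the cemetery stays there, and at a point of \<open>S\<close> convergence is tested on open subsets
  of \<open>S\<close>, which are open in the compactification. The point \<open>t\<close> is kept in
  \<open>{t..}\<close> because the approximating times in \<open>joint_measurable\<close> may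
  coincide with their limit.\<close>

lemma polys_right_continuous:
  assumes w: "w \<in> paths S" and f: "f \<in> polys S k" and t: "t \<ge> 0"
  shows "continuous (at t within {t..}) (\<lambda>s. f (w s))"
proof (cases "w t")
  case None
  then have "w s = None" if "s \<ge> t" for s using w t that unfolding paths_def by blast
  then show ?thesis
    unfolding continuous_within
    by (intro tendsto_eventually) (auto simp: eventually_at_filter None intro!: always_eventually)
next
  case (Some y)
  obtain q where q: "polynomial_of_degree_le k q" "\<And>y. y \<in> S \<Longrightarrow> f (Some y) = q y"
    using f by (rule polysE) (rule that)
  have "w t \<in> states S" using w t unfolding paths_def by (auto simp: PiE_def Pi_def)
  then have y: "y \<in> S" using Some by (auto simp: states_def)
  have lim: "limitin (state_topology S) w (Some y) (at_right t)"
    using w t Some unfolding paths_def cadlag_def by auto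
  have "\<forall>\<^sub>F s in at_right t. dist (f (w s)) (q y) < \<epsilon>" if "\<epsilon> > 0" for \<epsilon>
  proof -
    have "open (q -` ball (q y) \<epsilon>)"
      by (rule open_vimage[OF open_ball continuous_polynomial[OF q(1)]])
    then have "openin (state_topology S) (Some ` (S \<inter> q -` ball (q y) \<epsilon>))"
      unfolding state_topology_def by (simp add: openin_open_Int)
    moreover have "Some y \<in> Some ` (S \<inter> q -` ball (q y) \<epsilon>)" using y that by auto
    ultimately have "\<forall>\<^sub>F s in at_right t. w s \<in> Some ` (S \<inter> q -` ball (q y) \<epsilon>)"
      using lim unfolding limitin_def by blast
    then show ?thesis
      by eventually_elim (use q(2) in \<open>auto simp: dist_commute\<close>)
  qed
  then have "((\<lambda>s. f (w s)) \<longlongrightarrow> q y) (at_right t)" by (rule tendstoI)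
  moreover have "at_right t = at t within {t..}"
    unfolding at_within_def by (rule arg_cong[where f = "\<lambda>A. inf (nhds t) (principal A)"]) auto
  ultimately show ?thesis unfolding continuous_within using q(2)[OF y] Some by simp
qed

lemma nodal_space_polys: obtains X e where "nodal_space (polys S k) X e"
  by (rule nodal_space_exists[OF finite_multi_indices[where k = k] subspace_polys polys_spanned])

section \<open>The Markov process\<close>

context transition_function
begin

lemma kernel_space:
  assumes "x \<in> states S" "t \<ge> 0"
  shows "subprob_space (p t x)" "sets (p t x) = sets (state_algebra S)" "space (p t x) = states S"
proof -
  have "p t x \<in> space (subprob_algebra (state_algebra S))"
    using measurable_space[OF kernel[OF assms(2)]] assms(1) by simp
  then show "subprob_space (p t x)" "sets (p t x) = sets (state_algebra S)"
    by (simp_all add: space_subprob_algebra)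
  from sets_eq_imp_space_eq[OF this(2)] show "space (p t x) = states S" by simp
qed

lemma prob_space_kernel:
  assumes "x \<in> states S" "t \<ge> 0"
  shows "prob_space (p t x)"
proof -
  interpret subprob_space "p t x" by (rule kernel_space[OF assms])
  have meas: "{None} \<in> sets (p t x)" "Some ` S \<in> sets (p t x)"
    unfolding kernel_space(2)[OF assms] by measurable
  have "measure (p t x) (states S) = 1"
  proof (cases x)
    case None
    have "states S \<in> sets (p t x)" using sets.top[of "p t x"] kernel_space(3)[OF assms] by simp
    then have "measure (p t x) {None} \<le> measure (p t x) (states S)"
      by (intro finite_measure_mono) (auto simp: states_def)
    then have "1 \<le> measure (p t x) (states S)"
      using absorbing[OF assms(2)] None by simp
    then show ?thesis using subprob_measure_le_1[of "states S"] by linarith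
  next
    case (Some y)
    then have "y \<in> S" using assms(1) by (auto simp: states_def)
    have "measure (p t x) ({None} \<union> Some ` S) = measure (p t x) {None} + measure (p t x) (Some ` S)"
      by (rule finite_measure_Union[OF meas]) auto
    then show ?thesis using killing[OF assms(2) \<open>y \<in> S\<close>] Some by (simp add: states_def)
  qed
  then show ?thesis
    by (intro prob_spaceI) (simp add: emeasure_eq_measure kernel_space(3)[OF assms])
qed

end

section \<open>One-dimensional laws and time integrals along paths\<close>

context markov_process
begin

abbreviation P where "P \<equiv> transition_semigroup S p"

lemma subalgebra_F: "x \<in> states S \<Longrightarrow> t \<ge> 0 \<Longrightarrow> subalgebra (Pr x) (F t)"
  unfolding subalgebra_def using space_F space_Pr sets_Pr by (auto intro!: sigma_sets.Basic)

lemma sigma_finite_subalgebra_F: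
  assumes "x \<in> states S" "t \<ge> 0"
  shows "sigma_finite_subalgebra (Pr x) (F t)"
proof (rule finite_measure_subalgebra_is_sigma_finite)
  interpret prob_space "Pr x" by (rule prob_space_Pr[OF assms(1)])
  show "finite_measure_subalgebra (Pr x) (F t)"
    by unfold_locales (rule subalgebra_F[OF assms])
qed

lemma coordinate_measurable:
  assumes "x \<in> states S" "t \<ge> 0"
  shows "(\<lambda>w. w t) \<in> Pr x \<rightarrow>\<^sub>M state_algebra S"
  by (rule measurable_from_subalg[OF subalgebra_F[OF assms] adapted[OF assms(2)]])

lemma coordinate_measurable_F:
  assumes "0 \<le> s" "s \<le> t"
  shows "(\<lambda>w. w s) \<in> F t \<rightarrow>\<^sub>M state_algebra S"
proof (rule measurable_from_subalg[OF _ adapted[OF assms(1)]])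
  show "subalgebra (F t) (F s)"
    unfolding subalgebra_def using space_F[of s] space_F[of t] mono_F[OF assms] assms by auto
qed

text \<open>The Markov property at time 0 for the indicator of \<open>B\<close>, which vanishes at
  the cemetery as \<open>markov\<close> demands. The conditional expectation given
  \<open>F 0\<close> is then almost surely the constant \<open>P t (indicator B) x\<close>, because
  the path starts at \<open>x\<close>.\<close>

lemma law_indicator:
  assumes x: "x \<in> states S" and t: "t \<ge> 0" and B: "B \<in> sets (state_algebra S)" and "None \<notin> B"
  shows "measure (distr (Pr x) (state_algebra S) (\<lambda>w. w t)) B = measure (p t x) B"
proof -
  interpret Pr: prob_space "Pr x" by (rule prob_space_Pr[OF x])
  interpret sigma_finite_subalgebra "Pr x" "F 0" by (rule sigma_finite_subalgebra_F[OF x order_refl])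
  note [measurable] = coordinate_measurable[OF x t] B
  have B_sub: "B \<subseteq> Some ` S" using sets.sets_into_space[OF B] \<open>None \<notin> B\<close> by (auto simp: states_def)
  have f: "(indicator B :: _ \<Rightarrow> real) \<in> borel_measurable (state_algebra S)" by simp
  have int: "integrable (Pr y) (\<lambda>w. indicator B (w u) :: real)" if "y \<in> states S" "u \<ge> 0" for y u
  proof -
    interpret Y: prob_space "Pr y" by (rule prob_space_Pr[OF that(1)])
    show ?thesis
      using measurable_compose[OF coordinate_measurable[OF that] f]
      by (intro Y.integrable_const_bound[where B = 1]) (auto simp: indicator_def)
  qed
  have "AE w in Pr x. real_cond_exp (Pr x) (F 0) (\<lambda>w. indicator B (w (t + 0))) w = P t (indicator B) (w 0)"
    using \<open>None \<notin> B\<close> by (intro markov f int x t order_refl) (auto simp: states_def)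
  then have AE: "AE w in Pr x. real_cond_exp (Pr x) (F 0) (\<lambda>w. indicator B (w t)) w = P t (indicator B) x"
    using initial_value[OF x] by eventually_elim simp
  have "measure (distr (Pr x) (state_algebra S) (\<lambda>w. w t)) B = (\<integral>w. indicator B (w t) \<partial>Pr x)"
    using integral_distr[OF coordinate_measurable[OF x t] f] sets.sets_into_space[OF B]
    by (simp add: Int_absorb2)
  also have "\<dots> = (\<integral>w. real_cond_exp (Pr x) (F 0) (\<lambda>w. indicator B (w t)) w \<partial>Pr x)"
    by (rule real_cond_exp_int(2)[OF int[OF x t], symmetric])
  also have "\<dots> = (\<integral>w. P t (indicator B) x \<partial>Pr x)"
    by (rule integral_cong_AE[OF _ _ AE]) auto
  also have "\<dots> = P t (indicator B) x" by (simp add: Pr.prob_space)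
  also have "\<dots> = (\<integral>y. indicator B y \<partial>p t x)"
    unfolding transition_semigroup_def set_lebesgue_integral_def using x B_sub
    by (auto intro!: Bochner_Integration.integral_cong simp: indicator_def)
  also have "\<dots> = measure (p t x) B"
    using B sets.sets_into_space[OF B] kernel_space[OF x t] by (simp add: Int_absorb2)
  finally show ?thesis .
qed

text \<open>Sets containing the cemetery are reached through complements, both measures having total
  mass 1.\<close>

lemma law:
  assumes x: "x \<in> states S" and t: "t \<ge> 0"
  shows "distr (Pr x) (state_algebra S) (\<lambda>w. w t) = p t x"
proof (rule measure_eqI)
  interpret Pr: prob_space "Pr x" by (rule prob_space_Pr[OF x])
  interpret D: prob_space "distr (Pr x) (state_algebra S) (\<lambda>w. w t)"
    by (rule Pr.prob_space_distr[OF coordinate_measurable[OF x t]])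
  interpret K: prob_space "p t x" by (rule prob_space_kernel[OF x t])
  show "sets (distr (Pr x) (state_algebra S) (\<lambda>w. w t)) = sets (p t x)"
    using kernel_space(2)[OF x t] by simp
  fix B assume "B \<in> sets (distr (Pr x) (state_algebra S) (\<lambda>w. w t))"
  then have B: "B \<in> sets (state_algebra S)" by simp
  have "measure (distr (Pr x) (state_algebra S) (\<lambda>w. w t)) B = measure (p t x) B"
  proof (cases "None \<in> B")
    case True
    have C: "states S - B \<in> sets (state_algebra S)"
      using sets.compl_sets[OF B] by simp
    have "measure (distr (Pr x) (state_algebra S) (\<lambda>w. w t)) (states S - B) = measure (p t x) (states S - B)"
      by (rule law_indicator[OF x t C]) (use True in simp)
    then show ?thesis
      using D.prob_compl[of B] K.prob_compl[of B] B kernel_space[OF x t] by simp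
  qed (rule law_indicator[OF x t B])
  then show "emeasure (distr (Pr x) (state_algebra S) (\<lambda>w. w t)) B = emeasure (p t x) B"
    by (simp add: D.emeasure_eq_measure K.emeasure_eq_measure)
qed

lemma polys_coordinate_measurable:
  assumes "x \<in> states S" "t \<ge> 0" "f \<in> polys S k"
  shows "(\<lambda>w. f (w t)) \<in> borel_measurable (Pr x)"
  by (rule measurable_compose[OF coordinate_measurable[OF assms(1,2)] polys_measurable[OF assms(3)]])

text \<open>Change of variables by \<open>law\<close>; since \<open>f\<close> is 0 at the cemetery,
  integrating over the image of \<open>S\<close> alone loses nothing.\<close>

lemma semigroup_abs_eq:
  assumes x: "x \<in> states S" and t: "t \<ge> 0" and f: "f \<in> polys S k"
  shows "transition_semigroup_abs S p t f x = (\<integral>\<^sup>+ w. ennreal \<bar>f (w t)\<bar> \<partial>Pr x)"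
proof -
  have [measurable]: "f \<in> borel_measurable (state_algebra S)" by (rule polys_measurable[OF f])
  have "transition_semigroup_abs S p t f x = (\<integral>\<^sup>+ y. ennreal \<bar>f y\<bar> \<partial>p t x)"
    unfolding transition_semigroup_abs_def
    by (rule nn_integral_cong)
      (use kernel_space(3)[OF x t] polys_None[OF f] in \<open>auto simp: states_def indicator_def\<close>)
  also have "\<dots> = (\<integral>\<^sup>+ w. ennreal \<bar>f (w t)\<bar> \<partial>Pr x)"
    unfolding law[OF x t, symmetric] by (rule nn_integral_distr[OF coordinate_measurable[OF x t]]) simp
  finally show ?thesis .
qed

lemma semigroup_eq:
  assumes x: "x \<in> states S" and t: "t \<ge> 0" and f: "f \<in> polys S k"
  shows "P t f x = (\<integral>w. f (w t) \<partial>Pr x)"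
proof -
  have "P t f x = (\<integral>y. f y \<partial>p t x)"
    unfolding transition_semigroup_def set_lebesgue_integral_def using x
    by (simp, intro Bochner_Integration.integral_cong)
      (use kernel_space(3)[OF x t] polys_None[OF f] in \<open>auto simp: states_def indicator_def\<close>)
  also have "\<dots> = (\<integral>w. f (w t) \<partial>Pr x)"
    unfolding law[OF x t, symmetric] by (rule integral_distr[OF coordinate_measurable[OF x t] polys_measurable[OF f]])
  finally show ?thesis .
qed

text \<open>Progressive measurability: times are discretised from the right, and right continuity of
  the path identifies the limit. The algebra is that of \<open>F T\<close> and not merely that of
  \<open>Pr x\<close>, so that time integrals up to \<open>T\<close> are adapted.\<close>

lemma joint_measurable:
  assumes T: "T \<ge> 0" and f: "f \<in> polys S k"
  shows "(\<lambda>(w, s). indicator {0..T} s * f (w s)) \<in> borel_measurable (F T \<Otimes>\<^sub>M (borel :: real measure))"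
proof -
  \<comment> \<open>For fixed \<open>n\<close> the unclamped time has countably many values
    \<open>i / Suc n\<close>. Clamping to \<open>{0..T}\<close> keeps each evaluation measurable for
    \<open>F T\<close>; \<open>c\<close> is the limit of \<open>u n\<close>, approached from
    above.\<close>
  define u where "u = (\<lambda>n s. max 0 (min T (of_int \<lceil>s * real (Suc n)\<rceil> / real (Suc n))))"
  define c where "c = (\<lambda>s. max 0 (min T s))"
  have u_lim: "(\<lambda>n. u n s) \<longlonglongrightarrow> c s" for s
  proof -
    have "(\<lambda>n. of_int \<lceil>s * real (Suc n)\<rceil> / real (Suc n)) \<longlonglongrightarrow> s"
    proof (rule tendsto_sandwich[where f = "\<lambda>n. s" and h = "\<lambda>n. s + 1 / real (Suc n)"])
      show "\<forall>\<^sub>F n in sequentially. s \<le> of_int \<lceil>s * real (Suc n)\<rceil> / real (Suc n)"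
        by (intro always_eventually allI) (subst pos_le_divide_eq, simp, rule le_of_int_ceiling)
      have "of_int \<lceil>s * real (Suc n)\<rceil> / real (Suc n) \<le> (s * real (Suc n) + 1) / real (Suc n)" for n
        by (intro divide_right_mono of_int_ceiling_le_add_one) simp
      then show "\<forall>\<^sub>F n in sequentially. of_int \<lceil>s * real (Suc n)\<rceil> / real (Suc n) \<le> s + 1 / real (Suc n)"
        by (intro always_eventually allI) (simp add: add_divide_distrib del: of_nat_Suc)
      show "(\<lambda>n. s + 1 / real (Suc n)) \<longlonglongrightarrow> s"
        using tendsto_add[OF tendsto_const LIMSEQ_Suc[OF lim_1_over_n], of s] by simp
    qed simp
    then show ?thesis unfolding u_def c_def by (intro tendsto_intros)
  qed
  have u_ge: "u n s \<in> {c s..}" for n s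
  proof -
    have "s \<le> of_int \<lceil>s * real (Suc n)\<rceil> / real (Suc n)"
      by (subst pos_le_divide_eq, simp, rule le_of_int_ceiling)
    then show ?thesis by (auto simp: u_def c_def)
  qed
  have "(\<lambda>(w, s). f (w (c s))) \<in> borel_measurable (F T \<Otimes>\<^sub>M borel)"
  proof (rule borel_measurable_LIMSEQ_real)
    fix ws assume ws: "ws \<in> space (F T \<Otimes>\<^sub>M (borel :: real measure))"
    obtain w s where [simp]: "ws = (w, s)" by fastforce
    have "w \<in> paths S" using ws space_F[OF T] by (simp add: space_pair_measure)
    then have "continuous (at (c s) within {c s..}) (\<lambda>s. f (w s))"
      using f by (rule polys_right_continuous) (simp add: c_def)
    from continuous_within_tendsto_compose'[OF this u_ge u_lim]
    show "(\<lambda>n. case ws of (w, s) \<Rightarrow> f (w (u n s))) \<longlonglongrightarrow> (case ws of (w, s) \<Rightarrow> f (w (c s)))" by simp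
  next
    fix n
    have "(\<lambda>ws. f (fst ws (max 0 (min T (of_int \<lceil>snd ws * real (Suc n)\<rceil> / real (Suc n)))))) \<in> borel_measurable (F T \<Otimes>\<^sub>M borel)"
    proof (rule measurable_compose_countable[where f = "\<lambda>(i::int) ws. f (fst ws (max 0 (min T (of_int i / real (Suc n)))))"
          and g = "\<lambda>ws. \<lceil>snd ws * real (Suc n)\<rceil>"])
      show "(\<lambda>ws. f (fst ws (max 0 (min T (of_int i / real (Suc n)))))) \<in> borel_measurable (F T \<Otimes>\<^sub>M borel)" for i :: int
        using T by (intro measurable_compose[OF measurable_fst]
            measurable_compose[OF coordinate_measurable_F polys_measurable[OF f]]) auto
    qed measurable
    then show "(\<lambda>(w, s). f (w (u n s))) \<in> borel_measurable (F T \<Otimes>\<^sub>M borel)"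
      by (simp add: u_def case_prod_beta)
  qed
  then have [measurable]: "(\<lambda>ws. f (fst ws (c (snd ws)))) \<in> borel_measurable (F T \<Otimes>\<^sub>M borel)"
    by (simp add: case_prod_beta)
  have "(\<lambda>ws. indicator {0..T} (snd ws) * f (fst ws (c (snd ws)))) \<in> borel_measurable (F T \<Otimes>\<^sub>M borel)"
    by measurable
  also have "(\<lambda>ws. indicator {0..T} (snd ws) * f (fst ws (c (snd ws)))) = (\<lambda>(w, s). indicator {0..T} s * f (w s))"
    by (auto simp: fun_eq_iff indicator_def c_def)
  finally show ?thesis .
qed

lemma joint_measurable_Pr:
  assumes "x \<in> states S" "T \<ge> 0" "f \<in> polys S k"
  shows "(\<lambda>(w, s). indicator {0..T} s * f (w s)) \<in> borel_measurable (Pr x \<Otimes>\<^sub>M lborel)"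
proof -
  have "(\<lambda>q. q) \<in> Pr x \<Otimes>\<^sub>M lborel \<rightarrow>\<^sub>M F T \<Otimes>\<^sub>M (borel :: real measure)"
    using measurable_from_subalg[OF subalgebra_F[OF assms(1,2)], of "\<lambda>w. w" "F T"]
    by (intro measurable_pair) (auto simp: comp_def)
  from measurable_compose[OF this joint_measurable[OF assms(2,3)]] show ?thesis .
qed

text \<open>The time integral is a parameter integral of a jointly measurable function. Paths on
  which it diverges make no exception: the Lebesgue integral assigns them the value 0.\<close>

lemma gen_process_measurable:
  assumes T: "T \<ge> 0" and f: "f \<in> polys S k" and g: "g \<in> polys S l"
  shows "gen_process f g x T \<in> borel_measurable (F T)"
proof -
  have "(\<lambda>w. \<integral>s. indicator {0..T} s * g (w s) \<partial>lborel) \<in> borel_measurable (F T)"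
    using joint_measurable[OF T g]
    by (intro lborel.borel_measurable_lebesgue_integral) (simp cong: measurable_cong_sets sets_pair_measure_cong)
  moreover have "(\<lambda>w. f (w T)) \<in> borel_measurable (F T)"
    by (rule measurable_compose[OF adapted[OF T] polys_measurable[OF f]])
  ultimately show ?thesis
    unfolding gen_process_def set_lebesgue_integral_def by simp
qed

lemma occupation_integrable:
  assumes x: "x \<in> states S" and T: "T \<ge> 0" and f: "f \<in> polys S k"
    and fin: "(\<integral>\<^sup>+ s. \<integral>\<^sup>+ w. ennreal \<bar>indicator {0..T} s * f (w s)\<bar> \<partial>Pr x \<partial>lborel) < \<infinity>"
  shows "integrable (Pr x \<Otimes>\<^sub>M lborel) (\<lambda>(w, s). indicator {0..T} s * f (w s))"
proof -
  interpret Pr: prob_space "Pr x" by (rule prob_space_Pr[OF x])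
  interpret pair_sigma_finite "Pr x" lborel by unfold_locales
  note [measurable] = joint_measurable_Pr[OF x T f]
  have "(\<integral>\<^sup>+ ws. ennreal (norm (case ws of (w, s) \<Rightarrow> indicator {0..T} s * f (w s))) \<partial>(Pr x \<Otimes>\<^sub>M lborel))
      = (\<integral>\<^sup>+ s. \<integral>\<^sup>+ w. ennreal \<bar>indicator {0..T} s * f (w s)\<bar> \<partial>Pr x \<partial>lborel)"
    by (subst nn_integral_snd[symmetric]) auto
  then show ?thesis using fin by (intro integrableI_bounded) auto
qed

text \<open>The set \<open>B\<close> is carried along because the martingale property is tested by
  integrating over sets known at an earlier time; plain expectations use the whole space.\<close>

lemma occupation_fubini:
  assumes x: "x \<in> states S" and T: "T \<ge> 0" and f: "f \<in> polys S k"
    and int: "integrable (Pr x \<Otimes>\<^sub>M lborel) (\<lambda>(w, s). indicator {0..T} s * f (w s))"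
    and B: "B \<in> sets (Pr x)"
  shows "AE w in Pr x. set_integrable lborel {0..T} (\<lambda>s. f (w s))"
    and "integrable (Pr x) (\<lambda>w. LINT s:{0..T}|lborel. f (w s))"
    and "set_integrable lborel {0..T} (\<lambda>s. LINT w:B|Pr x. f (w s))"
    and "(LINT w:B|Pr x. LINT s:{0..T}|lborel. f (w s)) = (LINT s:{0..T}|lborel. LINT w:B|Pr x. f (w s))"
proof -
  interpret Pr: prob_space "Pr x" by (rule prob_space_Pr[OF x])
  interpret pair_sigma_finite "Pr x" lborel by unfold_locales
  show "AE w in Pr x. set_integrable lborel {0..T} (\<lambda>s. f (w s))"
    using AE_integrable_fst'[OF int] unfolding set_integrable_def by simp
  show "integrable (Pr x) (\<lambda>w. LINT s:{0..T}|lborel. f (w s))"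
    using integrable_fst'[OF int] unfolding set_lebesgue_integral_def by simp
  have "integrable (Pr x \<Otimes>\<^sub>M lborel) (\<lambda>ws. indicator (B \<times> UNIV) ws *\<^sub>R (case ws of (w, s) \<Rightarrow> indicator {0..T} s * f (w s)))"
    by (rule integrable_mult_indicator[OF _ int]) (use B in auto)
  then have int': "integrable (Pr x \<Otimes>\<^sub>M lborel) (\<lambda>(w, s). indicator {0..T} s * (indicator B w * f (w s)))"
    by (rule back_subst[where P = "integrable _"]) (auto simp: fun_eq_iff indicator_def)
  from integrable_snd[OF int'] show "set_integrable lborel {0..T} (\<lambda>s. LINT w:B|Pr x. f (w s))"
    unfolding set_integrable_def set_lebesgue_integral_def by simp
  have s: "(\<integral>w. indicator {0..T} s * (indicator B w * f (w s)) \<partial>Pr x)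
      = indicator {0..T} s * (\<integral>w. indicator B w * f (w s) \<partial>Pr x)" for s
    by (rule integral_mult_right_zero)
  have w: "(\<integral>s. indicator {0..T} s * (indicator B w * f (w s)) \<partial>lborel)
      = indicator B w * (\<integral>s. indicator {0..T} s * f (w s) \<partial>lborel)" for w
    by (subst integral_mult_right_zero[symmetric]) (simp only: mult.left_commute)
  from Fubini_integral[OF int', symmetric, unfolded s w]
  show "(LINT w:B|Pr x. LINT s:{0..T}|lborel. f (w s)) = (LINT s:{0..T}|lborel. LINT w:B|Pr x. f (w s))"
    unfolding set_lebesgue_integral_def real_scaleR_def .
qed

end

section \<open>Polynomial processes and matrix exponentials\<close>

context sigma_finite_subalgebra
begin

text \<open>The sign of the conditional expectation is \<open>F\<close>-measurable, so
  \<open>sgn (?c x) * ?c x\<close> and \<open>sgn (?c x) * f x\<close> have the same integral, and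
  the latter is at most \<open>\<bar>f x\<bar>\<close> pointwise.\<close>

lemma real_cond_exp_L1_contraction:
  assumes "integrable M f"
  shows "(\<integral>x. \<bar>real_cond_exp M F f x\<bar> \<partial>M) \<le> (\<integral>x. \<bar>f x\<bar> \<partial>M)"
proof -
  let ?c = "real_cond_exp M F f"
  have [measurable]: "f \<in> borel_measurable M" using assms by simp
  have sgn: "(\<lambda>x. sgn (?c x)) \<in> borel_measurable F" by measurable
  then have [measurable]: "(\<lambda>x. sgn (?c x)) \<in> borel_measurable M" by (rule measurable_from_subalg[OF subalg])
  have int: "integrable M (\<lambda>x. sgn (?c x) * f x)"
    by (rule Bochner_Integration.integrable_bound[OF assms]) (auto simp: abs_mult sgn_if)
  have "(\<integral>x. \<bar>?c x\<bar> \<partial>M) = (\<integral>x. sgn (?c x) * ?c x \<partial>M)"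
    by (rule Bochner_Integration.integral_cong) (auto simp: sgn_if)
  also have "\<dots> = (\<integral>x. sgn (?c x) * f x \<partial>M)"
    by (rule real_cond_exp_intg(2)[OF int sgn]) simp
  also have "\<dots> \<le> (\<integral>x. \<bar>f x\<bar> \<partial>M)"
    by (rule integral_mono[OF int]) (use assms in \<open>auto simp: sgn_if\<close>)
  finally show ?thesis .
qed

end

text \<open>Integrability is recorded for all starting points and all times because
  \<open>markov\<close> admits \<open>f\<close> under exactly such a condition.\<close>

locale markov_moments = markov_process S p F Pr
  for S :: "(real ^ 'n::finite) set" and p :: "real \<Rightarrow> 'n state \<Rightarrow> 'n state measure"
    and F :: "real \<Rightarrow> 'n path measure" and Pr :: "'n state \<Rightarrow> 'n path measure" +
  fixes m :: nat
  assumes moments: "\<And>f x t. f \<in> polys S m \<Longrightarrow> x \<in> states S \<Longrightarrow> t \<ge> 0 \<Longrightarrow> integrable (Pr x) (\<lambda>w. f (w t))"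

lemma (in markov_process) markov_momentsI:
  assumes "\<And>f x t. f \<in> polys S m \<Longrightarrow> x \<in> states S \<Longrightarrow> t \<ge> 0 \<Longrightarrow> transition_semigroup_abs S p t f x < \<infinity>"
  shows "markov_moments S p F Pr m"
proof
  fix f x and t :: real assume *: "f \<in> polys S m" "x \<in> states S" "t \<ge> 0"
  then show "integrable (Pr x) (\<lambda>w. f (w t))"
    using assms[OF *] semigroup_abs_eq[OF *(2,3,1)] polys_coordinate_measurable[OF *(2,3,1)]
    by (intro integrableI_bounded) auto
qed

context markov_moments
begin

lemma semigroup_outside: "x \<notin> states S \<Longrightarrow> P t f x = 0"
  by (simp add: transition_semigroup_def)

lemma semigroup_add_fun:
  assumes "f \<in> polys S m" "g \<in> polys S m" "t \<ge> 0"
  shows "P t (\<lambda>x. f x + g x) = (\<lambda>x. P t f x + P t g x)"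
proof
  fix x
  show "P t (\<lambda>x. f x + g x) x = P t f x + P t g x"
  proof (cases "x \<in> states S")
    case True
    then show ?thesis
      using assms moments function_subspaceD(2)[OF subspace_polys assms(1,2)]
      by (simp add: semigroup_eq)
  qed (simp add: semigroup_outside)
qed

lemma semigroup_scale:
  assumes "f \<in> polys S m" "t \<ge> 0"
  shows "P t (\<lambda>x. c * f x) = (\<lambda>x. c * P t f x)"
proof
  fix x
  show "P t (\<lambda>x. c * f x) x = c * P t f x"
  proof (cases "x \<in> states S")
    case True
    then show ?thesis
      using assms function_subspaceD(3)[OF subspace_polys assms(1), of c]
      by (simp add: semigroup_eq)
  qed (simp add: semigroup_outside)
qed

lemma semigroup_linear:
  assumes "k \<le> m" "t \<ge> 0" "\<And>f. f \<in> polys S k \<Longrightarrow> P t f \<in> polys S k"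
  shows "linear_map_on (polys S k) (P t)"
  unfolding linear_map_on_def
  using assms polys_mono[OF assms(1)] by (auto intro!: semigroup_add_fun semigroup_scale)

lemma semigroup_zero_time:
  assumes "f \<in> polys S m"
  shows "P 0 f = f"
proof
  fix x
  show "P 0 f x = f x"
  proof (cases "x \<in> states S")
    case True
    interpret prob_space "Pr x" by (rule prob_space_Pr[OF True])
    have "P 0 f x = (\<integral>w. f x \<partial>Pr x)"
      unfolding semigroup_eq[OF True order_refl assms]
      by (rule integral_cong_AE)
        (use initial_value[OF True] polys_coordinate_measurable[OF True order_refl assms] in auto)
    then show ?thesis by (simp add: prob_space)
  next
    case False
    then show ?thesis using polys_outside[OF assms] by (simp add: semigroup_outside)
  qed
qed

lemma cond_exp_semigroup:
  assumes "f \<in> polys S m" "x \<in> states S" "s \<ge> 0" "t \<ge> 0"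
  shows "AE w in Pr x. real_cond_exp (Pr x) (F s) (\<lambda>w. f (w (t + s))) w = P t f (w s)"
  using assms by (intro markov polys_measurable polys_None moments) (auto simp: states_def)

text \<open>The tower rule for the Markov property at time \<open>s\<close>. As \<open>P t f\<close>
  is again a polynomial, \<open>semigroup_eq\<close> recognises its expectation at time
  \<open>s\<close> as \<open>P s (P t f)\<close>.\<close>

lemma semigroup_add_time:
  assumes f: "f \<in> polys S m" and st: "s \<ge> 0" "t \<ge> 0" and inv: "P t f \<in> polys S m"
  shows "P (s + t) f = P s (P t f)"
proof
  fix x
  show "P (s + t) f x = P s (P t f) x"
  proof (cases "x \<in> states S")
    case True
    interpret sigma_finite_subalgebra "Pr x" "F s" by (rule sigma_finite_subalgebra_F[OF True st(1)])
    have st': "t + s \<ge> 0" using st by simp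
    have "P (s + t) f x = (\<integral>w. f (w (t + s)) \<partial>Pr x)"
      using semigroup_eq[OF True st' f] by (simp add: add.commute)
    also have "\<dots> = (\<integral>w. real_cond_exp (Pr x) (F s) (\<lambda>w. f (w (t + s))) w \<partial>Pr x)"
      by (rule real_cond_exp_int(2)[OF moments[OF f True st'], symmetric])
    also have "\<dots> = (\<integral>w. P t f (w s) \<partial>Pr x)"
      by (rule integral_cong_AE[OF _ polys_coordinate_measurable[OF True st(1) inv] cond_exp_semigroup[OF f True st]]) simp
    finally show ?thesis unfolding semigroup_eq[OF True st(1) inv] .
  qed (simp add: semigroup_outside)
qed

lemma semigroup_is_exp_if_invariant:
  assumes inv: "\<And>k f t. k \<le> m \<Longrightarrow> f \<in> polys S k \<Longrightarrow> t \<ge> 0 \<Longrightarrow> P t f \<in> polys S k"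
    and cont: "\<And>f x. f \<in> polys S m \<Longrightarrow> x \<in> states S \<Longrightarrow> continuous (at 0 within {0..}) (\<lambda>t. P t f x)"
    and k: "k \<le> m"
  obtains A where "linear_map_on (polys S k) A" "\<And>t f. t \<ge> 0 \<Longrightarrow> f \<in> polys S k \<Longrightarrow> P t f = exp_map t A f"
proof -
  obtain X e where "nodal_space (polys S k) X e" by (rule nodal_space_polys)
  then interpret nodal_space "polys S k" X e .
  have sub: "f \<in> polys S m" if "f \<in> polys S k" for f using polys_mono[OF k] that by blast
  interpret nodal_semigroup "polys S k" X e P
  proof
    show "linear_map_on (polys S k) (P t)" if "t \<ge> 0" for t
      using inv[OF k _ that] by (rule semigroup_linear[OF k that])
    show "P 0 f = f" if "f \<in> polys S k" for f by (rule semigroup_zero_time[OF sub[OF that]])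
    show "P (s + t) f = P s (P t f)" if "s \<ge> 0" "t \<ge> 0" "f \<in> polys S k" for s t f
      by (rule semigroup_add_time[OF sub[OF that(3)] that(1,2) sub[OF inv[OF k that(3,2)]]])
    show "((\<lambda>t. P t f x) \<longlongrightarrow> f x) (at_right 0)" if f: "f \<in> polys S k" for f x
    proof (cases "x \<in> states S")
      case True
      have "((\<lambda>t. P t f x) \<longlongrightarrow> P 0 f x) (at 0 within {0..})"
        using cont[OF sub[OF f] True] unfolding continuous_within .
      then show ?thesis
        unfolding semigroup_zero_time[OF sub[OF f]] by (rule tendsto_within_subset) auto
    next
      case False
      then show ?thesis using polys_outside[OF f False] by (simp add: semigroup_outside)
    qed
  qed
  show ?thesis by (rule semigroup_eq_exp_map[OF finite_multi_indices[where k = k] polys_spanned that])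
qed

end

section \<open>Equivalence of the polynomial property and the exponential form\<close>

lemma (in markov_process) semigroup_is_exp_if_m_polynomial:
  assumes "m_polynomial S p m"
  shows "semigroup_is_exp S p m"
proof -
  have mp: "\<And>f x t. f \<in> polys S m \<Longrightarrow> x \<in> states S \<Longrightarrow> t \<ge> 0 \<Longrightarrow> transition_semigroup_abs S p t f x < \<infinity>"
    "\<And>k f t. k \<le> m \<Longrightarrow> f \<in> polys S k \<Longrightarrow> t \<ge> 0 \<Longrightarrow> P t f \<in> polys S k"
    "\<And>f x. f \<in> polys S m \<Longrightarrow> x \<in> states S \<Longrightarrow> continuous (at 0 within {0..}) (\<lambda>t. P t f x)"
    using assms unfolding m_polynomial_def by blast+
  interpret markov_moments S p F Pr m by (rule markov_momentsI[OF mp(1)])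
  show ?thesis
    unfolding semigroup_is_exp_def
  proof (intro allI impI)
    fix k assume k: "k \<le> m"
    obtain A where A: "linear_map_on (polys S k) A" "\<And>t f. t \<ge> 0 \<Longrightarrow> f \<in> polys S k \<Longrightarrow> P t f = exp_map t A f"
      by (rule semigroup_is_exp_if_invariant[OF mp(2,3) k]) (assumption | rule that)+
    have "\<forall>x\<in>states S. transition_semigroup_abs S p t f x < \<infinity>" if "t \<ge> 0" "f \<in> polys S k" for t f
      using mp(1) that polys_mono[OF k] by blast
    then show "\<exists>A. linear_map_on (polys S k) A \<and> (\<forall>t\<ge>0. \<forall>f\<in>polys S k.
        (\<forall>x\<in>states S. transition_semigroup_abs S p t f x < \<infinity>) \<and> P t f = exp_map t A f)"
      using A by (intro exI[of _ A]) simp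
  qed
qed

lemma m_polynomial_if_semigroup_is_exp:
  assumes "semigroup_is_exp S p m"
  shows "m_polynomial S p m"
proof -
  have ex: "\<exists>A. linear_map_on (polys S k) A \<and> (\<forall>t\<ge>0. \<forall>f\<in>polys S k.
      (\<forall>x\<in>states S. transition_semigroup_abs S p t f x < \<infinity>) \<and> transition_semigroup S p t f = exp_map t A f)"
    if "k \<le> m" for k
    using assms that unfolding semigroup_is_exp_def by blast
  show ?thesis
    unfolding m_polynomial_def
  proof (intro conjI ballI allI impI)
    fix f x and t :: real assume "f \<in> polys S m" "x \<in> states S" "t \<ge> 0"
    then show "transition_semigroup_abs S p t f x < \<infinity>" using ex[OF order_refl] by blast
  next
    fix k f and t :: real assume k: "k \<le> m" and f: "f \<in> polys S k" and t: "t \<ge> 0"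
    obtain X e where "nodal_space (polys S k) X e" by (rule nodal_space_polys)
    then interpret nodal_space "polys S k" X e .
    obtain A where "linear_map_on (polys S k) A" "transition_semigroup S p t f = exp_map t A f"
      using ex[OF k] f t by blast
    then show "transition_semigroup S p t f \<in> polys S k" using exp_map_in[OF _ f] by simp
  next
    fix f x assume f: "f \<in> polys S m" and x: "x \<in> states S"
    obtain X e where "nodal_space (polys S m) X e" by (rule nodal_space_polys)
    then interpret nodal_space "polys S m" X e .
    obtain A where A: "linear_map_on (polys S m) A" "\<And>t. t \<ge> 0 \<Longrightarrow> transition_semigroup S p t f = exp_map t A f"
      using ex[OF order_refl] f by blast
    have "continuous (at 0 within {0..}) (\<lambda>t. exp_map t A f x)"
      by (rule continuous_at_imp_continuous_at_within[OF DERIV_isCont[OF exp_map_has_derivative[OF A(1) f]]])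
    then show "continuous (at 0 within {0..}) (\<lambda>t. transition_semigroup S p t f x)"
      by (rule continuous_transform_within[OF _ zero_less_one]) (simp_all add: A(2))
  qed
qed

section \<open>From the exponential to the martingales\<close>

lemma set_lebesgue_integral_continuous_on:
  fixes g :: "real \<Rightarrow> real"
  assumes "set_integrable lborel {0..T} g"
  shows "continuous_on {0..T} (\<lambda>t. LINT s:{0..t}|lborel. g s)"
proof -
  have "continuous_on {0..T} (\<lambda>t. integral {0..t} g)"
    by (rule indefinite_integral_continuous_1[OF set_borel_integral_eq_integral(1)[OF assms]])
  moreover have "integral {0..t} g = (LINT s:{0..t}|lborel. g s)" if "t \<in> {0..T}" for t
    by (rule set_borel_integral_eq_integral(2)[OF set_integrable_subset[OF assms], symmetric]) (use that in auto)
  ultimately show ?thesis by (rule continuous_on_eq)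
qed

lemma set_lebesgue_integral_right_continuous:
  fixes g :: "real \<Rightarrow> real"
  assumes "\<And>T. T \<ge> 0 \<Longrightarrow> set_integrable lborel {0..T} g" "t \<ge> 0"
  shows "continuous (at_right t) (\<lambda>t. LINT s:{0..t}|lborel. g s)"
proof -
  have "continuous_on {0..t+1} (\<lambda>t. LINT s:{0..t}|lborel. g s)"
    using assms by (intro set_lebesgue_integral_continuous_on) auto
  then have "continuous (at t within {0..t+1}) (\<lambda>t. LINT s:{0..t}|lborel. g s)"
    using assms(2) by (simp add: continuous_on_eq_continuous_within)
  then have "continuous (at t within {t..t+1}) (\<lambda>t. LINT s:{0..t}|lborel. g s)"
    by (rule continuous_within_subset) (use assms(2) in auto)
  then show ?thesis by (simp add: at_within_Icc_at_right)
qed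

text \<open>Only degree \<open>m\<close> is recorded. The maps of lower degree are compared with
  this \<open>A\<close> later, when the generator has to preserve each
  \<open>polys S k\<close>.\<close>

locale exponential_semigroup = markov_moments S p F Pr m
  for S :: "(real ^ 'n::finite) set" and p :: "real \<Rightarrow> 'n state \<Rightarrow> 'n state measure"
    and F :: "real \<Rightarrow> 'n path measure" and Pr :: "'n state \<Rightarrow> 'n path measure" and m :: nat +
  fixes A :: "('n state \<Rightarrow> real) \<Rightarrow> 'n state \<Rightarrow> real"
  assumes linear_A: "linear_map_on (polys S m) A"
    and semigroup_exp: "\<And>t f. t \<ge> 0 \<Longrightarrow> f \<in> polys S m \<Longrightarrow> P t f = exp_map t A f"
begin

lemma semigroup_in:
  assumes "t \<ge> 0" "f \<in> polys S m"
  shows "P t f \<in> polys S m"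
proof -
  obtain X e where "nodal_space (polys S m) X e" by (rule nodal_space_polys)
  then interpret nodal_space "polys S m" X e .
  show ?thesis unfolding semigroup_exp[OF assms] by (rule exp_map_in[OF linear_A assms(2)])
qed

text \<open>By the Markov property \<open>P t f\<close> at time \<open>s\<close> is a conditional
  expectation, which does not increase the mean absolute value. Moments at an earlier time are thus
  bounded by moments at a later one.\<close>

lemma semigroup_contraction:
  assumes x: "x \<in> states S" and f: "f \<in> polys S m" and st: "s \<ge> 0" "t \<ge> 0"
  shows "(\<integral>w. \<bar>P t f (w s)\<bar> \<partial>Pr x) \<le> (\<integral>w. \<bar>f (w (t + s))\<bar> \<partial>Pr x)"
proof -
  interpret sigma_finite_subalgebra "Pr x" "F s" by (rule sigma_finite_subalgebra_F[OF x st(1)])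
  note [measurable] = polys_coordinate_measurable[OF x st(1) semigroup_in[OF st(2) f]]
  have ts: "t + s \<ge> 0" using st by simp
  have "(\<integral>w. \<bar>P t f (w s)\<bar> \<partial>Pr x) = (\<integral>w. \<bar>real_cond_exp (Pr x) (F s) (\<lambda>w. f (w (t + s))) w\<bar> \<partial>Pr x)"
    by (rule integral_cong_AE) (use cond_exp_semigroup[OF f x st] in auto)
  then show ?thesis using real_cond_exp_L1_contraction[OF moments[OF f x ts]] by simp
qed

text \<open>For small \<open>h\<close> the operator \<open>P\<^sub>h\<close> is close to the identity, so that moments at time \<open>s\<close> are
  controlled by moments at time \<open>s + h\<close>.\<close>

lemma moment_bounded:
  assumes x: "x \<in> states S" and f: "f \<in> polys S m" and T: "T \<ge> 0"
  obtains C where "\<And>s. s \<in> {0..T} \<Longrightarrow> (\<integral>w. \<bar>f (w s)\<bar> \<partial>Pr x) \<le> C"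
proof -
  obtain X e where "nodal_space (polys S m) X e" by (rule nodal_space_polys)
  then interpret nodal_space "polys S m" X e .
  \<comment> \<open>Entrywise distance from \<open>P h\<close> to the identity at the nodes. Once it
    is below 1/2, half of the sum of the \<open>\<bar>e u z\<bar>\<close> can be absorbed, which
    leaves the factor 2 in \<open>small\<close>.\<close>
  define D where "D = (\<lambda>h. \<Sum>u\<in>X. \<Sum>y\<in>X. \<bar>e y u - P h (e y) u\<bar>)"
  have "((\<lambda>h. exp_map h A (e y) u) \<longlongrightarrow> exp_map 0 A (e y) u) (at 0)" if "y \<in> X" for y u
    using DERIV_isCont[OF exp_map_has_derivative[OF linear_A basis_in[OF that]]] unfolding isCont_def .
  then have e_lim: "((\<lambda>h. exp_map h A (e y) u) \<longlongrightarrow> e y u) (at_right 0)" if "y \<in> X" for y u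
    unfolding exp_map_zero by (rule tendsto_within_subset[OF _ subset_UNIV]) (use that in simp)
  have "((\<lambda>h. P h (e y) u) \<longlongrightarrow> e y u) (at_right 0)" if "y \<in> X" for y u
  proof (rule Lim_transform_eventually[OF e_lim[OF that]])
    show "\<forall>\<^sub>F h in at_right 0. exp_map h A (e y) u = P h (e y) u"
      using eventually_at_right_less[of 0] by eventually_elim (simp add: semigroup_exp basis_in that)
  qed
  then have "(D \<longlongrightarrow> (\<Sum>u\<in>X. \<Sum>y\<in>X. \<bar>e y u - e y u\<bar>)) (at_right 0)"
    unfolding D_def by (intro tendsto_intros)
  then have "(D \<longlongrightarrow> 0) (at_right 0)" by simp
  then have "\<forall>\<^sub>F h in at_right 0. D h < 1 / 2" by (rule order_tendstoD) simp
  then obtain \<delta> where \<delta>: "\<delta> > 0" "\<And>h. 0 < h \<Longrightarrow> h < \<delta> \<Longrightarrow> D h < 1 / 2"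
    unfolding eventually_at_right_field by auto
  have small: "(\<Sum>y\<in>X. \<bar>e y z\<bar>) \<le> 2 * (\<Sum>y\<in>X. \<bar>P h (e y) z\<bar>)" if h: "0 < h" "h < \<delta>" for h z
  proof -
    have diff: "(\<lambda>z. e y z - P h (e y) z) \<in> polys S m" if "y \<in> X" for y
      using semigroup_in[OF _ basis_in[OF that], of h] h
      by (intro function_subspace_diff[OF subspace] basis_in that) auto
    have "(\<Sum>y\<in>X. \<bar>e y z - P h (e y) z\<bar>) \<le> (\<Sum>y\<in>X. (\<Sum>u\<in>X. \<bar>e y u - P h (e y) u\<bar>) * (\<Sum>u\<in>X. \<bar>e u z\<bar>))"
      by (intro sum_mono linear_bound[OF linear_map_on_id diff])
    also have "\<dots> = D h * (\<Sum>u\<in>X. \<bar>e u z\<bar>)"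
      unfolding D_def sum_distrib_right[symmetric] by (subst sum.swap) (rule refl)
    also have "\<dots> \<le> 1 / 2 * (\<Sum>u\<in>X. \<bar>e u z\<bar>)"
      using \<delta>(2)[OF h] by (intro mult_right_mono sum_nonneg) auto
    finally have "(\<Sum>y\<in>X. \<bar>e y z - P h (e y) z\<bar>) \<le> 1 / 2 * (\<Sum>u\<in>X. \<bar>e u z\<bar>)" .
    moreover have "(\<Sum>y\<in>X. \<bar>e y z\<bar>) \<le> (\<Sum>y\<in>X. \<bar>e y z - P h (e y) z\<bar> + \<bar>P h (e y) z\<bar>)"
      by (intro sum_mono) linarith
    ultimately show ?thesis by (simp add: sum.distrib)
  qed
  \<comment> \<open>All basis functions are summed because \<open>small\<close> compares the whole
    basis with the whole family \<open>P h (e y)\<close>; the inequality does not close for a single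
    function.\<close>
  define B where "B = (\<lambda>s. \<Sum>y\<in>X. \<integral>w. \<bar>e y (w s)\<bar> \<partial>Pr x)"
  have step: "B s \<le> 2 * B (s + h)" if s: "s \<ge> 0" and h: "0 < h" "h < \<delta>" for s h
  proof -
    have int: "integrable (Pr x) (\<lambda>w. \<bar>e y (w s)\<bar>)" "integrable (Pr x) (\<lambda>w. \<bar>P h (e y) (w s)\<bar>)" if "y \<in> X" for y
      using moments[OF basis_in[OF that] x s] moments[OF semigroup_in[OF _ basis_in[OF that]] x s, of h] h by auto
    have "B s = (\<integral>w. (\<Sum>y\<in>X. \<bar>e y (w s)\<bar>) \<partial>Pr x)"
      unfolding B_def by (rule Bochner_Integration.integral_sum[symmetric]) (rule int)
    also have "\<dots> \<le> (\<integral>w. 2 * (\<Sum>y\<in>X. \<bar>P h (e y) (w s)\<bar>) \<partial>Pr x)"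
      using int by (intro integral_mono small[OF h] Bochner_Integration.integrable_sum integrable_mult_right) auto
    also have "\<dots> = 2 * (\<Sum>y\<in>X. \<integral>w. \<bar>P h (e y) (w s)\<bar> \<partial>Pr x)"
      using int by (simp add: Bochner_Integration.integral_sum)
    also have "\<dots> \<le> 2 * B (s + h)"
      unfolding B_def using semigroup_contraction[OF x basis_in s, of _ h] h
      by (intro mult_left_mono sum_mono) (auto simp: add.commute)
    finally show ?thesis .
  qed
  have iterate: "B s \<le> 2 ^ n * B (s + n * h)" if s: "s \<ge> 0" and h: "0 < h" "h < \<delta>" for s h :: real and n :: nat
  proof (induction n)
    case (Suc n)
    have "B (s + n * h) \<le> 2 * B (s + n * h + h)" using s h by (intro step) auto
    then have "2 ^ n * B (s + n * h) \<le> 2 ^ n * (2 * B (s + n * h + h))" by (intro mult_left_mono) auto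
    from order_trans[OF Suc this] show ?case by (simp add: algebra_simps)
  qed simp
  \<comment> \<open>One \<open>n\<close> serves all \<open>s\<close>: steps of length
    \<open>(T - s) / n\<close> stay below \<open>\<delta>\<close>, so \<open>2 ^ n\<close> is
    uniform in \<open>s\<close>.\<close>
  obtain n where n: "T < real n * \<delta>" using reals_Archimedean3[OF \<delta>(1)] by blast
  have npos: "n > 0" using n T by (cases n) auto
  have B0: "B T \<ge> 0" unfolding B_def by (intro sum_nonneg) simp
  have B_bound: "B s \<le> 2 ^ n * B T" if s: "s \<in> {0..T}" for s
  proof (cases "s = T")
    case True
    have "1 * B T \<le> 2 ^ n * B T" using B0 by (intro mult_right_mono) auto
    then show ?thesis using True by simp
  next
    case False
    have "(T - s) / n < \<delta>" using n s npos by (simp add: divide_less_eq mult.commute)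
    moreover have "(T - s) / n > 0" using False s npos by simp
    ultimately show ?thesis using iterate[of s "(T - s) / n" n] s npos by simp
  qed
  have f_bound: "(\<integral>w. \<bar>f (w s)\<bar> \<partial>Pr x) \<le> (\<Sum>y\<in>X. \<bar>f y\<bar>) * B s" if "s \<ge> 0" for s
  proof -
    have int: "integrable (Pr x) (\<lambda>w. \<bar>e y (w s)\<bar>)" if "y \<in> X" for y
      using moments[OF basis_in[OF that] x \<open>s \<ge> 0\<close>] by auto
    have "(\<integral>w. \<bar>f (w s)\<bar> \<partial>Pr x) \<le> (\<integral>w. (\<Sum>y\<in>X. \<bar>f y\<bar>) * (\<Sum>y\<in>X. \<bar>e y (w s)\<bar>) \<partial>Pr x)"
      using int moments[OF f x that]
      by (intro integral_mono linear_bound[OF linear_map_on_id f] integrable_mult_right Bochner_Integration.integrable_sum) auto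
    also have "\<dots> = (\<Sum>y\<in>X. \<bar>f y\<bar>) * B s"
      unfolding B_def using int by (simp add: Bochner_Integration.integral_sum)
    finally show ?thesis .
  qed
  have "(\<integral>w. \<bar>f (w s)\<bar> \<partial>Pr x) \<le> (\<Sum>y\<in>X. \<bar>f y\<bar>) * (2 ^ n * B T)" if s: "s \<in> {0..T}" for s
  proof -
    have "(\<Sum>y\<in>X. \<bar>f y\<bar>) * B s \<le> (\<Sum>y\<in>X. \<bar>f y\<bar>) * (2 ^ n * B T)"
      by (rule mult_left_mono[OF B_bound[OF s]]) (simp add: sum_nonneg)
    with f_bound[of s] s show ?thesis by simp
  qed
  then show ?thesis by (rule that)
qed

lemma occupation_integrable_exp:
  assumes x: "x \<in> states S" and T: "T \<ge> 0" and f: "f \<in> polys S m"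
  shows "integrable (Pr x \<Otimes>\<^sub>M lborel) (\<lambda>(w, s). indicator {0..T} s * f (w s))"
proof (rule occupation_integrable[OF x T f])
  obtain C where C: "\<And>s. s \<in> {0..T} \<Longrightarrow> (\<integral>w. \<bar>f (w s)\<bar> \<partial>Pr x) \<le> C" by (rule moment_bounded[OF x f T]) (rule that)
  have "(\<integral>\<^sup>+ w. ennreal \<bar>indicator {0..T} s * f (w s)\<bar> \<partial>Pr x) \<le> ennreal C * indicator {0..T} s" for s
  proof (cases "s \<in> {0..T}")
    case True
    then have "(\<integral>\<^sup>+ w. ennreal \<bar>f (w s)\<bar> \<partial>Pr x) = ennreal (\<integral>w. \<bar>f (w s)\<bar> \<partial>Pr x)"
      using moments[OF f x, of s] by (intro nn_integral_eq_integral) auto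
    then show ?thesis using True C[OF True] by (simp add: ennreal_leI)
  qed simp
  then have "(\<integral>\<^sup>+ s. \<integral>\<^sup>+ w. ennreal \<bar>indicator {0..T} s * f (w s)\<bar> \<partial>Pr x \<partial>lborel) \<le> (\<integral>\<^sup>+ s. ennreal C * indicator {0..T} s \<partial>lborel)"
    by (intro nn_integral_mono)
  also have "\<dots> = ennreal C * ennreal T"
    using T by (subst nn_integral_cmult_indicator) auto
  also have "\<dots> < \<infinity>" by (simp add: ennreal_mult_less_top)
  finally show "(\<integral>\<^sup>+ s. \<integral>\<^sup>+ w. ennreal \<bar>indicator {0..T} s * f (w s)\<bar> \<partial>Pr x \<partial>lborel) < \<infinity>" .
qed

lemma A_in: "f \<in> polys S m \<Longrightarrow> A f \<in> polys S m"
  by (rule linear_mapD(1)[OF linear_A])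

text \<open>Conditioning on \<open>F s\<close> puts the dependence on \<open>u\<close> into the
  scalars \<open>exp_map (u - s) A f y\<close> and that on \<open>B\<close> into the constants
  \<open>c y\<close>. Differentiating the scalars replaces \<open>f\<close> by \<open>A f\<close>,
  and the fundamental theorem of calculus applies.\<close>

lemma moment_on_set_increment:
  assumes x: "x \<in> states S" and f: "f \<in> polys S m" and st: "0 \<le> s" "s \<le> t" and B: "B \<in> sets (F s)"
  shows "((\<lambda>u. LINT w:B|Pr x. A f (w u)) has_integral
    (LINT w:B|Pr x. f (w t)) - (LINT w:B|Pr x. f (w s))) {s..t}"
proof -
  interpret Pr: prob_space "Pr x" by (rule prob_space_Pr[OF x])
  interpret sigma_finite_subalgebra "Pr x" "F s" by (rule sigma_finite_subalgebra_F[OF x st(1)])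
  obtain X e where "nodal_space (polys S m) X e" by (rule nodal_space_polys)
  then interpret nodal_space "polys S m" X e .
  have B': "B \<in> sets (Pr x)" using B subalg by (auto simp: subalgebra_def)
  define c where "c = (\<lambda>y. LINT w:B|Pr x. e y (w s))"
  have eq: "(LINT w:B|Pr x. h (w u)) = (\<Sum>y\<in>X. exp_map (u - s) A h y * c y)"
    if h: "h \<in> polys S m" and u: "u \<in> {s..t}" for h u
  proof -
    have us: "u - s \<ge> 0" "u \<ge> 0" using u st by auto
    have Ph: "P (u - s) h \<in> polys S m" by (rule semigroup_in[OF us(1) h])
    have "(LINT w:B|Pr x. h (w u)) = (LINT w:B|Pr x. real_cond_exp (Pr x) (F s) (\<lambda>w. h (w u)) w)"
      by (rule real_cond_exp_intA[OF moments[OF h x us(2)] B])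
    also have "\<dots> = (LINT w:B|Pr x. P (u - s) h (w s))"
      unfolding set_lebesgue_integral_def
      using cond_exp_semigroup[OF h x st(1) us(1)] B' polys_coordinate_measurable[OF x st(1) Ph]
      by (intro integral_cong_AE) auto
    also have "\<dots> = (LINT w:B|Pr x. \<Sum>y\<in>X. P (u - s) h y * e y (w s))"
      by (rule arg_cong[where f = "\<lambda>g. LINT w:B|Pr x. g w"], rule ext, rule expansion[OF Ph])
    also have "\<dots> = (\<integral>w. (\<Sum>y\<in>X. P (u - s) h y * (indicator B w * e y (w s))) \<partial>Pr x)"
      unfolding set_lebesgue_integral_def by (simp add: sum_distrib_left mult.left_commute)
    also have "\<dots> = (\<Sum>y\<in>X. \<integral>w. P (u - s) h y * (indicator B w * e y (w s)) \<partial>Pr x)"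
      using integrable_mult_indicator[OF B' moments[OF basis_in x st(1)]]
      by (intro Bochner_Integration.integral_sum integrable_mult_right) simp
    also have "\<dots> = (\<Sum>y\<in>X. exp_map (u - s) A h y * c y)"
      unfolding semigroup_exp[OF us(1) h] c_def set_lebesgue_integral_def by simp
    finally show ?thesis .
  qed
  have "((\<lambda>u. LINT w:B|Pr x. f (w u)) has_real_derivative (LINT w:B|Pr x. A f (w u))) (at u within {s..t})"
    if u: "u \<in> {s..t}" for u
  proof -
    have "((\<lambda>u. exp_map (u + - s) A f y) has_field_derivative exp_map (u + - s) A (A f) y) (at u within {s..t})" for y
      by (rule has_field_derivative_at_within[OF DERIV_shift[THEN iffD1, OF exp_map_has_derivative[OF linear_A f]]])
    then have "((\<lambda>u. \<Sum>y\<in>X. exp_map (u - s) A f y * c y) has_real_derivative (\<Sum>y\<in>X. exp_map (u - s) A (A f) y * c y)) (at u within {s..t})"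
      by (intro DERIV_sum DERIV_cmult_right) simp
    then have "((\<lambda>u. LINT w:B|Pr x. f (w u)) has_real_derivative (\<Sum>y\<in>X. exp_map (u - s) A (A f) y * c y)) (at u within {s..t})"
      by (rule has_field_derivative_transform_within[OF _ zero_less_one u]) (rule eq[OF f, symmetric])
    then show ?thesis unfolding eq[OF A_in[OF f] u] .
  qed
  then show ?thesis
    by (intro fundamental_theorem_of_calculus[OF st(2)]) (simp add: has_real_derivative_iff_has_vector_derivative)
qed

text \<open>Integrate over \<open>B\<close> known at time \<open>s\<close>. Fubini moves the time
  integral outside, and the contribution of \<open>{s..t}\<close> cancels the increment of
  \<open>f\<close> by \<open>moment_on_set_increment\<close>.\<close>

lemma martingale_gen_process:
  assumes x: "x \<in> states S" and f: "f \<in> polys S m"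
  shows "martingale (Pr x) F (gen_process f (A f) x)"
  unfolding martingale_def
proof (intro conjI allI impI)
  interpret Pr: prob_space "Pr x" by (rule prob_space_Pr[OF x])
  fix t :: real assume t: "t \<ge> 0"
  show "gen_process f (A f) x t \<in> borel_measurable (F t)"
    by (rule gen_process_measurable[OF t f A_in[OF f]])
next
  interpret Pr: prob_space "Pr x" by (rule prob_space_Pr[OF x])
  have int: "integrable (Pr x) (gen_process f (A f) x t)" if "t \<ge> 0" for t
    unfolding gen_process_def
    using moments[OF f x that] occupation_fubini(2)[OF x that A_in[OF f] occupation_integrable_exp[OF x that A_in[OF f]] sets.top]
    by simp
  fix t :: real assume "t \<ge> 0"
  then show "integrable (Pr x) (gen_process f (A f) x t)" by (rule int)
next
  interpret Pr: prob_space "Pr x" by (rule prob_space_Pr[OF x])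
  have int: "integrable (Pr x) (gen_process f (A f) x t)" if "t \<ge> 0" for t
    unfolding gen_process_def
    using moments[OF f x that] occupation_fubini(2)[OF x that A_in[OF f] occupation_integrable_exp[OF x that A_in[OF f]] sets.top]
    by simp
  fix s t :: real assume s: "s \<ge> 0" and st: "s \<le> t"
  then have t: "t \<ge> 0" by simp
  interpret sigma_finite_subalgebra "Pr x" "F s" by (rule sigma_finite_subalgebra_F[OF x s])
  show "AE w in Pr x. real_cond_exp (Pr x) (F s) (gen_process f (A f) x t) w = gen_process f (A f) x s w"
  proof (rule real_cond_exp_charact[OF _ int[OF t] int[OF s] gen_process_measurable[OF s f A_in[OF f]]])
    fix B assume B: "B \<in> sets (F s)"
    then have B': "B \<in> sets (Pr x)" using subalg by (auto simp: subalgebra_def)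
    define \<psi> where "\<psi> = (\<lambda>u. LINT w:B|Pr x. A f (w u))"
    note fub = occupation_fubini[OF x _ A_in[OF f] occupation_integrable_exp[OF x _ A_in[OF f]] B']
    have M: "(LINT w:B|Pr x. gen_process f (A f) x u w)
        = (LINT w:B|Pr x. f (w u)) - f x * measure (Pr x) B - integral {0..u} \<psi>" if u: "u \<ge> 0" for u
    proof -
      have i: "integrable (Pr x) (\<lambda>w. indicator B w * f (w u))"
        "integrable (Pr x) (\<lambda>w. indicator B w * (LINT s:{0..u}|lborel. A f (w s)))"
        "integrable (Pr x) (\<lambda>w. indicator B w * f x)"
        using integrable_mult_indicator[OF B' moments[OF f x u]] integrable_mult_indicator[OF B' fub(2)[OF u u]]
          integrable_mult_indicator[OF B' Pr.integrable_const[of "f x"]]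
        by (simp_all only: real_scaleR_def)
      have "(LINT w:B|Pr x. gen_process f (A f) x u w)
        = (\<integral>w. indicator B w * f (w u) - indicator B w * f x - indicator B w * (LINT s:{0..u}|lborel. A f (w s)) \<partial>Pr x)"
        unfolding set_lebesgue_integral_def[of "Pr x"] gen_process_def by (simp add: right_diff_distrib)
      also have "\<dots> = (LINT w:B|Pr x. f (w u)) - f x * measure (Pr x) B - (LINT w:B|Pr x. LINT s:{0..u}|lborel. A f (w s))"
        unfolding set_lebesgue_integral_def[of "Pr x"] using i B' sets.sets_into_space[OF B']
        by (simp add: Int_absorb2)
      also have "(LINT w:B|Pr x. LINT s:{0..u}|lborel. A f (w s)) = integral {0..u} \<psi>"
        unfolding fub(4)[OF u u] \<psi>_def by (rule set_borel_integral_eq_integral(2)[OF fub(3)[OF u u]])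
      finally show ?thesis .
    qed
    have "\<psi> integrable_on {0..t}"
      unfolding \<psi>_def by (rule set_borel_integral_eq_integral(1)[OF fub(3)[OF t t]])
    from Henstock_Kurzweil_Integration.integral_combine[OF s st this]
    have "integral {0..t} \<psi> = integral {0..s} \<psi> + integral {s..t} \<psi>" by simp
    also have "integral {s..t} \<psi> = (LINT w:B|Pr x. f (w t)) - (LINT w:B|Pr x. f (w s))"
      unfolding \<psi>_def by (rule integral_unique[OF moment_on_set_increment[OF x f s st B]])
    finally show "(LINT w:B|Pr x. gen_process f (A f) x t w) = (LINT w:B|Pr x. gen_process f (A f) x s w)"
      unfolding M[OF s] M[OF t] by simp
  qed
qed

text \<open>A true martingale is local with stopping times that are constantly infinite. The rest is
  pathwise: integrability at all times comes from countably many integer horizons, right continuity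
  from the paths.\<close>

lemma generator_rel_A:
  assumes f: "f \<in> polys S m"
  shows "generator_rel S F Pr f (A f)"
  unfolding generator_rel_def
proof (intro conjI ballI)
  show "f \<in> borel_measurable (state_algebra S)" "A f \<in> borel_measurable (state_algebra S)"
    by (rule polys_measurable[OF f], rule polys_measurable[OF A_in[OF f]])
  fix x assume x: "x \<in> states S"
  have "AE w in Pr x. set_integrable lborel {0..real n} (\<lambda>s. A f (w s))" for n
    by (rule occupation_fubini(1)[OF x _ A_in[OF f] occupation_integrable_exp[OF x _ A_in[OF f]] sets.top]) auto
  then have "AE w in Pr x. \<forall>n. set_integrable lborel {0..real n} (\<lambda>s. A f (w s))"
    unfolding AE_all_countable by simp
  then show int: "AE w in Pr x. \<forall>t\<ge>0. set_integrable lborel {0..t} (\<lambda>s. A f (w s))"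
  proof eventually_elim
    case (elim w)
    show ?case
    proof (intro allI impI)
      fix t :: real
      obtain n where "t \<le> real n" using real_arch_simple by blast
      then show "set_integrable lborel {0..t} (\<lambda>s. A f (w s))"
        by (intro set_integrable_subset[OF spec[OF elim, of n]]) auto
    qed
  qed
  show "local_martingale (Pr x) F (gen_process f (A f) x)"
    unfolding local_martingale_def
  proof (intro conjI exI[of _ "\<lambda>n w. \<infinity>"] allI impI)
    show "gen_process f (A f) x t \<in> borel_measurable (F t)" if "t \<ge> 0" for t
      by (rule gen_process_measurable[OF that f A_in[OF f]])
    have "AE w in Pr x. w \<in> paths S" using space_Pr[OF x] by (intro AE_I2) simp
    with int show "AE w in Pr x. \<forall>t\<ge>0. continuous (at_right t) (\<lambda>s. gen_process f (A f) x s w)"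
    proof eventually_elim
      case (elim w)
      have "continuous (at_right t) (\<lambda>s. f (w s))" if "t \<ge> 0" for t
        by (rule continuous_within_subset[OF polys_right_continuous[OF elim(2) f that]]) auto
      then show ?case
        unfolding gen_process_def using set_lebesgue_integral_right_continuous[of "\<lambda>s. A f (w s)"] elim(1)
        by (auto intro!: continuous_intros)
    qed
    show "martingale (Pr x) F (\<lambda>t w. gen_process f (A f) x (enn2real (min (ennreal t) \<infinity>)) w)"
    proof -
      have "gen_process f (A f) x (enn2real (min (ennreal t) \<infinity>)) = gen_process f (A f) x t" if "t \<ge> 0" for t
        using that by simp
      then show ?thesis using martingale_gen_process[OF x f] unfolding martingale_def by auto
    qed
  qed auto
qed

end

lemma (in markov_process) martingale_generator_condition_if_semigroup_is_exp:
  assumes "semigroup_is_exp S p m"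
  shows "martingale_generator_condition S p F Pr m"
proof -
  have ex: "\<exists>A. linear_map_on (polys S k) A \<and> (\<forall>t\<ge>0. \<forall>f\<in>polys S k.
      (\<forall>x\<in>states S. transition_semigroup_abs S p t f x < \<infinity>) \<and> P t f = exp_map t A f)"
    if "k \<le> m" for k
    using assms that unfolding semigroup_is_exp_def by blast
  obtain A where A: "linear_map_on (polys S m) A"
    "\<And>t f x. t \<ge> 0 \<Longrightarrow> f \<in> polys S m \<Longrightarrow> x \<in> states S \<Longrightarrow> transition_semigroup_abs S p t f x < \<infinity>"
    "\<And>t f. t \<ge> 0 \<Longrightarrow> f \<in> polys S m \<Longrightarrow> P t f = exp_map t A f"
    using ex[OF order_refl] by blast
  interpret markov_moments S p F Pr m by (rule markov_momentsI) (rule A(2))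
  interpret exponential_semigroup S p F Pr m A by unfold_locales (rule A(1), rule A(3))
  \<comment> \<open>The map \<open>A'\<close> of degree \<open>k\<close> yields the same
    \<open>P t f\<close> as \<open>A\<close>, so \<open>A f\<close> and \<open>A' f\<close> are both
    the derivative of \<open>P t f\<close> at time 0.\<close>
  have A_polys: "A f \<in> polys S k" if k: "k \<le> m" and f: "f \<in> polys S k" for f k
  proof -
    have fm: "f \<in> polys S m" using polys_mono[OF k] f by blast
    obtain X e where "nodal_space (polys S m) X e" by (rule nodal_space_polys)
    then interpret M: nodal_space "polys S m" X e .
    obtain Y d where "nodal_space (polys S k) Y d" by (rule nodal_space_polys)
    then interpret K: nodal_space "polys S k" Y d .
    obtain A' where A': "linear_map_on (polys S k) A'" "\<And>t. t \<ge> 0 \<Longrightarrow> P t f = exp_map t A' f"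
      using ex[OF k] f by blast
    have "A f x = A' f x" for x
    proof -
      have "((\<lambda>t. exp_map t A f x) has_real_derivative A f x) (at 0 within {0..})"
        using has_field_derivative_at_within[OF M.exp_map_has_derivative[OF A(1) fm, of x 0]]
        unfolding M.exp_map_zero .
      then have "((\<lambda>t. exp_map t A' f x) has_real_derivative A f x) (at 0 within {0..})"
        by (rule has_derivative_transform_atLeast) (use A'(2) A(3)[OF _ fm] in auto)
      moreover have "((\<lambda>t. exp_map t A' f x) has_real_derivative A' f x) (at 0 within {0..})"
        using has_field_derivative_at_within[OF K.exp_map_has_derivative[OF A'(1) f, of x 0]]
        unfolding K.exp_map_zero .
      moreover have "at (0::real) within {0..} \<noteq> bot" using at_within_Ici_at_right[of "0::real"] by simp
      ultimately show ?thesis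
        unfolding has_field_derivative_iff by (intro tendsto_unique)
    qed
    then have "A f = A' f" by (rule ext)
    then show ?thesis using linear_mapD(1)[OF A'(1) f] by simp
  qed
  \<comment> \<open>A version of the extended generator must answer on its whole domain, so outside
    the polynomials some admissible function is chosen.\<close>
  define G where "G = (\<lambda>f. if f \<in> polys S m then A f else SOME g. generator_rel S F Pr f g)"
  have G: "G f = A f" if "f \<in> polys S m" for f using that by (simp add: G_def)
  have "extended_generator S F Pr G"
    unfolding extended_generator_def
  proof
    fix f assume "f \<in> generator_domain S F Pr"
    then have "\<exists>g. generator_rel S F Pr f g" by (simp add: generator_domain_def)
    from someI_ex[OF this] show "generator_rel S F Pr f (G f)"
      using generator_rel_A by (simp add: G_def)
  qed
  moreover have "polys S m \<subseteq> generator_domain S F Pr"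
    unfolding generator_domain_def using generator_rel_A by blast
  moreover have "\<forall>f\<in>polys S m. \<forall>x\<in>states S. martingale (Pr x) F (gen_process f (G f) x)"
    using martingale_gen_process G by simp
  moreover have "\<forall>k\<le>m. G ` polys S k \<subseteq> polys S k"
  proof (intro allI impI image_subsetI)
    fix k f assume "k \<le> m" "f \<in> polys S k"
    then show "G f \<in> polys S k" using A_polys G[of f] polys_mono[of k m S] by auto
  qed
  ultimately show ?thesis
    unfolding martingale_generator_condition_def
    by (intro conjI exI[of _ G] ballI allI impI semigroup_abs_eq A(2)) auto
qed

section \<open>From the martingales to the exponential\<close>

lemma integrable_indicator_Icc: "integrable lborel (indicator {a..b} :: real \<Rightarrow> real)"
  by (rule integrable_real_indicator) (auto simp: emeasure_lborel_Icc_eq)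

text \<open>The right-hand side of \<open>le\<close>, multiplied by
  \<open>exp (- \<alpha> * t)\<close>, is nonincreasing: the sign of its derivative is that of
  \<open>\<zeta>\<close> minus this right-hand side.\<close>

lemma gronwall_continuous:
  fixes \<zeta> :: "real \<Rightarrow> real"
  assumes cont: "continuous_on {0..T} \<zeta>" and \<alpha>: "\<alpha> \<ge> 0" and t: "t \<in> {0..T}"
    and le: "\<And>t. t \<in> {0..T} \<Longrightarrow> \<zeta> t \<le> C + \<alpha> * integral {0..t} \<zeta>"
  shows "\<zeta> t \<le> C * exp (\<alpha> * t)"
proof -
  define q where "q = (\<lambda>t. exp (- \<alpha> * t) * (C + \<alpha> * integral {0..t} \<zeta>))"
  have der: "(q has_real_derivative exp (- \<alpha> * u) * (\<alpha> * (\<zeta> u - (C + \<alpha> * integral {0..u} \<zeta>)))) (at u within {0..T})"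
    if "u \<in> {0..T}" for u
    unfolding q_def
    by (rule derivative_eq_intros integral_has_real_derivative[OF cont that] refl)+ (simp add: algebra_simps)
  have "q t \<le> q 0"
  proof (cases "t = 0")
    case False
    show ?thesis
    proof (rule DERIV_nonpos_imp_decreasing_open[where f = q and a = 0 and b = t])
      show "0 \<le> t" using t by simp
      show "\<exists>y. (q has_real_derivative y) (at u) \<and> y \<le> 0" if "0 < u" "u < t" for u
      proof (intro exI conjI)
        have u: "u \<in> {0..T}" "u \<in> interior {0..T}" using that t by auto
        show "(q has_real_derivative exp (- \<alpha> * u) * (\<alpha> * (\<zeta> u - (C + \<alpha> * integral {0..u} \<zeta>)))) (at u)"
          using der[OF u(1)] unfolding at_within_interior[OF u(2)] .
        show "exp (- \<alpha> * u) * (\<alpha> * (\<zeta> u - (C + \<alpha> * integral {0..u} \<zeta>))) \<le> 0"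
          using le[OF u(1)] \<alpha> by (intro mult_nonneg_nonpos) auto
      qed
      have "continuous_on {0..T} q" by (rule DERIV_continuous_on[OF der])
      then show "continuous_on {0..t} q" by (rule continuous_on_subset) (use t in auto)
    qed
  qed simp
  then have le_C: "exp (\<alpha> * t) * q t \<le> exp (\<alpha> * t) * C" by (simp add: q_def)
  have "exp (\<alpha> * t) * q t = C + \<alpha> * integral {0..t} \<zeta>"
    by (simp add: q_def mult.assoc[symmetric] exp_add[symmetric])
  with le_C le[OF t] show ?thesis by (metis mult.commute order_trans)
qed

lemma set_integral_sum:
  fixes f :: "'i \<Rightarrow> 'a \<Rightarrow> real"
  assumes "\<And>i. i \<in> I \<Longrightarrow> set_integrable M A (f i)"
  shows "set_integrable M A (\<lambda>x. \<Sum>i\<in>I. f i x)"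
    and "(LINT x:A|M. \<Sum>i\<in>I. f i x) = (\<Sum>i\<in>I. LINT x:A|M. f i x)"
  using assms unfolding set_integrable_def set_lebesgue_integral_def scaleR_sum_right
  by (auto intro!: Bochner_Integration.integrable_sum Bochner_Integration.integral_sum)

text \<open>Here \<open>r\<close> stands for node values along a path, \<open>D\<close> for their
  drifts and \<open>M\<close> for the noise. Gronwall is applied to the accumulated drifts
  \<open>\<zeta>\<close>, which are continuous while \<open>r\<close> and \<open>M\<close> may jump.
  The bound is linear in \<open>h\<close>, so only first absolute moments of the noise will
  enter.\<close>

lemma pathwise_gronwall:
  fixes r M D :: "'a \<Rightarrow> real \<Rightarrow> real" and a :: "'a \<Rightarrow> 'a \<Rightarrow> real"
  assumes X: "finite X" and T: "T \<ge> 0"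
    and r: "\<And>y s. y \<in> X \<Longrightarrow> s \<in> {0..T} \<Longrightarrow> r y s = c y + M y s + (LINT u:{0..s}|lborel. D y u)"
    and D: "\<And>y s. y \<in> X \<Longrightarrow> s \<in> {0..T} \<Longrightarrow> D y s = (\<Sum>u\<in>X. a y u * r u s)"
    and int_M: "\<And>y. y \<in> X \<Longrightarrow> set_integrable lborel {0..T} (M y)"
    and int_D: "\<And>y. y \<in> X \<Longrightarrow> set_integrable lborel {0..T} (D y)"
    and s: "s \<in> {0..T}"
  defines "h \<equiv> \<lambda>s. \<Sum>y\<in>X. \<bar>c y\<bar> + \<bar>M y s\<bar>"
    and "\<alpha> \<equiv> \<Sum>y\<in>X. \<Sum>u\<in>X. \<bar>a y u\<bar>"
  shows "(\<Sum>y\<in>X. \<bar>r y s\<bar>) \<le> h s + \<alpha> * exp (\<alpha> * T) * (LINT u:{0..T}|lborel. h u)"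
proof -
  define Z where "Z = (\<lambda>y t. LINT u:{0..t}|lborel. D y u)"
  define \<zeta> where "\<zeta> = (\<lambda>t. \<Sum>y\<in>X. \<bar>Z y t\<bar>)"
  have \<alpha>: "\<alpha> \<ge> 0" unfolding \<alpha>_def by (intro sum_nonneg) auto
  have cont: "continuous_on {0..T} \<zeta>"
    unfolding \<zeta>_def Z_def by (intro continuous_intros set_lebesgue_integral_continuous_on int_D)
  have r_le: "(\<Sum>y\<in>X. \<bar>r y t\<bar>) \<le> h t + \<zeta> t" if "t \<in> {0..T}" for t
  proof -
    have "(\<Sum>y\<in>X. \<bar>r y t\<bar>) \<le> (\<Sum>y\<in>X. \<bar>c y\<bar> + \<bar>M y t\<bar> + \<bar>Z y t\<bar>)"
      by (rule sum_mono) (simp add: r[OF _ that] Z_def)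
    then show ?thesis by (simp add: h_def \<zeta>_def sum.distrib)
  qed
  have D_le: "(\<Sum>y\<in>X. \<bar>D y t\<bar>) \<le> \<alpha> * (h t + \<zeta> t)" if "t \<in> {0..T}" for t
  proof -
    have "(\<Sum>y\<in>X. \<bar>D y t\<bar>) \<le> (\<Sum>y\<in>X. \<Sum>u\<in>X. \<bar>a y u\<bar> * (\<Sum>u\<in>X. \<bar>r u t\<bar>))"
    proof (rule sum_mono)
      fix y assume y: "y \<in> X"
      have "\<bar>D y t\<bar> \<le> (\<Sum>u\<in>X. \<bar>a y u\<bar> * \<bar>r u t\<bar>)"
        unfolding D[OF y that] by (rule order_trans[OF sum_abs]) (simp add: abs_mult)
      also have "\<dots> \<le> (\<Sum>u\<in>X. \<bar>a y u\<bar> * (\<Sum>u\<in>X. \<bar>r u t\<bar>))"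
        using X by (intro sum_mono mult_left_mono member_le_sum) auto
      finally show "\<bar>D y t\<bar> \<le> (\<Sum>u\<in>X. \<bar>a y u\<bar> * (\<Sum>u\<in>X. \<bar>r u t\<bar>))" .
    qed
    also have "\<dots> = \<alpha> * (\<Sum>u\<in>X. \<bar>r u t\<bar>)" by (simp add: \<alpha>_def sum_distrib_right)
    also have "\<dots> \<le> \<alpha> * (h t + \<zeta> t)" by (rule mult_left_mono[OF r_le[OF that] \<alpha>])
    finally show ?thesis .
  qed
  have h_nonneg: "h u \<ge> 0" for u unfolding h_def by (intro sum_nonneg) simp
  have int_h: "set_integrable lborel {0..T} h"
    unfolding h_def using int_M integrable_indicator_Icc[of 0 T]
    by (intro set_integral_sum(1) set_integral_add(1) set_integrable_abs) (auto simp: set_integrable_def)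
  have int_\<zeta>: "set_integrable lborel {0..T} \<zeta>" by (rule borel_integrable_atLeastAtMost'[OF cont])
  define H where "H = (LINT u:{0..T}|lborel. h u)"
  \<comment> \<open>The integral of \<open>h\<close> is enlarged from \<open>{0..t}\<close> to
    \<open>{0..T}\<close> so that the term \<open>\<alpha> * H\<close> does not depend on
    \<open>t\<close>.\<close>
  have \<zeta>_le: "\<zeta> t \<le> \<alpha> * H + \<alpha> * integral {0..t} \<zeta>" if t: "t \<in> {0..T}" for t
  proof -
    have sub: "{0..t} \<subseteq> {0..T}" using t by auto
    have i: "set_integrable lborel {0..t} h" "set_integrable lborel {0..t} \<zeta>"
      "\<And>y. y \<in> X \<Longrightarrow> set_integrable lborel {0..t} (D y)"
      using int_h int_\<zeta> int_D by (auto intro: set_integrable_subset[OF _ _ sub])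
    have "\<zeta> t \<le> (\<Sum>y\<in>X. LINT u:{0..t}|lborel. \<bar>D y u\<bar>)"
      unfolding \<zeta>_def Z_def using set_integral_norm_bound[OF i(3)] by (intro sum_mono) simp
    also have "\<dots> = (LINT u:{0..t}|lborel. \<Sum>y\<in>X. \<bar>D y u\<bar>)"
      using i(3) by (intro set_integral_sum(2)[symmetric] set_integrable_abs) auto
    also have "\<dots> \<le> (LINT u:{0..t}|lborel. \<alpha> * (h u + \<zeta> u))"
      using i D_le sub
      by (intro set_integral_mono set_integral_sum(1) set_integrable_abs set_integrable_mult_right set_integral_add(1)) auto
    also have "\<dots> = \<alpha> * (LINT u:{0..t}|lborel. h u) + \<alpha> * (LINT u:{0..t}|lborel. \<zeta> u)"
      using i by (simp add: set_integral_add(2) distrib_left)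
    also have "(LINT u:{0..t}|lborel. \<zeta> u) = integral {0..t} \<zeta>"
      by (rule set_borel_integral_eq_integral(2)[OF i(2)])
    also have "(LINT u:{0..t}|lborel. h u) \<le> H"
      unfolding H_def set_lebesgue_integral_def
      using int_h i(1) sub h_nonneg unfolding set_integrable_def
      by (intro integral_mono) (auto simp: indicator_def)
    finally show ?thesis using \<alpha> by (simp add: mult_left_mono)
  qed
  have "\<zeta> s \<le> (\<alpha> * H) * exp (\<alpha> * s)" by (rule gronwall_continuous[OF cont \<alpha> s \<zeta>_le])
  also have "\<dots> \<le> (\<alpha> * H) * exp (\<alpha> * T)"
  proof (rule mult_left_mono)
    show "exp (\<alpha> * s) \<le> exp (\<alpha> * T)" using s \<alpha> by (simp add: mult_left_mono)
    have "H \<ge> 0" unfolding H_def set_lebesgue_integral_def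
      by (rule Bochner_Integration.integral_nonneg) (simp add: h_nonneg)
    then show "\<alpha> * H \<ge> 0" using \<alpha> by simp
  qed
  finally show ?thesis using r_le[OF s] unfolding H_def by (simp add: mult_ac)
qed

section \<open>Time integrability of the martingales and of polynomials along paths\<close>

context markov_process
begin

text \<open>The upper limit of the inner integral varies with \<open>s\<close>. Expressed as a
  factor of the integrand on a triple product, it leaves a parameter integral over a fixed
  domain.\<close>

lemma gen_process_joint_measurable:
  assumes x: "x \<in> states S" and T: "T \<ge> 0" and f: "f \<in> polys S k" and g: "g \<in> polys S l"
  shows "(\<lambda>(w, s). indicator {0..T} s * gen_process f g x s w) \<in> borel_measurable (Pr x \<Otimes>\<^sub>M lborel)"
proof -
  note [measurable] = joint_measurable_Pr[OF x T f]
  have "(\<lambda>q. (fst (fst q), snd q)) \<in> (Pr x \<Otimes>\<^sub>M lborel) \<Otimes>\<^sub>M lborel \<rightarrow>\<^sub>M Pr x \<Otimes>\<^sub>M (lborel :: real measure)"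
    by measurable
  from measurable_compose[OF this joint_measurable_Pr[OF x T g]]
  have [measurable]: "(\<lambda>q. indicator {0..T} (snd q) * g (fst (fst q) (snd q))) \<in> borel_measurable ((Pr x \<Otimes>\<^sub>M lborel) \<Otimes>\<^sub>M lborel)"
    by simp
  have "(\<lambda>q. (if 0 \<le> snd q \<and> snd q \<le> snd (fst q) then 1 else 0) * (indicator {0..T} (snd q) * g (fst (fst q) (snd q))))
      \<in> borel_measurable ((Pr x \<Otimes>\<^sub>M lborel) \<Otimes>\<^sub>M (lborel :: real measure))"
    by measurable
  then have [measurable]: "(\<lambda>ws. \<integral>u. (if 0 \<le> u \<and> u \<le> snd ws then 1 else 0) * (indicator {0..T} u * g (fst ws u)) \<partial>lborel)
      \<in> borel_measurable (Pr x \<Otimes>\<^sub>M (lborel :: real measure))"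
    by (intro lborel.borel_measurable_lebesgue_integral) (simp add: case_prod_beta)
  have "(\<lambda>ws. (case ws of (w, s) \<Rightarrow> indicator {0..T} s * f (w s)) - indicator {0..T} (snd ws) * f x
      - indicator {0..T} (snd ws) * (\<integral>u. (if 0 \<le> u \<and> u \<le> snd ws then 1 else 0) * (indicator {0..T} u * g (fst ws u)) \<partial>lborel))
      \<in> borel_measurable (Pr x \<Otimes>\<^sub>M lborel)"
    by measurable
  also have "(\<lambda>ws. (case ws of (w, s) \<Rightarrow> indicator {0..T} s * f (w s)) - indicator {0..T} (snd ws) * f x
      - indicator {0..T} (snd ws) * (\<integral>u. (if 0 \<le> u \<and> u \<le> snd ws then 1 else 0) * (indicator {0..T} u * g (fst ws u)) \<partial>lborel))
    = (\<lambda>(w, s). indicator {0..T} s * gen_process f g x s w)"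
  proof (rule ext)
    fix ws :: "'n path \<times> real"
    obtain w s where ws: "ws = (w, s)" by fastforce
    have "(\<integral>u. (if 0 \<le> u \<and> u \<le> s then 1 else 0) * (indicator {0..T} u * g (w u)) \<partial>lborel) = (LINT u:{0..s}|lborel. g (w u))"
      if "s \<in> {0..T}"
      unfolding set_lebesgue_integral_def using that
      by (intro Bochner_Integration.integral_cong) (auto simp: indicator_def)
    then show "(case ws of (w, s) \<Rightarrow> indicator {0..T} s * f (w s)) - indicator {0..T} (snd ws) * f x
      - indicator {0..T} (snd ws) * (\<integral>u. (if 0 \<le> u \<and> u \<le> snd ws then 1 else 0) * (indicator {0..T} u * g (fst ws u)) \<partial>lborel)
      = (case ws of (w, s) \<Rightarrow> indicator {0..T} s * gen_process f g x s w)"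
      unfolding ws gen_process_def by (simp add: indicator_def)
  qed
  finally show ?thesis .
qed

end

context markov_moments
begin

lemma martingale_abs_mono:
  assumes x: "x \<in> states S" and M: "martingale (Pr x) F M" and st: "0 \<le> s" "s \<le> t"
  shows "(\<integral>w. \<bar>M s w\<bar> \<partial>Pr x) \<le> (\<integral>w. \<bar>M t w\<bar> \<partial>Pr x)"
proof -
  interpret sigma_finite_subalgebra "Pr x" "F s" by (rule sigma_finite_subalgebra_F[OF x st(1)])
  have int: "integrable (Pr x) (M s)" "integrable (Pr x) (M t)" using M st unfolding martingale_def by auto
  have "AE w in Pr x. real_cond_exp (Pr x) (F s) (M t) w = M s w" using M st unfolding martingale_def by auto
  then have "(\<integral>w. \<bar>M s w\<bar> \<partial>Pr x) = (\<integral>w. \<bar>real_cond_exp (Pr x) (F s) (M t) w\<bar> \<partial>Pr x)"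
    by (intro integral_cong_AE) (use int in auto)
  then show ?thesis using real_cond_exp_L1_contraction[OF int(2)] by simp
qed

text \<open>By \<open>martingale_abs_mono\<close> each time in \<open>{0..T}\<close> contributes at
  most the mean absolute value at \<open>T\<close>, so \<open>T\<close> times that value bounds the
  double integral.\<close>

lemma martingale_occupation_finite:
  assumes x: "x \<in> states S" and T: "T \<ge> 0" and f: "f \<in> polys S k" and g: "g \<in> polys S l"
    and M: "martingale (Pr x) F (gen_process f g x)"
  shows "(\<integral>\<^sup>+ w. \<integral>\<^sup>+ s. ennreal \<bar>indicator {0..T} s * gen_process f g x s w\<bar> \<partial>lborel \<partial>Pr x) < \<infinity>"
proof -
  interpret Pr: prob_space "Pr x" by (rule prob_space_Pr[OF x])
  interpret pair_sigma_finite "Pr x" lborel by unfold_locales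
  note [measurable] = gen_process_joint_measurable[OF x T f g]
  let ?C = "\<integral>w. \<bar>gen_process f g x T w\<bar> \<partial>Pr x"
  have "(\<integral>\<^sup>+ w. ennreal \<bar>indicator {0..T} s * gen_process f g x s w\<bar> \<partial>Pr x) \<le> ennreal ?C * indicator {0..T} s" for s
  proof (cases "s \<in> {0..T}")
    case True
    then have "integrable (Pr x) (gen_process f g x s)" using M unfolding martingale_def by auto
    then have "(\<integral>\<^sup>+ w. ennreal \<bar>gen_process f g x s w\<bar> \<partial>Pr x) = ennreal (\<integral>w. \<bar>gen_process f g x s w\<bar> \<partial>Pr x)"
      by (intro nn_integral_eq_integral) auto
    then show ?thesis using True martingale_abs_mono[OF x M, of s T] by (simp add: ennreal_leI)
  qed simp
  then have "(\<integral>\<^sup>+ s. \<integral>\<^sup>+ w. ennreal \<bar>indicator {0..T} s * gen_process f g x s w\<bar> \<partial>Pr x \<partial>lborel) \<le> (\<integral>\<^sup>+ s. ennreal ?C * indicator {0..T} s \<partial>lborel)"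
    by (intro nn_integral_mono)
  also have "\<dots> = ennreal ?C * ennreal T"
    using T by (subst nn_integral_cmult_indicator) auto
  also have "\<dots> < \<infinity>" by (simp add: ennreal_mult_less_top)
  finally show ?thesis
    using Fubini'[of "\<lambda>w s. ennreal \<bar>indicator {0..T} s * gen_process f g x s w\<bar>"] by simp
qed


text \<open>Moments are finite at each time, but no bound uniform in time is known yet. Node values
  along a path solve a linear integral equation driven by the martingales, so
  \<open>pathwise_gronwall\<close> transfers the time integrability of the martingales to
  \<open>f\<close>.\<close>

lemma occupation_integrable_martingale:
  assumes x: "x \<in> states S" and T: "T \<ge> 0" and k: "k \<le> m"
    and nodal: "nodal_space (polys S k) X e" and d: "\<And>y. y \<in> X \<Longrightarrow> d y \<in> polys S k"
    and mart: "\<And>y. y \<in> X \<Longrightarrow> martingale (Pr x) F (gen_process (e y) (d y) x)"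
    and int_d: "\<And>y. y \<in> X \<Longrightarrow> AE w in Pr x. set_integrable lborel {0..T} (\<lambda>s. d y (w s))"
    and f: "f \<in> polys S k"
  shows "integrable (Pr x \<Otimes>\<^sub>M lborel) (\<lambda>(w, s). indicator {0..T} s * f (w s))"
proof -
  interpret nodal_space "polys S k" X e by (rule nodal)
  interpret Pr: prob_space "Pr x" by (rule prob_space_Pr[OF x])
  interpret pair_sigma_finite "Pr x" lborel by unfold_locales
  define M where "M = (\<lambda>y s w. gen_process (e y) (d y) x s w)"
  define h where "h = (\<lambda>w s. \<Sum>y\<in>X. \<bar>e y x\<bar> + \<bar>M y s w\<bar>)"
  define \<alpha> where "\<alpha> = (\<Sum>y\<in>X. \<Sum>u\<in>X. \<bar>d y u\<bar>)"
  define H where "H = (\<lambda>w. LINT u:{0..T}|lborel. h w u)"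
  have \<alpha>: "\<alpha> \<ge> 0" unfolding \<alpha>_def by (intro sum_nonneg) auto
  have h0: "h w s \<ge> 0" for w s unfolding h_def by (intro sum_nonneg) simp
  have int_M: "integrable (Pr x \<Otimes>\<^sub>M lborel) (\<lambda>(w, s). indicator {0..T} s * M y s w)" if y: "y \<in> X" for y
  proof (rule integrableI_bounded)
    note [measurable] = gen_process_joint_measurable[OF x T basis_in[OF y] d[OF y]]
    show "(\<lambda>(w, s). indicator {0..T} s * M y s w) \<in> borel_measurable (Pr x \<Otimes>\<^sub>M lborel)"
      unfolding M_def by measurable
    have "(\<integral>\<^sup>+ ws. ennreal (norm (case ws of (w, s) \<Rightarrow> indicator {0..T} s * M y s w)) \<partial>(Pr x \<Otimes>\<^sub>M lborel))
      = (\<integral>\<^sup>+ w. \<integral>\<^sup>+ s. ennreal \<bar>indicator {0..T} s * M y s w\<bar> \<partial>lborel \<partial>Pr x)"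
      unfolding M_def by (subst lborel.nn_integral_fst[symmetric]) auto
    then show "(\<integral>\<^sup>+ ws. ennreal (norm (case ws of (w, s) \<Rightarrow> indicator {0..T} s * M y s w)) \<partial>(Pr x \<Otimes>\<^sub>M lborel)) < \<infinity>"
      using martingale_occupation_finite[OF x T basis_in[OF y] d[OF y] mart[OF y]] by (simp add: M_def)
  qed
  have const: "integrable (Pr x \<Otimes>\<^sub>M lborel) (\<lambda>(w, s). indicator {0..T} s * (c::real))" for c
  proof -
    have "emeasure (Pr x \<Otimes>\<^sub>M lborel) (space (Pr x) \<times> {0..T}) = emeasure (Pr x) (space (Pr x)) * emeasure lborel {0..T}"
      by (rule lborel.emeasure_pair_measure_Times) auto
    then have "emeasure (Pr x \<Otimes>\<^sub>M lborel) (space (Pr x) \<times> {0..T}) < \<infinity>"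
      using T by (simp add: Pr.emeasure_space_1)
    then have "integrable (Pr x \<Otimes>\<^sub>M lborel) (\<lambda>q. indicator (space (Pr x) \<times> {0..T}) q * c)"
      by (intro integrable_mult_left integrable_real_indicator) auto
    then show ?thesis
      by (rule Bochner_Integration.integrable_cong[THEN iffD1, rotated 2])
        (auto simp: space_pair_measure indicator_def)
  qed
  have int_h: "integrable (Pr x \<Otimes>\<^sub>M lborel) (\<lambda>(w, s). indicator {0..T} s * h w s)"
  proof -
    have "integrable (Pr x \<Otimes>\<^sub>M lborel) (\<lambda>q. \<Sum>y\<in>X. (case q of (w, s) \<Rightarrow> indicator {0..T} s * \<bar>e y x\<bar>)
        + \<bar>case q of (w, s) \<Rightarrow> indicator {0..T} s * M y s w\<bar>)"
      using int_M const by (intro Bochner_Integration.integrable_sum Bochner_Integration.integrable_add integrable_abs) auto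
    also have "(\<lambda>q. \<Sum>y\<in>X. (case q of (w, s) \<Rightarrow> indicator {0..T} s * \<bar>e y x\<bar>)
        + \<bar>case q of (w, s) \<Rightarrow> indicator {0..T} s * M y s w\<bar>) = (\<lambda>(w, s). indicator {0..T} s * h w s)"
      by (auto simp: fun_eq_iff h_def sum_distrib_left distrib_left abs_mult)
    finally show ?thesis .
  qed
  have int_H: "integrable (Pr x) H"
    using integrable_fst'[OF int_h] by (simp add: H_def[abs_def] set_lebesgue_integral_def)
  have AE_M: "AE w in Pr x. \<forall>y\<in>X. set_integrable lborel {0..T} (\<lambda>s. M y s w)"
    using AE_integrable_fst'[OF int_M] finite_nodes by (intro AE_finite_allI) (auto simp: set_integrable_def)
  have AE_d: "AE w in Pr x. \<forall>y\<in>X. set_integrable lborel {0..T} (\<lambda>s. d y (w s))"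
    using int_d finite_nodes by (intro AE_finite_allI) auto
  have AE_h: "AE w in Pr x. set_integrable lborel {0..T} (h w)"
    using AE_integrable_fst'[OF int_h] by (simp add: set_integrable_def)
  define N where "N = (\<Sum>y\<in>X. \<bar>f y\<bar>)"
  \<comment> \<open>Integrating \<open>N * (h w s + \<alpha> * exp (\<alpha> * T) * H w)\<close>
    over \<open>s\<close> in \<open>{0..T}\<close> gives \<open>C * H w\<close>, as
    \<open>h w\<close> integrates to \<open>H w\<close>.\<close>
  define C where "C = N * (1 + \<alpha> * exp (\<alpha> * T) * T)"
  have bound: "AE w in Pr x. (\<integral>\<^sup>+ s. ennreal \<bar>indicator {0..T} s * f (w s)\<bar> \<partial>lborel) \<le> ennreal (C * H w)"
    using AE_M AE_d AE_h
  proof eventually_elim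
    case (elim w)
    have N: "N \<ge> 0" unfolding N_def by (intro sum_nonneg) simp
    have H: "H w \<ge> 0" unfolding H_def set_lebesgue_integral_def
      by (rule Bochner_Integration.integral_nonneg) (simp add: h0)
    define b where "b = \<alpha> * exp (\<alpha> * T) * H w"
    have b: "b \<ge> 0" using \<alpha> H by (simp add: b_def)
    have le: "(\<Sum>y\<in>X. \<bar>e y (w s)\<bar>) \<le> h w s + b" if s: "s \<in> {0..T}" for s
      unfolding b_def h_def H_def \<alpha>_def
    \<comment> \<open>The coefficients of the linear system are the node values
      \<open>d y u\<close>, because \<open>d y\<close> lies in the same nodal space as the
      \<open>e y\<close>.\<close>
    proof (rule pathwise_gronwall[OF finite_nodes T _ _ _ _ s, where D = "\<lambda>y s. d y (w s)" and r = "\<lambda>y s. e y (w s)"])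
      fix y s assume y: "y \<in> X"
      show "e y (w s) = e y x + M y s w + (LINT u:{0..s}|lborel. d y (w u))"
        by (simp add: M_def gen_process_def)
      show "d y (w s) = (\<Sum>u\<in>X. d y u * e u (w s))" by (rule expansion[OF d[OF y]])
    qed (use elim in auto)
    have f_le: "\<bar>indicator {0..T} s * f (w s)\<bar> \<le> N * (indicator {0..T} s * (h w s + b))" for s
    proof (cases "s \<in> {0..T}")
      case True
      have "\<bar>f (w s)\<bar> \<le> N * (\<Sum>y\<in>X. \<bar>e y (w s)\<bar>)"
        unfolding N_def by (rule linear_bound[OF linear_map_on_id f])
      also have "\<dots> \<le> N * (h w s + b)" by (rule mult_left_mono[OF le[OF True] N])
      finally show ?thesis using True by simp
    qed simp
    have i: "integrable lborel (\<lambda>s. indicator {0..T} s * h w s)" "integrable lborel (\<lambda>s. indicator {0..T} s * b)"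
      using elim(3) integrable_indicator_Icc[of 0 T] by (auto simp: set_integrable_def)
    have "(\<integral>\<^sup>+ s. ennreal \<bar>indicator {0..T} s * f (w s)\<bar> \<partial>lborel) \<le> (\<integral>\<^sup>+ s. ennreal (N * (indicator {0..T} s * (h w s + b))) \<partial>lborel)"
      by (intro nn_integral_mono ennreal_leI f_le)
    also have "\<dots> = ennreal (\<integral>s. N * (indicator {0..T} s * (h w s + b)) \<partial>lborel)"
      using i N h0 b by (intro nn_integral_eq_integral) (auto simp: distrib_left)
    also have "(\<integral>s. N * (indicator {0..T} s * (h w s + b)) \<partial>lborel) = N * (H w + T * b)"
      using i T by (simp add: H_def set_lebesgue_integral_def distrib_left)
    also have "\<dots> = C * H w" by (simp add: C_def b_def algebra_simps)
    finally show ?case .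
  qed
  have C: "C \<ge> 0"
    unfolding C_def N_def using \<alpha> T by (intro mult_nonneg_nonneg sum_nonneg add_nonneg_nonneg) auto
  have "(\<integral>\<^sup>+ w. \<integral>\<^sup>+ s. ennreal \<bar>indicator {0..T} s * f (w s)\<bar> \<partial>lborel \<partial>Pr x) \<le> (\<integral>\<^sup>+ w. ennreal (C * H w) \<partial>Pr x)"
    by (rule nn_integral_mono_AE[OF bound])
  also have "\<dots> \<le> (\<integral>\<^sup>+ w. ennreal (norm (C * H w)) \<partial>Pr x)"
    by (intro nn_integral_mono ennreal_leI) simp
  also have "\<dots> < \<infinity>"
    using integrable_mult_right[OF int_H, of C] unfolding integrable_iff_bounded by simp
  finally have fin: "(\<integral>\<^sup>+ w. \<integral>\<^sup>+ s. ennreal \<bar>indicator {0..T} s * f (w s)\<bar> \<partial>lborel \<partial>Pr x) < \<infinity>" .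
  note [measurable] = joint_measurable_Pr[OF x T f]
  show ?thesis
    using fin Fubini'[of "\<lambda>w s. ennreal \<bar>indicator {0..T} s * f (w s)\<bar>"]
    by (intro occupation_integrable[OF x T f]) simp
qed

text \<open>Linearity of the expectation under the nodal expansion. It makes \<open>P t\<close> at
  one \<open>x\<close> a finite combination before \<open>P t\<close> is known to preserve
  \<open>polys S k\<close>, and supplies the hypothesis \<open>expand\<close> of
  \<open>exp_map_unique\<close>.\<close>

lemma semigroup_expansion:
  assumes nodal: "nodal_space (polys S k) X e" and k: "k \<le> m" and x: "x \<in> states S" and t: "t \<ge> 0" and f: "f \<in> polys S k"
  shows "P t f x = (\<Sum>y\<in>X. f y * P t (e y) x)"
proof -
  interpret nodal_space "polys S k" X e by (rule nodal)
  have e: "e y \<in> polys S m" if "y \<in> X" for y using basis_in[OF that] polys_mono[OF k] by blast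
  have "P t f x = (\<integral>w. f (w t) \<partial>Pr x)" by (rule semigroup_eq[OF x t f])
  also have "\<dots> = (\<integral>w. (\<Sum>y\<in>X. f y * e y (w t)) \<partial>Pr x)"
    by (rule arg_cong[where f = "integral\<^sup>L (Pr x)"], rule ext, rule expansion[OF f])
  also have "\<dots> = (\<Sum>y\<in>X. \<integral>w. f y * e y (w t) \<partial>Pr x)"
    by (intro Bochner_Integration.integral_sum integrable_mult_right moments e x t)
  also have "\<dots> = (\<Sum>y\<in>X. f y * P t (e y) x)"
    by (intro sum.cong refl) (simp add: semigroup_eq[OF x t basis_in])
  finally show ?thesis .
qed

text \<open>The martingale has equal expectations at times 0 and \<open>t\<close>, the former being
  0 by \<open>semigroup_zero_time\<close>; Fubini moves the expectation inside the time
  integral.\<close>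

lemma martingale_dynkin:
  assumes x: "x \<in> states S" and t: "t \<ge> 0" and f: "f \<in> polys S m" and g: "g \<in> polys S m"
    and mart: "martingale (Pr x) F (gen_process f g x)"
    and occ: "\<And>T. T \<ge> 0 \<Longrightarrow> integrable (Pr x \<Otimes>\<^sub>M lborel) (\<lambda>(w, s). indicator {0..T} s * g (w s))"
  shows "P t f x = f x + integral {0..t} (\<lambda>s. P s g x)" "(\<lambda>s. P s g x) integrable_on {0..t}"
proof -
  interpret Pr: prob_space "Pr x" by (rule prob_space_Pr[OF x])
  interpret sigma_finite_subalgebra "Pr x" "F 0" by (rule sigma_finite_subalgebra_F[OF x order_refl])
  have fub: "integrable (Pr x) (\<lambda>w. LINT s:{0..u}|lborel. g (w s))"
    "(\<integral>w. (LINT s:{0..u}|lborel. g (w s)) \<partial>Pr x) = integral {0..u} (\<lambda>s. P s g x)"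
    "(\<lambda>s. P s g x) integrable_on {0..u}" if u: "u \<ge> 0" for u
  proof -
    note fub = occupation_fubini[OF x u g occ[OF u] sets.top]
    show "integrable (Pr x) (\<lambda>w. LINT s:{0..u}|lborel. g (w s))" by (rule fub(2))
    have eq: "integral {0..u} (\<lambda>s. LINT w:space (Pr x)|Pr x. g (w s)) = integral {0..u} (\<lambda>s. P s g x)"
      by (rule integral_cong) (simp add: set_integral_space moments g x semigroup_eq[OF x _ g])
    show "(\<integral>w. (LINT s:{0..u}|lborel. g (w s)) \<partial>Pr x) = integral {0..u} (\<lambda>s. P s g x)"
      using fub(4) set_borel_integral_eq_integral(2)[OF fub(3)] eq fub(2) by (simp add: set_integral_space)
    show "(\<lambda>s. P s g x) integrable_on {0..u}"
      using set_borel_integral_eq_integral(1)[OF fub(3)]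
      by (rule integrable_eq) (simp add: set_integral_space moments g x semigroup_eq[OF x _ g])
  qed
  have M: "(\<integral>w. gen_process f g x u w \<partial>Pr x) = P u f x - f x - integral {0..u} (\<lambda>s. P s g x)" if u: "u \<ge> 0" for u
    unfolding gen_process_def fub(2)[OF u, symmetric] semigroup_eq[OF x u f]
    using moments[OF f x u] fub(1)[OF u] by (simp add: Pr.prob_space)
  have int: "integrable (Pr x) (gen_process f g x u)" if "u \<ge> 0" for u
    using mart that unfolding martingale_def by blast
  have "AE w in Pr x. real_cond_exp (Pr x) (F 0) (gen_process f g x t) w = gen_process f g x 0 w"
    using mart t unfolding martingale_def by auto
  then have "(\<integral>w. real_cond_exp (Pr x) (F 0) (gen_process f g x t) w \<partial>Pr x) = (\<integral>w. gen_process f g x 0 w \<partial>Pr x)"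
    using int[of 0] by (intro integral_cong_AE) auto
  then have "(\<integral>w. gen_process f g x t w \<partial>Pr x) = (\<integral>w. gen_process f g x 0 w \<partial>Pr x)"
    using real_cond_exp_int(2)[OF int[OF t]] by simp
  then show "P t f x = f x + integral {0..t} (\<lambda>s. P s g x)"
    unfolding M[OF t] M[OF order_refl] using semigroup_zero_time[OF f] by simp
  show "(\<lambda>s. P s g x) integrable_on {0..t}" by (rule fub(3)[OF t])
qed

end

lemma (in markov_process) semigroup_is_exp_if_martingale_generator_condition:
  assumes "martingale_generator_condition S p F Pr m"
  shows "semigroup_is_exp S p m"
proof -
  have fin: "transition_semigroup_abs S p t f x < \<infinity>" if "f \<in> polys S m" "x \<in> states S" "t \<ge> 0" for f x t
    using assms that unfolding martingale_generator_condition_def by blast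
  interpret markov_moments S p F Pr m by (rule markov_momentsI[OF fin])
  have "\<exists>G. extended_generator S F Pr G \<and> polys S m \<subseteq> generator_domain S F Pr \<and>
      (\<forall>f\<in>polys S m. \<forall>x\<in>states S. martingale (Pr x) F (gen_process f (G f) x)) \<and>
      (\<forall>k\<le>m. G ` polys S k \<subseteq> polys S k)"
    using assms unfolding martingale_generator_condition_def by (rule conjunct2)
  then obtain G where gen: "extended_generator S F Pr G" and dom: "polys S m \<subseteq> generator_domain S F Pr"
    and mart: "\<forall>f\<in>polys S m. \<forall>x\<in>states S. martingale (Pr x) F (gen_process f (G f) x)"
    and inv: "\<forall>k\<le>m. G ` polys S k \<subseteq> polys S k"
    by (elim exE conjE)
  have G_mart: "martingale (Pr x) F (gen_process f (G f) x)" if "f \<in> polys S m" "x \<in> states S" for f x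
    using mart that by simp
  have G_in: "G f \<in> polys S k" if "k \<le> m" "f \<in> polys S k" for k f
    using inv that by (simp add: image_subset_iff)
  have int_G: "AE w in Pr x. \<forall>t\<ge>0. set_integrable lborel {0..t} (\<lambda>s. G f (w s))"
    if "f \<in> polys S m" "x \<in> states S" for f x
  proof -
    have "generator_rel S F Pr f (G f)"
      using gen dom that(1) unfolding extended_generator_def by (simp add: subset_iff)
    then show ?thesis using that(2) unfolding generator_rel_def by simp
  qed
  show ?thesis
    unfolding semigroup_is_exp_def
  proof (intro allI impI)
    fix k assume k: "k \<le> m"
    have sub: "f \<in> polys S m" if "f \<in> polys S k" for f using polys_mono[OF k] that by blast
    obtain X e where nodal: "nodal_space (polys S k) X e" by (rule nodal_space_polys)
    then interpret nodal_space "polys S k" X e .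
    have d: "G (e y) \<in> polys S k" if "y \<in> X" for y by (rule G_in[OF k basis_in[OF that]])
    define A where "A = (\<lambda>f x. \<Sum>y\<in>X. f y * G (e y) x)"
    have A: "linear_map_on (polys S k) A" unfolding A_def by (rule linear_map_from_basis[OF d])
    have "P t f x = exp_map t A f x" if f: "f \<in> polys S k" and t: "t \<ge> 0" for f x t
    proof (cases "x \<in> states S")
      case False
      then show ?thesis
        using polys_outside[OF exp_map_in[OF A f] False] by (simp add: semigroup_outside)
    next
      case x: True
      have occ: "integrable (Pr x \<Otimes>\<^sub>M lborel) (\<lambda>(w, s). indicator {0..T} s * f (w s))"
        if T: "T \<ge> 0" and f: "f \<in> polys S k" for T f
      proof (rule occupation_integrable_martingale[OF x T k nodal d _ _ f])
        fix y assume y: "y \<in> X"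
        show "martingale (Pr x) F (gen_process (e y) (G (e y)) x)" by (rule G_mart[OF sub[OF basis_in[OF y]] x])
        show "AE w in Pr x. set_integrable lborel {0..T} (\<lambda>s. G (e y) (w s))"
          using int_G[OF sub[OF basis_in[OF y]] x] by eventually_elim (use T in blast)
      qed
      have dynkin: "P t (e y) x = e y x + integral {0..t} (\<lambda>s. P s (G (e y)) x)"
        "(\<lambda>s. P s (G (e y)) x) integrable_on {0..t}" if y: "y \<in> X" and t: "t \<ge> 0" for y t
        using martingale_dynkin[OF x t sub[OF basis_in[OF y]] sub[OF d[OF y]] G_mart[OF sub[OF basis_in[OF y]] x]
            occ[OF _ d[OF y]]] by blast+
      \<comment> \<open>Regularity is gained in two rounds. \<open>dynkin\<close> shows
        \<open>P s (e y) x\<close> as an indefinite integral, hence continuous in \<open>s\<close>.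
        Since \<open>G (e y)\<close> is a combination of basis functions, the integrand is then
        continuous as well, and the integral is differentiable.\<close>
      have cont_e: "continuous_on {0..} (\<lambda>s. P s (e y) x)" if y: "y \<in> X" for y
      proof -
        have "continuous_on {0..T} (\<lambda>s. P s (e y) x)" if T: "T \<ge> 0" for T
        proof (rule continuous_on_eq)
          show "continuous_on {0..T} (\<lambda>t. e y x + integral {0..t} (\<lambda>s. P s (G (e y)) x))"
            by (intro continuous_intros indefinite_integral_continuous_1 dynkin(2) y T)
          show "e y x + integral {0..t} (\<lambda>s. P s (G (e y)) x) = P t (e y) x" if "t \<in> {0..T}" for t
            using dynkin(1)[OF y, of t] that by simp
        qed
        \<comment> \<open>Continuity at \<open>u\<close> is tested on \<open>{0..u + 1}\<close>,
          which contains a neighbourhood of \<open>u\<close> relative to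
          \<open>{0..}\<close>.\<close>
        from this[of "_ + 1"] show ?thesis
          unfolding continuous_on_eq_continuous_within
        proof (intro ballI)
          fix u :: real assume u: "u \<in> {0..}"
            and c: "\<And>T. 0 \<le> T + 1 \<Longrightarrow> \<forall>v\<in>{0..T + 1}. continuous (at v within {0..T + 1}) (\<lambda>s. P s (e y) x)"
          have "continuous (at u within {0..u + 1}) (\<lambda>s. P s (e y) x)" using c[of u] u by simp
          moreover have "at u within {0..u + 1} = at u within {0..}"
            using u by (intro at_within_nhd[of u "{..<u + 1}"]) auto
          ultimately show "continuous (at u within {0..}) (\<lambda>s. P s (e y) x)" by simp
        qed
      qed
      have cont: "continuous_on {0..} (\<lambda>s. P s f x)" if f: "f \<in> polys S k" for f
      proof (rule continuous_on_eq)
        show "continuous_on {0..} (\<lambda>s. \<Sum>y\<in>X. f y * P s (e y) x)" by (intro continuous_intros cont_e)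
        show "(\<Sum>y\<in>X. f y * P s (e y) x) = P s f x" if "s \<in> {0..}" for s
          using that by (intro semigroup_expansion[OF nodal k x _ f, symmetric]) simp
      qed
      have der: "((\<lambda>t. P t (e y) x) has_real_derivative P t (G (e y)) x) (at t within {0..})" if y: "y \<in> X" and t: "t \<ge> 0" for y t
      proof (rule has_derivative_transform_atLeast[OF _ _ t])
        show "((\<lambda>t. e y x + integral {0..t} (\<lambda>s. P s (G (e y)) x)) has_real_derivative P t (G (e y)) x) (at t within {0..})"
          using DERIV_add[OF DERIV_const antiderivative_atLeast[OF cont[OF d[OF y]] t]] by simp
        show "P s (e y) x = e y x + integral {0..s} (\<lambda>u. P u (G (e y)) x)" if "s \<ge> 0" for s
          by (rule dynkin(1)[OF y that])
      qed
      show ?thesis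
      proof (rule exp_map_unique[where \<phi> = "\<lambda>t f. P t f x", OF A semigroup_expansion[OF nodal k x] _ _ f t])
        show "P 0 f x = f x" if "f \<in> polys S k" for f using semigroup_zero_time[OF sub[OF that]] by simp
        show "((\<lambda>t. P t f x) has_real_derivative P t (A f) x) (at t within {0..})"
          if f: "f \<in> polys S k" and t: "t \<ge> 0" for f t
        proof (rule has_derivative_transform_atLeast[OF _ semigroup_expansion[OF nodal k x _ f] t])
          have "P t (A f) x = (\<Sum>y\<in>X. f y * P t (G (e y)) x)"
          proof -
            have Gm: "integrable (Pr x) (\<lambda>w. f y * G (e y) (w t))" if "y \<in> X" for y
              by (intro integrable_mult_right moments sub d that x t)
            have "P t (A f) x = (\<integral>w. A f (w t) \<partial>Pr x)"
              by (rule semigroup_eq[OF x t linear_mapD(1)[OF A f]])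
            also have "\<dots> = (\<Sum>y\<in>X. f y * P t (G (e y)) x)"
              unfolding A_def using Gm
              by (subst Bochner_Integration.integral_sum) (auto simp: semigroup_eq[OF x t d] intro!: sum.cong)
            finally show ?thesis .
          qed
          then show "((\<lambda>t. \<Sum>y\<in>X. f y * P t (e y) x) has_real_derivative P t (A f) x) (at t within {0..})"
            by (simp only:) (rule DERIV_sum, rule DERIV_cmult, rule der[OF _ t])
        qed
      qed
    qed
    then have "P t f = exp_map t A f" if "f \<in> polys S k" "t \<ge> 0" for f t using that by (intro ext)
    then show "\<exists>A. linear_map_on (polys S k) A \<and> (\<forall>t\<ge>0. \<forall>f\<in>polys S k.
        (\<forall>x\<in>states S. transition_semigroup_abs S p t f x < \<infinity>) \<and> P t f = exp_map t A f)"
      using A fin sub by (intro exI[of _ A]) simp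
  qed
qed

theorem theorem2p7:
  fixes S :: "(real ^ 'n::finite) set"
    and p :: "real \<Rightarrow> 'n state \<Rightarrow> 'n state measure"
    and F :: "real \<Rightarrow> 'n path measure"
    and Pr :: "'n state \<Rightarrow> 'n path measure"
    and m :: nat
  assumes "markov_process S p F Pr"
  shows "(m_polynomial S p m \<longleftrightarrow> semigroup_is_exp S p m) \<and>
         (semigroup_is_exp S p m \<longleftrightarrow> martingale_generator_condition S p F Pr m)"
  using m_polynomial_if_semigroup_is_exp
    markov_process.semigroup_is_exp_if_m_polynomial[OF assms]
    markov_process.martingale_generator_condition_if_semigroup_is_exp[OF assms]
    markov_process.semigroup_is_exp_if_martingale_generator_condition[OF assms]
  by blast

end
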